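(* Let $0<\alpha<1$, $\rho_0,\rho_1>0$, $u_0,u_1\in\mathbb{R}$, and consider the generalized Chaplygin gas system $$\partial_t\rho+\partial_x(\rho u)=0,\qquad \partial_t(\rho u)+\partial_x\Big(\rho u^2-\frac{1}{\rho^{\alpha}}\Big)=0$$ with Riemann initial data $(\rho,u)(x,0)=(\rho_0,u_0)$ for $x<0$ and $(\rho,u)(x,0)=(\rho_1,u_1)$ for $x>0$. The solution of this Riemann problem is a combination of classical elementary waves (shock and rarefaction waves) if $$u_1>u_0-\rho_0^{-\frac{1+\alpha}{2}}-\rho_1^{-\frac{1+\alpha}{2}},$$ and it is a shadow wave otherwise. In each of the two cases the indicated solution satisfies the energy admissibility condition.
   Context: Eigenvalues: $\lambda_{1}(\rho,u)=u-\sqrt{\alpha}\rho^{-\frac{1+\alpha}{2}}<\lambda_2(\rho,u)=u+\sqrt{\alpha}\rho^{-\frac{1+\alpha}{2}}$; both characteristic fields are genuinely nonlinear. Notation: $[g]=g(\rho_1,u_1)-g(\rho_0,u_0)$. Energy pair: $\eta(\rho,u)=\frac12\rho u^2+\frac{1}{1+\alpha}\rho^{-\alpha}$, $Q(\rho,u)=\frac12\rho u^3-\frac{\alpha}{1+\alpha}\rho^{-\alpha}u$. Shadow wave: a net of piecewise constant functions ($\varepsilon\to0$) $$U^\varepsilon(x,t)=\begin{cases}(\rho_0,u_0),& x<ct-\frac{\varepsilon}{2}t\\(\rho_\varepsilon,u_\varepsilon),& ct-\frac{\varepsilon}{2}t<x<ct+\frac{\varepsilon}{2}t\\(\rho_1,u_1),&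 x>ct+\frac{\varepsilon}{2}t\end{cases}$$ that satisfies the system in the limit $\varepsilon\to0$ in the sense of distributions, with $\rho_\varepsilon\sim\varepsilon^{-1}$. For this system such a wave has $u_\varepsilon\to c$, $$\kappa_1=\lim_{\varepsilon\to0}\varepsilon\rho_\varepsilon=\sqrt{\rho_0\rho_1(u_0-u_1)^2-(\rho_0-\rho_1)(\rho_1^{-\alpha}-\rho_0^{-\alpha})},$$ and speed $c=\frac{u_1\rho_1-u_0\rho_0+\kappa_1}{\rho_1-\rho_0}$ if $\rho_0\ne\rho_1$, $c=\frac12(u_0+u_1)$ if $\rho_0=\rho_1$. It is overcompressive if $\lambda_i(\rho_0,u_0)\ge c\ge\lambda_i(\rho_1,u_1)$ for $i=1,2$. The weak solutions of the Riemann problem under consideration are the combinations of classical (admissible) elementary waves and the overcompressive shadow waves. Local energy production: for a shock with speed $s$ and left/right states $U_l,U_r$ it is $-s(\eta(U_r)-\eta(U_l))+Q(U_r)-Q(U_l)$; for a rarefaction wave it is $0$; for the shadow wave it is $-c[\eta]+[Q]+\lim_{\varepsilon\to0}\varepsilon\eta(\rho_\varepsilon,u_\varepsilon)=-c[\eta]+[Q]+\frac12c^2\kappa_1$. The local energy production $\mathcal D$ of a solution is the sum over its waves. Energy admissibility condition: let $\bar\eta=\eta+a_1\rho+a_2\rho u$ and $\bar Q=Q+a_1\rho u+a_2(\rho u^2-\rho^{-\alpha})+\bar c$ with constants chosen so that $\bar Q(\rho_0,u_0)=\bar Q(\rho_1,u_1)=0$, let $L$ be large, and let $\bar H_{[-L,L]}(U(\cdot,t))=\int_{-L}^{L}\bar\eta(U(x,t))\,dx$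 (the limit as $\varepsilon\to0$ of the corresponding integrals in the case of a shadow wave). A solution $U$ satisfies the energy admissibility condition if it minimizes $\frac{d}{dt}\bar H_{[-L,L]}(U(\cdot,t))\big|_{t=t_0+0}$ (here $t_0=0$) among the weak solutions. The local energy production is invariant under the affine change of the pair $(\eta,Q)$ to $(\bar\eta,\bar Q)$ with $\bar\eta=\eta+a_1\rho+a_2\rho u$, $\bar Q=Q+a_1\rho u+a_2(\rho u^2-\rho^{-\alpha})+\bar c$, and $\frac{d}{dt}\bar H_{[-L,L]}=\mathcal D$, so the condition says that $\mathcal D$ is minimal. *)

theory Defs
  imports "HOL-Analysis.Analysis"
begin

text \<open>A state is a pair (density, velocity).  The system is
  \<open>\<partial>\<^sub>t (conserved U) + \<partial>\<^sub>x (flux \<alpha> U) = 0\<close>.\<close>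

type_synonym state = "real \<times> real"

fun conserved :: "state \<Rightarrow> real \<times> real" where
  "conserved (\<rho>, u) = (\<rho>, \<rho> * u)"

fun flux :: "real \<Rightarrow> state \<Rightarrow> real \<times> real" where
  "flux \<alpha> (\<rho>, u) = (\<rho> * u, \<rho> * u\<^sup>2 - 1 / \<rho> powr \<alpha>)"

datatype family = First | Second

fun eigenvalue :: "real \<Rightarrow> family \<Rightarrow> state \<Rightarrow> real" where
  "eigenvalue \<alpha> First (\<rho>, u) = u - sqrt \<alpha> * \<rho> powr (- (1 + \<alpha>) / 2)"
| "eigenvalue \<alpha> Second (\<rho>, u) = u + sqrt \<alpha> * \<rho> powr (- (1 + \<alpha>) / 2)"

fun eta :: "real \<Rightarrow> state \<Rightarrow> real" where
  "eta \<alpha> (\<rho>, u) = \<rho> * u\<^sup>2 / 2 + \<rho> powr (- \<alpha>) / (1 + \<alpha>)"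

fun Q :: "real \<Rightarrow> state \<Rightarrow> real" where
  "Q \<alpha> (\<rho>, u) = \<rho> * u ^ 3 / 2 - \<alpha> / (1 + \<alpha>) * \<rho> powr (- \<alpha>) * u"

fun eta_bar :: "real \<Rightarrow> real \<Rightarrow> real \<Rightarrow> state \<Rightarrow> real" where
  "eta_bar \<alpha> a1 a2 (\<rho>, u) = eta \<alpha> (\<rho>, u) + a1 * \<rho> + a2 * (\<rho> * u)"

fun Q_bar :: "real \<Rightarrow> real \<Rightarrow> real \<Rightarrow> real \<Rightarrow> state \<Rightarrow> real" where
  "Q_bar \<alpha> a1 a2 c (\<rho>, u) =
     Q \<alpha> (\<rho>, u) + a1 * (\<rho> * u) + a2 * (\<rho> * u\<^sup>2 - \<rho> powr (- \<alpha>)) + c"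


section \<open>Waves and the nets they form\<close>

text \<open>Arguments: left state, right state, and then
  \<^item> the speed, for a shock;
  \<^item> the profile as a function of \<open>\<xi> = x / t\<close>, for a rarefaction wave
    (only its values between the two characteristic speeds matter);
  \<^item> the speed \<open>c\<close> and the net \<open>\<epsilon> \<mapsto> (\<rho>\<^sub>\<epsilon>, u\<^sub>\<epsilon>)\<close> of intermediate states, for a shadow wave.\<close>

datatype wave =
  is_Shock: Shock family (left_state: state) (right_state: state) real
| is_Rarefaction: Rarefaction family (left_state: state) (right_state: state) "real \<Rightarrow> state"
| is_Shadow: Shadow (left_state: state) (right_state: state) real "real \<Rightarrow> state"

fun left_speed :: "real \<Rightarrow> wave \<Rightarrow> real \<Rightarrow> real" where
  "left_speed \<alpha> (Shock i Ul Ur s) \<epsilon> = s"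
| "left_speed \<alpha> (Rarefaction i Ul Ur V) \<epsilon> = eigenvalue \<alpha> i Ul"
| "left_speed \<alpha> (Shadow Ul Ur c V) \<epsilon> = c - \<epsilon> / 2"

fun right_speed :: "real \<Rightarrow> wave \<Rightarrow> real \<Rightarrow> real" where
  "right_speed \<alpha> (Shock i Ul Ur s) \<epsilon> = s"
| "right_speed \<alpha> (Rarefaction i Ul Ur V) \<epsilon> = eigenvalue \<alpha> i Ur"
| "right_speed \<alpha> (Shadow Ul Ur c V) \<epsilon> = c + \<epsilon> / 2"

text \<open>The value inside a wave; the first equation is never used, as a shock has no interior.\<close>

fun interior_value :: "wave \<Rightarrow> real \<Rightarrow> real \<Rightarrow> state" where
  "interior_value (Shock i Ul Ur s) \<epsilon> \<xi> = Ul"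
| "interior_value (Rarefaction i Ul Ur V) \<epsilon> \<xi> = V \<xi>"
| "interior_value (Shadow Ul Ur c V) \<epsilon> \<xi> = V \<epsilon>"

text \<open>The net \<open>U\<^sup>\<epsilon>(x,t)\<close> built from the waves of a list, in the order from left to right, starting
  from the left state \<open>Ul\<close>.  It does not depend on \<open>\<epsilon>\<close> if no shadow wave occurs.\<close>

fun wave_net :: "real \<Rightarrow> state \<Rightarrow> wave list \<Rightarrow> real \<Rightarrow> real \<Rightarrow> real \<Rightarrow> state" where
  "wave_net \<alpha> Ul [] \<epsilon> x t = Ul"
| "wave_net \<alpha> Ul (w # ws) \<epsilon> x t =
     (if x < left_speed \<alpha> w \<epsilon> * t then Ul
      else if x < right_speed \<alpha> w \<epsilon> * t then interior_value w \<epsilon> (x / t)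
      else wave_net \<alpha> (right_state w) ws \<epsilon> x t)"


section \<open>Solutions in the limit in the sense of distributions\<close>

text \<open>\<open>D i j\<close> is \<open>\<partial>\<^sub>x\<^sup>i \<partial>\<^sub>t\<^sup>j \<phi>\<close> for the smooth function \<open>\<phi> = D 0 0\<close>, whose support is a compact
  subset of the open half-plane \<open>t > 0\<close>.\<close>

definition test_function :: "(nat \<Rightarrow> nat \<Rightarrow> real \<Rightarrow> real \<Rightarrow> real) \<Rightarrow> bool" where
  "test_function D \<longleftrightarrow>
     (\<forall>i j x t. ((\<lambda>y. D i j y t) has_real_derivative D (Suc i) j x t) (at x) \<and>
                ((\<lambda>s. D i j x s) has_real_derivative D i (Suc j) x t) (at t)) \<and>
     (\<forall>i j. continuous_on UNIV (\<lambda>(x, t). D i j x t)) \<and>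
     (\<exists>\<delta>>0. \<exists>R. \<forall>x t. D 0 0 x t \<noteq> 0 \<longrightarrow> \<bar>x\<bar> \<le> R \<and> \<delta> \<le> t \<and> t \<le> R)"

definition solves_in_limit :: "real \<Rightarrow> (real \<Rightarrow> real \<Rightarrow> real \<Rightarrow> state) \<Rightarrow> bool" where
  "solves_in_limit \<alpha> N \<longleftrightarrow>
     (\<forall>D. test_function D \<longrightarrow>
        ((\<lambda>\<epsilon>. LINT t|lborel. LINT x|lborel.
             D 0 1 x t *\<^sub>R conserved (N \<epsilon> x t) + D 1 0 x t *\<^sub>R flux \<alpha> (N \<epsilon> x t)) \<longlongrightarrow> 0)
          (at_right 0))"


section \<open>Admissible waves\<close>

text \<open>Rankine-Hugoniot condition and the Lax inequalities.\<close>

fun lax_condition :: "real \<Rightarrow> family \<Rightarrow> state \<Rightarrow> state \<Rightarrow> real \<Rightarrow> bool" where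
  "lax_condition \<alpha> First Ul Ur s \<longleftrightarrow>
     eigenvalue \<alpha> First Ur < s \<and> s < eigenvalue \<alpha> First Ul \<and> s < eigenvalue \<alpha> Second Ur"
| "lax_condition \<alpha> Second Ul Ur s \<longleftrightarrow>
     eigenvalue \<alpha> Second Ur < s \<and> s < eigenvalue \<alpha> Second Ul \<and> eigenvalue \<alpha> First Ul < s"

definition shock_wave :: "real \<Rightarrow> family \<Rightarrow> state \<Rightarrow> state \<Rightarrow> real \<Rightarrow> bool" where
  "shock_wave \<alpha> i Ul Ur s \<longleftrightarrow>
     s *\<^sub>R (conserved Ur - conserved Ul) = flux \<alpha> Ur - flux \<alpha> Ul \<and> lax_condition \<alpha> i Ul Ur s"

text \<open>A centred simple wave: \<open>U(x,t) = V(x/t)\<close> solves the system iff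
  \<open>(flux (V \<xi>))' = \<xi> (conserved (V \<xi>))'\<close>.\<close>

definition rarefaction_wave ::
  "real \<Rightarrow> family \<Rightarrow> state \<Rightarrow> state \<Rightarrow> (real \<Rightarrow> state) \<Rightarrow> bool" where
  "rarefaction_wave \<alpha> i Ul Ur V \<longleftrightarrow>
     (let a = eigenvalue \<alpha> i Ul; b = eigenvalue \<alpha> i Ur in
        a < b \<and> V a = Ul \<and> V b = Ur \<and>
        (\<forall>\<xi>\<in>{a..b}. fst (V \<xi>) > 0 \<and> eigenvalue \<alpha> i (V \<xi>) = \<xi> \<and>
           (\<exists>w. ((\<lambda>z. conserved (V z)) has_vector_derivative w) (at \<xi> within {a..b}) \<and>
                ((\<lambda>z. flux \<alpha> (V z)) has_vector_derivative \<xi> *\<^sub>R w) (at \<xi> within {a..b}))))"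

text \<open>The second condition is \<open>\<rho>\<^sub>\<epsilon> \<sim> \<epsilon>\<^sup>-\<^sup>1\<close>.\<close>

definition shadow_wave :: "real \<Rightarrow> state \<Rightarrow> state \<Rightarrow> real \<Rightarrow> (real \<Rightarrow> state) \<Rightarrow> bool" where
  "shadow_wave \<alpha> Ul Ur c V \<longleftrightarrow>
     (\<forall>\<epsilon>>0. fst (V \<epsilon>) > 0) \<and>
     (\<exists>\<kappa>>0. ((\<lambda>\<epsilon>. \<epsilon> * fst (V \<epsilon>)) \<longlongrightarrow> \<kappa>) (at_right 0)) \<and>
     solves_in_limit \<alpha> (wave_net \<alpha> Ul [Shadow Ul Ur c V])"

definition overcompressive :: "real \<Rightarrow> state \<Rightarrow> state \<Rightarrow> real \<Rightarrow> bool" where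
  "overcompressive \<alpha> Ul Ur c \<longleftrightarrow> (\<forall>i. eigenvalue \<alpha> i Ul \<ge> c \<and> c \<ge> eigenvalue \<alpha> i Ur)"

fun admissible_wave :: "real \<Rightarrow> wave \<Rightarrow> bool" where
  "admissible_wave \<alpha> (Shock i Ul Ur s) \<longleftrightarrow>
     fst Ul > 0 \<and> fst Ur > 0 \<and> shock_wave \<alpha> i Ul Ur s"
| "admissible_wave \<alpha> (Rarefaction i Ul Ur V) \<longleftrightarrow>
     fst Ul > 0 \<and> fst Ur > 0 \<and> rarefaction_wave \<alpha> i Ul Ur V"
| "admissible_wave \<alpha> (Shadow Ul Ur c V) \<longleftrightarrow>
     fst Ul > 0 \<and> fst Ur > 0 \<and> shadow_wave \<alpha> Ul Ur c V \<and> overcompressive \<alpha> Ul Ur c"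


section \<open>Solutions of the Riemann problem\<close>

fun connects :: "state \<Rightarrow> wave list \<Rightarrow> state \<Rightarrow> bool" where
  "connects Ul [] Ur \<longleftrightarrow> Ul = Ur"
| "connects Ul (w # ws) Ur \<longleftrightarrow> left_state w = Ul \<and> connects (right_state w) ws Ur"

text \<open>Consecutive waves are separated by a sector in which the solution is constant, for all
  small \<open>\<epsilon>\<close>.  (Two adjacent rarefaction waves of one family count as a single wave.)\<close>

definition separated :: "real \<Rightarrow> wave list \<Rightarrow> bool" where
  "separated \<alpha> ws \<longleftrightarrow>
     successively (\<lambda>w w'. \<forall>\<^sub>F \<epsilon> in at_right 0. right_speed \<alpha> w \<epsilon> < left_speed \<alpha> w' \<epsilon>) ws"

definition riemann_solution :: "real \<Rightarrow> state \<Rightarrow> state \<Rightarrow> wave list \<Rightarrow> bool" where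
  "riemann_solution \<alpha> U0 U1 ws \<longleftrightarrow>
     connects U0 ws U1 \<and> separated \<alpha> ws \<and> (\<forall>w\<in>set ws. admissible_wave \<alpha> w)"

definition classical_solution :: "real \<Rightarrow> state \<Rightarrow> state \<Rightarrow> wave list \<Rightarrow> bool" where
  "classical_solution \<alpha> U0 U1 ws \<longleftrightarrow>
     riemann_solution \<alpha> U0 U1 ws \<and> (\<forall>w\<in>set ws. is_Shock w \<or> is_Rarefaction w)"

definition shadow_solution :: "real \<Rightarrow> state \<Rightarrow> state \<Rightarrow> wave list \<Rightarrow> bool" where
  "shadow_solution \<alpha> U0 U1 ws \<longleftrightarrow>
     riemann_solution \<alpha> U0 U1 ws \<and> (\<exists>c V. ws = [Shadow U0 U1 c V])"


section \<open>Energy admissibility\<close>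

fun wave_production :: "real \<Rightarrow> wave \<Rightarrow> real" where
  "wave_production \<alpha> (Shock i Ul Ur s) = - s * (eta \<alpha> Ur - eta \<alpha> Ul) + (Q \<alpha> Ur - Q \<alpha> Ul)"
| "wave_production \<alpha> (Rarefaction i Ul Ur V) = 0"
| "wave_production \<alpha> (Shadow Ul Ur c V) =
     - c * (eta \<alpha> Ur - eta \<alpha> Ul) + (Q \<alpha> Ur - Q \<alpha> Ul) + Lim (at_right 0) (\<lambda>\<epsilon>. \<epsilon> * eta \<alpha> (V \<epsilon>))"

definition energy_production :: "real \<Rightarrow> wave list \<Rightarrow> real" where
  "energy_production \<alpha> ws = (\<Sum>w\<leftarrow>ws. wave_production \<alpha> w)"

text \<open>\<open>d\<close> is the (one-sided) derivative at \<open>t = 0\<close> of the integral of \<open>eta_bar\<close> over \<open>[-L, L]\<close>,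
  which is understood as a limit for \<open>\<epsilon> \<rightarrow> 0\<close>.\<close>

definition has_energy_rate ::
  "real \<Rightarrow> real \<Rightarrow> real \<Rightarrow> real \<Rightarrow> state \<Rightarrow> wave list \<Rightarrow> real \<Rightarrow> bool" where
  "has_energy_rate \<alpha> a1 a2 L U0 ws d \<longleftrightarrow>
     (\<exists>T>0. \<exists>H.
        (\<forall>t\<in>{0..T}. ((\<lambda>\<epsilon>. integral {-L..L} (\<lambda>x. eta_bar \<alpha> a1 a2 (wave_net \<alpha> U0 ws \<epsilon> x t)))
                        \<longlongrightarrow> H t) (at_right 0)) \<and>
        (H has_real_derivative d) (at 0 within {0..T}))"

text \<open>The first minimality condition is the one on the rate of the normalised energy; any \<open>L > 0\<close>
  is large enough because only the limit \<open>t \<rightarrow> 0\<close> matters.  If \<open>U0\<close> and \<open>U1\<close> are joined by a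
  stationary shock, no normalising constants exist and that condition is void.  The second
  condition is the equivalent one on the local energy production, which makes sense for all data.\<close>

definition energy_admissible :: "real \<Rightarrow> state \<Rightarrow> state \<Rightarrow> wave list \<Rightarrow> bool" where
  "energy_admissible \<alpha> U0 U1 ws \<longleftrightarrow>
     riemann_solution \<alpha> U0 U1 ws \<and>
     (\<forall>a1 a2 c L. Q_bar \<alpha> a1 a2 c U0 = 0 \<and> Q_bar \<alpha> a1 a2 c U1 = 0 \<and> L > 0 \<longrightarrow>
        (\<exists>d. has_energy_rate \<alpha> a1 a2 L U0 ws d \<and>
           (\<forall>ws'. riemann_solution \<alpha> U0 U1 ws' \<longrightarrow>
              (\<exists>d'. has_energy_rate \<alpha> a1 a2 L U0 ws' d' \<and> d \<le> d')))) \<and>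
     (\<forall>ws'. riemann_solution \<alpha> U0 U1 ws' \<longrightarrow>
        energy_production \<alpha> ws \<le> energy_production \<alpha> ws')"

end

theory Submission
  imports Defs
begin

text \<open>Everything is expressed through the specific volume \<open>\<tau> = 1 / \<rho>\<close>, in which the gas has the
pressure \<open>p = - \<tau>\<^sup>\<alpha>\<close> and the internal energy \<open>e = \<tau>\<^sup>1\<^sup>+\<^sup>\<alpha> / (1 + \<alpha>)\<close>.

\<^bold>\<open>Which solutions exist.\<close>  Comparing wave speeds at a common state shows that an overcompressive
shadow wave tolerates no other wave next to it and that classical waves occur at most once per
family, the first family on the left (\<open>riemann_solution_cases\<close>).  A classical solution is
therefore determined by the volume \<open>\<tau>\<close> of its middle state, and \<open>u0 - u1\<close> is the sum of the two
velocity losses \<open>f0 \<tau> + f1 \<tau>\<close> from the outer volumes to \<open>\<tau>\<close>.  These losses decrease continuously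
and strictly from \<open>\<rho>i powr (- (1 + \<alpha>) / 2)\<close> at \<open>\<tau> = 0\<close> to \<open>- \<infinity>\<close>, so one and only one middle
volume exists if \<open>u0 - u1\<close> is less than the sum of these two values, and none otherwise
(\<open>ex_middle_volume\<close>, \<open>middle_volume_unique\<close>).

For a shadow wave, test functions that equal \<open>1\<close> or \<open>x\<close> near the wave turn the distributional
limit into two jump relations with a point mass \<open>\<kappa> > 0\<close> moving at speed \<open>c\<close>
(\<open>shadow_wave_jump\<close>).  In the frame of the wave they say that
\<open>\<rho>i * vi\<^sup>2 - (1 / \<rho>i) powr \<alpha>\<close> has the same value \<open>- P\<close> on both sides, where \<open>v0 = u0 - c\<close> and
\<open>v1 = c - u1\<close>, and they determine \<open>c\<close>, \<open>\<kappa>\<close> and the energy production.  If no classical solution exists,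
the intermediate value theorem gives a \<open>c\<close> with \<open>vi \<ge> \<rho>i powr (- (1 + \<alpha>) / 2)\<close>, and this is more than
overcompressibility requires.

\<^bold>\<open>Which solution dissipates more.\<close>  If both kinds coexist, the shadow wave looks like a pair of shocks
into the volume \<open>0\<close> at the pressure \<open>- P\<close>.  The classical solution reaches the same total velocity
loss at a volume \<open>\<tau> > 0\<close> with mass fluxes \<open>Mi\<close> that exceed the fluxes \<open>mi = \<rho>i * vi\<close> of the shadow wave;
in particular it consists of two shocks.  Writing \<open>Vi\<close> for the velocity losses of these shocks, the
difference of the productions is
\<open>- \<Sum>i. (Mi - mi) * (\<tau>\<^sub>i * (\<tau>\<^sub>i powr \<alpha> - \<tau> powr \<alpha>) / (1 + \<alpha>) + vi * Vi / 2)\<close>,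
which is negative (\<open>classical_dissipation_less\<close>).  All classical solutions have one production and
so have all shadow waves; hence the minimisers are the classical solutions when they exist and the
shadow waves otherwise.

\<^bold>\<open>Rate of the energy.\<close>  Splitting \<open>[-L, L]\<close> at the waves shows that the energy is an affine function of
time, whose slope is the energy production once the flux \<open>Q_bar\<close> vanishes at both ends
(\<open>riemann_energy_rate\<close>).  So of the two minimality conditions in the definition of energy
admissibility the one on the productions implies the other.\<close>


section \<open>Velocity loss and dissipation as functions of the volume\<close>

text \<open>The drop of the velocity across a wave between an outer state of volume \<open>a\<close> and the middle state of
volume \<open>\<tau>\<close>, with the outer state on the left for the first family and on the right for the second: the
Hugoniot curve for \<open>\<tau> \<le> a\<close> and the integral curve of the characteristic field for \<open>\<tau> > a\<close>.  In terms
of the volume, rather than the density, the Hugoniot curve extends to \<open>\<tau> = 0\<close>, which is the volume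
inside a shadow wave.\<close>

definition velocity_loss :: "real \<Rightarrow> real \<Rightarrow> real \<Rightarrow> real" where
  "velocity_loss \<alpha> a \<tau> =
     (if \<tau> \<le> a then sqrt ((a powr \<alpha> - \<tau> powr \<alpha>) * (a - \<tau>))
      else 2 * sqrt \<alpha> / (1 + \<alpha>) * (a powr ((1 + \<alpha>) / 2) - \<tau> powr ((1 + \<alpha>) / 2)))"

text \<open>The mass that crosses a shock per unit time; its square is the slope of a chord of \<open>-p\<close>.\<close>

definition mass_flux :: "real \<Rightarrow> real \<Rightarrow> real \<Rightarrow> real" where
  "mass_flux \<alpha> a \<tau> = sqrt ((a powr \<alpha> - \<tau> powr \<alpha>) / (a - \<tau>))"

text \<open>For a shock, the mass flux times the jump of \<open>e\<close> plus the mean pressure times the jump of the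
volume; a rarefaction wave produces no energy.\<close>

definition dissipation :: "real \<Rightarrow> real \<Rightarrow> real \<Rightarrow> real" where
  "dissipation \<alpha> a \<tau> =
     (if \<tau> < a then mass_flux \<alpha> a \<tau> *
        ((\<tau> powr (1 + \<alpha>) - a powr (1 + \<alpha>)) / (1 + \<alpha>) + (a powr \<alpha> + \<tau> powr \<alpha>) / 2 * (a - \<tau>))
      else 0)"

lemma velocity_loss_self [simp]: "velocity_loss \<alpha> a a = 0"
  by (simp add: velocity_loss_def)

lemma dissipation_self [simp]: "dissipation \<alpha> a a = 0"
  by (simp add: dissipation_def)

lemma velocity_loss_at_zero:
  assumes "0 < \<alpha>" "0 < a"
  shows "velocity_loss \<alpha> a 0 = a powr ((1 + \<alpha>) / 2)"
proof -
  have "a powr \<alpha> * a = (a powr ((1 + \<alpha>) / 2))\<^sup>2"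
    using assms by (simp add: power2_eq_square powr_mult_base powr_add [symmetric] add.commute mult.commute)
  then show ?thesis
    using assms by (simp add: velocity_loss_def)
qed

text \<open>On the Hugoniot curve both factors under the root decrease in \<open>\<tau>\<close>; the two branches are
separated by their sign.\<close>

lemma velocity_loss_strict_antimono:
  assumes \<alpha>: "0 < \<alpha>" and "0 < a" "0 \<le> \<tau>" "\<tau> < \<tau>'"
  shows "velocity_loss \<alpha> a \<tau>' < velocity_loss \<alpha> a \<tau>"
proof -
  consider "\<tau>' \<le> a" | "\<tau> \<le> a" "a < \<tau>'" | "a < \<tau>" by linarith
  then show ?thesis
  proof cases
    case 1
    have "\<tau> powr \<alpha> < \<tau>' powr \<alpha>" "\<tau>' powr \<alpha> \<le> a powr \<alpha>"
      using assms 1 by (auto intro: powr_less_mono2 powr_mono2)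
    then have "(a powr \<alpha> - \<tau>' powr \<alpha>) * (a - \<tau>') < (a powr \<alpha> - \<tau> powr \<alpha>) * (a - \<tau>)"
      using assms 1 by (intro mult_strict_mono') auto
    then show ?thesis using assms 1 by (simp add: velocity_loss_def)
  next
    case 2
    have k: "2 * sqrt \<alpha> / (1 + \<alpha>) > 0" using \<alpha> by simp
    have "a powr ((1 + \<alpha>) / 2) < \<tau>' powr ((1 + \<alpha>) / 2)"
      using assms 2 by (auto intro: powr_less_mono2)
    then have "velocity_loss \<alpha> a \<tau>' < 0"
      using 2 mult_pos_neg [OF k] by (simp add: velocity_loss_def)
    moreover have "0 \<le> (a powr \<alpha> - \<tau> powr \<alpha>) * (a - \<tau>)"
      using assms 2 by (intro mult_nonneg_nonneg) (auto intro: powr_mono2)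
    then have "0 \<le> velocity_loss \<alpha> a \<tau>"
      using 2 by (simp add: velocity_loss_def)
    ultimately show ?thesis by linarith
  next
    case 3
    have k: "2 * sqrt \<alpha> / (1 + \<alpha>) > 0" using \<alpha> by simp
    have "\<tau> powr ((1 + \<alpha>) / 2) < \<tau>' powr ((1 + \<alpha>) / 2)"
      using assms 3 by (auto intro: powr_less_mono2)
    with mult_strict_left_mono [OF _ k] show ?thesis
      using assms 3 by (simp add: velocity_loss_def)
  qed
qed

lemma continuous_on_velocity_loss:
  assumes "0 < \<alpha>" "0 < a"
  shows "continuous_on {0..} (velocity_loss \<alpha> a)"
proof -
  have pow: "continuous_on A (\<lambda>\<tau>. \<tau> powr b)" if "A \<subseteq> {0..}" "b > 0" for A and b :: real
    using that by (intro continuous_on_powr' continuous_intros) auto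
  show ?thesis
    unfolding velocity_loss_def
    by (rule continuous_on_cases_le; (intro continuous_intros pow)?) (use assms in auto)
qed

text \<open>The sum of the losses decreases continuously from its value at \<open>\<tau> = 0\<close>, which is the right-hand
side, to \<open>- \<infinity>\<close>.  It tends to \<open>- \<infinity>\<close> because rarefaction waves never reach the vacuum here: the
exponent \<open>(1 + \<alpha>) / 2\<close> is positive.\<close>

lemma ex_middle_volume:
  assumes \<alpha>: "0 < \<alpha>" and pos: "0 < a" "0 < b"
  shows "(\<exists>\<tau>>0. velocity_loss \<alpha> a \<tau> + velocity_loss \<alpha> b \<tau> = d) \<longleftrightarrow>
         d < a powr ((1 + \<alpha>) / 2) + b powr ((1 + \<alpha>) / 2)"
proof
  assume "\<exists>\<tau>>0. velocity_loss \<alpha> a \<tau> + velocity_loss \<alpha> b \<tau> = d"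
  then obtain \<tau> where "\<tau> > 0" "velocity_loss \<alpha> a \<tau> + velocity_loss \<alpha> b \<tau> = d" by blast
  with velocity_loss_strict_antimono [OF \<alpha> pos(1), of 0 \<tau>]
    velocity_loss_strict_antimono [OF \<alpha> pos(2), of 0 \<tau>]
  show "d < a powr ((1 + \<alpha>) / 2) + b powr ((1 + \<alpha>) / 2)"
    using \<alpha> pos by (simp add: velocity_loss_at_zero)
next
  assume d: "d < a powr ((1 + \<alpha>) / 2) + b powr ((1 + \<alpha>) / 2)"
  define k where "k = 2 * sqrt \<alpha> / (1 + \<alpha>)"
  define \<beta> where "\<beta> = (1 + \<alpha>) / 2"
  have k: "k > 0" and \<beta>: "\<beta> > 0" using \<alpha> by (auto simp: k_def \<beta>_def)
  \<comment> \<open>at \<open>X\<close> both terms are rarefaction losses, and \<open>y\<close> makes their sum at most \<open>-\<bar>d\<bar>\<close>\<close>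
  define y where "y = a powr \<beta> + b powr \<beta> + \<bar>d\<bar> / k"
  define X where "X = y powr (1 / \<beta>) + a + b"
  have y: "y > 0" using pos k by (auto simp: y_def intro!: add_pos_nonneg)
  have "X powr \<beta> \<ge> (y powr (1 / \<beta>)) powr \<beta>"
    using \<beta> pos by (intro powr_mono2) (auto simp: X_def)
  then have X: "X powr \<beta> \<ge> y" using y \<beta> by (simp add: powr_powr)
  have aX: "a < X" "b < X" using pos by (auto simp: X_def add_nonneg_pos)
  have "velocity_loss \<alpha> a X + velocity_loss \<alpha> b X = k * (a powr \<beta> + b powr \<beta> - 2 * X powr \<beta>)"
    using aX by (simp add: velocity_loss_def k_def \<beta>_def algebra_simps)
  also have "\<dots> \<le> k * (- (\<bar>d\<bar> / k))"
  proof (rule mult_left_mono)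
    have "0 \<le> X powr \<beta>" by simp
    then show "a powr \<beta> + b powr \<beta> - 2 * X powr \<beta> \<le> - (\<bar>d\<bar> / k)"
      using X unfolding y_def by linarith
  qed (use k in auto)
  also have "\<dots> \<le> d" using k by simp
  finally have lo: "velocity_loss \<alpha> a X + velocity_loss \<alpha> b X \<le> d" .
  have hi: "d \<le> velocity_loss \<alpha> a 0 + velocity_loss \<alpha> b 0"
    using d \<alpha> pos by (simp add: velocity_loss_at_zero)
  have X0: "0 \<le> X" using aX pos by linarith
  have "continuous_on {0..X} (\<lambda>\<tau>. velocity_loss \<alpha> a \<tau> + velocity_loss \<alpha> b \<tau>)"
    by (intro continuous_on_add continuous_on_subset [OF continuous_on_velocity_loss]) (use \<alpha> pos in auto)
  from IVT2' [OF lo hi X0 this] obtain \<tau> where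
    \<tau>: "0 \<le> \<tau>" "velocity_loss \<alpha> a \<tau> + velocity_loss \<alpha> b \<tau> = d" by blast
  moreover have "\<tau> \<noteq> 0" using d \<tau> \<alpha> pos by (auto simp: velocity_loss_at_zero)
  ultimately show "\<exists>\<tau>>0. velocity_loss \<alpha> a \<tau> + velocity_loss \<alpha> b \<tau> = d" by (intro exI [of _ \<tau>]) auto
qed

lemma middle_volume_unique:
  assumes "0 < \<alpha>" "0 < a" "0 < b" "0 < \<tau>" "0 < \<tau>'"
    and "velocity_loss \<alpha> a \<tau> + velocity_loss \<alpha> b \<tau> = velocity_loss \<alpha> a \<tau>' + velocity_loss \<alpha> b \<tau>'"
  shows "\<tau> = \<tau>'"
proof (rule ccontr)
  assume "\<tau> \<noteq> \<tau>'"
  then consider "\<tau> < \<tau>'" | "\<tau>' < \<tau>" by linarith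
  then show False
    using velocity_loss_strict_antimono [of \<alpha> a \<tau> \<tau>'] velocity_loss_strict_antimono [of \<alpha> b \<tau> \<tau>']
      velocity_loss_strict_antimono [of \<alpha> a \<tau>' \<tau>] velocity_loss_strict_antimono [of \<alpha> b \<tau>' \<tau>] assms
    by cases (use assms in auto)
qed


section \<open>Shocks and rarefaction waves\<close>

text \<open>The density times the speed of sound, which is the mass flux through a characteristic and the
limit of \<open>mass_flux\<close> for weak shocks.\<close>

definition acoustic_flux :: "real \<Rightarrow> real \<Rightarrow> real" where
  "acoustic_flux \<alpha> \<tau> = sqrt (\<alpha> * \<tau> powr (\<alpha> - 1))"

lemma powr_neg_volume:
  fixes \<rho> b :: real
  assumes "\<rho> > 0"
  shows "\<rho> powr (- b) = (1 / \<rho>) powr b"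
  using assms by (simp add: powr_minus_divide powr_divide)

lemma sound_speed_volume:
  fixes \<rho> \<alpha> :: real
  assumes "\<rho> > 0"
  shows "sqrt \<alpha> * \<rho> powr (- (1 + \<alpha>) / 2) = 1 / \<rho> * acoustic_flux \<alpha> (1 / \<rho>)"
proof -
  define \<tau> where "\<tau> = 1 / \<rho>"
  have \<tau>: "\<tau> > 0" using assms by (simp add: \<tau>_def)
  have "\<tau> powr (\<alpha> - 1) = (\<tau> powr ((\<alpha> - 1) / 2))\<^sup>2"
    using \<tau> by (simp add: power2_eq_square powr_add [symmetric])
  then have "\<tau> * acoustic_flux \<alpha> \<tau> = sqrt \<alpha> * (\<tau> * \<tau> powr ((\<alpha> - 1) / 2))"
    by (simp add: acoustic_flux_def real_sqrt_mult)
  also have "\<tau> * \<tau> powr ((\<alpha> - 1) / 2) = \<tau> powr ((1 + \<alpha>) / 2)"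
  proof -
    have "\<tau> * \<tau> powr ((\<alpha> - 1) / 2) = \<tau> powr (1 + (\<alpha> - 1) / 2)"
      using \<tau> by (simp only: powr_mult_base less_imp_le)
    also have "1 + (\<alpha> - 1) / 2 = (1 + \<alpha>) / 2" by (simp add: field_simps)
    finally show ?thesis .
  qed
  also have "\<dots> = \<rho> powr (- (1 + \<alpha>) / 2)"
    by (simp only: \<tau>_def minus_divide_left [symmetric] powr_neg_volume [OF assms])
  finally show ?thesis by (simp add: \<tau>_def)
qed

lemma eigenvalue_volume:
  assumes "\<rho> > 0"
  shows "eigenvalue \<alpha> First (\<rho>, u) = u - 1 / \<rho> * acoustic_flux \<alpha> (1 / \<rho>)"
    and "eigenvalue \<alpha> Second (\<rho>, u) = u + 1 / \<rho> * acoustic_flux \<alpha> (1 / \<rho>)"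
  using sound_speed_volume [OF assms, of \<alpha>] by simp_all

lemma acoustic_flux_pos: "0 < \<alpha> \<Longrightarrow> 0 < \<tau> \<Longrightarrow> 0 < acoustic_flux \<alpha> \<tau>"
  by (simp add: acoustic_flux_def)

lemma acoustic_flux_less_iff:
  assumes "0 < \<alpha>" "\<alpha> < 1" "0 < a" "0 < b"
  shows "acoustic_flux \<alpha> a < acoustic_flux \<alpha> b \<longleftrightarrow> b < a"
proof -
  have "x < y \<Longrightarrow> y powr (\<alpha> - 1) < x powr (\<alpha> - 1)" if "0 < x" for x y :: real
    using assms that by (intro powr_less_mono2_neg) auto
  then have "a powr (\<alpha> - 1) < b powr (\<alpha> - 1) \<longleftrightarrow> b < a"
    using assms by (metis less_asym less_linear)
  then show ?thesis using assms by (simp add: acoustic_flux_def)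
qed

text \<open>The slope of the chord of the concave function \<open>\<tau> powr \<alpha>\<close> lies between the slopes at its ends.
These are the Lax inequalities in terms of mass fluxes.\<close>

lemma mass_flux_between:
  assumes \<alpha>: "0 < \<alpha>" "\<alpha> < 1" and "0 < \<tau>" "\<tau> < a"
  shows "acoustic_flux \<alpha> a < mass_flux \<alpha> a \<tau>" "mass_flux \<alpha> a \<tau> < acoustic_flux \<alpha> \<tau>"
proof -
  have "\<exists>z. \<tau> < z \<and> z < a \<and> a powr \<alpha> - \<tau> powr \<alpha> = (a - \<tau>) * (\<alpha> * z powr (\<alpha> - 1))"
    using assms by (intro MVT2) (auto intro!: has_real_derivative_powr)
  then obtain z where z: "\<tau> < z" "z < a" "a powr \<alpha> - \<tau> powr \<alpha> = (a - \<tau>) * (\<alpha> * z powr (\<alpha> - 1))"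
    by blast
  then have "mass_flux \<alpha> a \<tau> = acoustic_flux \<alpha> z"
    using assms by (simp add: mass_flux_def acoustic_flux_def)
  with z assms show "acoustic_flux \<alpha> a < mass_flux \<alpha> a \<tau>" "mass_flux \<alpha> a \<tau> < acoustic_flux \<alpha> \<tau>"
    by (simp_all add: acoustic_flux_less_iff)
qed

lemma mass_flux_square:
  assumes "0 < \<alpha>" "0 \<le> \<tau>" "\<tau> < a"
  shows "(mass_flux \<alpha> a \<tau>)\<^sup>2 * (a - \<tau>) = a powr \<alpha> - \<tau> powr \<alpha>"
proof -
  have "\<tau> powr \<alpha> \<le> a powr \<alpha>" using assms by (intro powr_mono2) auto
  then show ?thesis using assms by (simp add: mass_flux_def)
qed

lemma mass_flux_pos:
  assumes "0 < \<alpha>" "0 \<le> \<tau>" "\<tau> < a"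
  shows "0 < mass_flux \<alpha> a \<tau>"
  using assms by (auto simp: mass_flux_def intro!: divide_pos_pos powr_less_mono2)

lemma velocity_loss_mass_flux:
  assumes "\<tau> < a"
  shows "velocity_loss \<alpha> a \<tau> = mass_flux \<alpha> a \<tau> * (a - \<tau>)"
proof -
  have "(a powr \<alpha> - \<tau> powr \<alpha>) * (a - \<tau>) = (a powr \<alpha> - \<tau> powr \<alpha>) / (a - \<tau>) * (a - \<tau>)\<^sup>2"
    using assms by (simp add: power2_eq_square)
  then show ?thesis using assms
    by (simp add: velocity_loss_def mass_flux_def real_sqrt_mult del: times_divide_eq_left)
qed

text \<open>The Rankine-Hugoniot relations say that both states lie on a line \<open>u = s + m * \<tau>\<close>, where \<open>m\<close> is the
mass flux.  By the Lax inequalities \<open>m\<close> lies between the acoustic fluxes; as these are decreasing in the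
volume, the shock is compressive.\<close>

lemma first_shock_iff:
  assumes \<alpha>: "0 < \<alpha>" "\<alpha> < 1" and pos: "0 < \<rho>l" "0 < \<rho>r"
  defines "a \<equiv> 1 / \<rho>l" and "b \<equiv> 1 / \<rho>r"
  shows "shock_wave \<alpha> First (\<rho>l, ul) (\<rho>r, ur) s \<longleftrightarrow>
    b < a \<and> ur = ul - velocity_loss \<alpha> a b \<and> s = ul - a * mass_flux \<alpha> a b"
proof
  have ab: "0 < a" "0 < b" "\<rho>l * a = 1" "\<rho>r * b = 1" using pos by (auto simp: a_def b_def)
  have \<pi>: "1 / \<rho>l powr \<alpha> = a powr \<alpha>" "1 / \<rho>r powr \<alpha> = b powr \<alpha>"
    using pos by (auto simp: a_def b_def powr_divide)
  note ev = eigenvalue_volume [OF pos(1), folded a_def] eigenvalue_volume [OF pos(2), folded b_def]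
  note af = acoustic_flux_pos [OF \<alpha>(1) ab(1)] acoustic_flux_pos [OF \<alpha>(1) ab(2)]
  {
    assume S: "shock_wave \<alpha> First (\<rho>l, ul) (\<rho>r, ur) s"
    then have rh: "s * (\<rho>r - \<rho>l) = \<rho>r * ur - \<rho>l * ul"
        "s * (\<rho>r * ur - \<rho>l * ul) = \<rho>r * ur\<^sup>2 - b powr \<alpha> - (\<rho>l * ul\<^sup>2 - a powr \<alpha>)"
      and lax: "ur - b * acoustic_flux \<alpha> b < s" "s < ul - a * acoustic_flux \<alpha> a"
      by (simp_all add: shock_wave_def ev \<pi> del: eigenvalue.simps)
    \<comment> \<open>mass conservation: \<open>m\<close> is the flux on both sides\<close>
    define m where "m = \<rho>l * (ul - s)"
    have mr: "m = \<rho>r * (ur - s)" using rh(1) by (simp add: m_def algebra_simps)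
    have u: "ul - s = m * a" "ur - s = m * b"
      using ab(3,4) by (simp_all add: m_def, simp_all add: mr m_def [symmetric] mult.commute mult.left_commute)
    have m: "m * (ur - ul) = b powr \<alpha> - a powr \<alpha>" 
    proof -
      have "m * (ur - ul) = (m * (ur - s)) - m * (ul - s)" by (simp add: algebra_simps)
      also have "\<dots> = \<rho>r * (ur - s) * (ur - s) - \<rho>l * (ul - s) * (ul - s)"
        by (simp add: mr) (simp add: mr [symmetric] m_def)
      also have "\<dots> = (\<rho>r * ur\<^sup>2 - \<rho>l * ul\<^sup>2) - s * (\<rho>r * ur - \<rho>l * ul) - s * (\<rho>r * ur - \<rho>l * ul - s * (\<rho>r - \<rho>l))"
        by (simp add: algebra_simps power2_eq_square)
      also have "\<dots> = b powr \<alpha> - a powr \<alpha>" by (simp add: rh)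
      finally show ?thesis by simp
    qed
    have lt: "acoustic_flux \<alpha> a < m" "m < acoustic_flux \<alpha> b"
      using lax u ab(1,2) by (auto simp: mult.commute [of m] algebra_simps intro: mult_left_less_imp_less)
    then have "acoustic_flux \<alpha> a < acoustic_flux \<alpha> b" by linarith
    then have ba: "b < a" using \<alpha> ab by (simp add: acoustic_flux_less_iff)
    have "m * (m * b - m * a) = b powr \<alpha> - a powr \<alpha>" using m by (simp add: u [symmetric])
    then have "m\<^sup>2 = (a powr \<alpha> - b powr \<alpha>) / (a - b)"
      using ba by (simp add: field_simps power2_eq_square)
    then have "m = mass_flux \<alpha> a b"
      using lt af by (metis mass_flux_def real_sqrt_unique less_eq_real_def less_trans)
    then show "b < a \<and> ur = ul - velocity_loss \<alpha> a b \<and> s = ul - a * mass_flux \<alpha> a b"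
      using ba u by (simp add: velocity_loss_mass_flux algebra_simps)
  }
  {
    assume S: "b < a \<and> ur = ul - velocity_loss \<alpha> a b \<and> s = ul - a * mass_flux \<alpha> a b"
    define m where "m = mass_flux \<alpha> a b"
    have "velocity_loss \<alpha> a b = m * (a - b)" "s = ul - a * m" "ur = ul - velocity_loss \<alpha> a b"
      using S by (simp_all only: m_def velocity_loss_mass_flux)
    then have u: "ul = s + m * a" "ur = s + m * b"
      by (simp_all add: algebra_simps)
    have m2: "m\<^sup>2 * (a - b) = a powr \<alpha> - b powr \<alpha>"
      unfolding m_def using S \<alpha> ab by (intro mass_flux_square) auto
    have m: "acoustic_flux \<alpha> a < m" "m < acoustic_flux \<alpha> b" "m > 0"
      unfolding m_def using S \<alpha> ab by (auto intro: mass_flux_between mass_flux_pos)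
    have q: "\<rho>l * ul = \<rho>l * s + m" "\<rho>r * ur = \<rho>r * s + m"
      using ab(3,4) by (simp_all add: u algebra_simps)
    have q2: "\<rho>l * ul\<^sup>2 = \<rho>l * s\<^sup>2 + 2 * m * s + m\<^sup>2 * a" "\<rho>r * ur\<^sup>2 = \<rho>r * s\<^sup>2 + 2 * m * s + m\<^sup>2 * b"
    proof -
      have "\<rho> * (s + m * \<tau>)\<^sup>2 = \<rho> * s\<^sup>2 + 2 * m * s + m\<^sup>2 * \<tau>" if "\<rho> * \<tau> = 1" for \<rho> \<tau>
        using that by algebra
      then show "\<rho>l * ul\<^sup>2 = \<rho>l * s\<^sup>2 + 2 * m * s + m\<^sup>2 * a" "\<rho>r * ur\<^sup>2 = \<rho>r * s\<^sup>2 + 2 * m * s + m\<^sup>2 * b"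
        using ab(3,4) by (simp_all add: u)
    qed
    have "ur - b * acoustic_flux \<alpha> b < s" "s < ul - a * acoustic_flux \<alpha> a"
        "s < ur + b * acoustic_flux \<alpha> b"
      using m ab(1,2) af by (auto simp: u mult.commute intro: add_pos_pos)
    moreover have "s * (\<rho>r * ur - \<rho>l * ul) = \<rho>r * ur\<^sup>2 - b powr \<alpha> - (\<rho>l * ul\<^sup>2 - a powr \<alpha>)"
      unfolding q q2 using m2 by (simp add: algebra_simps power2_eq_square)
    ultimately show "shock_wave \<alpha> First (\<rho>l, ul) (\<rho>r, ur) s"
      by (simp add: shock_wave_def ev \<pi> q algebra_simps del: eigenvalue.simps)
  }
qed

text \<open>The frame of the shock simplifies \<open>Q - s * eta\<close>, and there the kinetic part of the jump is
\<open>m * [u\<^sup>2 / 2]\<close>, which the momentum balance \<open>m * [u] = - [p]\<close> turns into pressures.\<close>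

lemma first_shock_production:
  assumes \<alpha>: "0 < \<alpha>" "\<alpha> < 1" and pos: "0 < \<rho>l" "0 < \<rho>r"
    and S: "shock_wave \<alpha> First (\<rho>l, ul) (\<rho>r, ur) s"
  shows "wave_production \<alpha> (Shock First (\<rho>l, ul) (\<rho>r, ur) s) = dissipation \<alpha> (1 / \<rho>l) (1 / \<rho>r)"
proof -
  define a b m where "a = 1 / \<rho>l" and "b = 1 / \<rho>r" and "m = mass_flux \<alpha> a b"
  define x y where "x = a powr \<alpha>" and "y = b powr \<alpha>"
  have ab: "0 < a" "0 < b" "\<rho>l * a = 1" "\<rho>r * b = 1" using pos by (auto simp: a_def b_def)
  have \<pi>: "\<rho>l powr (- \<alpha>) = x" "\<rho>r powr (- \<alpha>) = y"
    using pos by (auto simp: a_def b_def x_def y_def powr_divide powr_minus_divide)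
  have ba: "b < a" and ur: "ur = ul - velocity_loss \<alpha> a b" and s: "s = ul - a * m"
    using first_shock_iff [OF \<alpha> pos, of ul ur s] S by (auto simp: a_def b_def m_def)
  have u: "ul = s + m * a" "ur = s + m * b"
    using ba s ur by (simp_all add: m_def velocity_loss_mass_flux algebra_simps)
  have m2: "m * (m * (a - b)) = x - y"
    using mass_flux_square [of \<alpha> b a] \<alpha> ab ba by (simp add: m_def x_def y_def power2_eq_square)
  have e: "a powr (1 + \<alpha>) = a * x" "b powr (1 + \<alpha>) = b * y"
    using ab by (simp_all add: x_def y_def powr_add)
  have diff: "Q \<alpha> (\<rho>, v) - s * eta \<alpha> (\<rho>, v) = m * v\<^sup>2 / 2 - \<rho> powr (- \<alpha>) * s - \<alpha> / (1 + \<alpha>) * (m * (t * \<rho> powr (- \<alpha>)))"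
    if "\<rho> * t = 1" "v = s + m * t" for \<rho> v t
  proof -
    have 1: "\<rho> * v ^ 3 / 2 - s * (\<rho> * v\<^sup>2 / 2) = m * v\<^sup>2 / 2"
      using that by algebra
    have 2: "\<alpha> / (1 + \<alpha>) * z * v + s * (z / (1 + \<alpha>)) = z * s + \<alpha> / (1 + \<alpha>) * (m * (t * z))" for z
    proof -
      have "inverse (1 + \<alpha>) * (1 + \<alpha>) = 1" using \<alpha> by simp
      then show ?thesis unfolding that(2) divide_inverse by algebra
    qed
    have "Q \<alpha> (\<rho>, v) - s * eta \<alpha> (\<rho>, v) = (\<rho> * v ^ 3 / 2 - s * (\<rho> * v\<^sup>2 / 2)) -
        (\<alpha> / (1 + \<alpha>) * \<rho> powr (- \<alpha>) * v + s * (\<rho> powr (- \<alpha>) / (1 + \<alpha>)))"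
      unfolding Q.simps eta.simps by (simp only: algebra_simps)
    then show ?thesis unfolding 1 2 by (simp only: diff_diff_eq)
  qed
  have k: "\<alpha> / (1 + \<alpha>) = 1 - 1 / (1 + \<alpha>)" using \<alpha> by (simp add: field_simps)
  have "wave_production \<alpha> (Shock First (\<rho>l, ul) (\<rho>r, ur) s) =
      (Q \<alpha> (\<rho>r, ur) - s * eta \<alpha> (\<rho>r, ur)) - (Q \<alpha> (\<rho>l, ul) - s * eta \<alpha> (\<rho>l, ul))"
    unfolding wave_production.simps by (simp only: algebra_simps)
  also have "\<dots> = m * ur\<^sup>2 / 2 - y * s - \<alpha> / (1 + \<alpha>) * (m * (b * y)) -
      (m * ul\<^sup>2 / 2 - x * s - \<alpha> / (1 + \<alpha>) * (m * (a * x)))"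
    unfolding diff [OF ab(4) u(2)] diff [OF ab(3) u(1)] \<pi> ..
  also have "\<dots> = m * ((b * y - a * x) / (1 + \<alpha>) + (x + y) / 2 * (a - b))"
    unfolding u k using m2 by (simp add: field_simps) algebra
  finally show ?thesis
    using ba by (simp add: dissipation_def m_def [symmetric] e x_def [symmetric] y_def [symmetric]
        a_def [symmetric] b_def [symmetric])
qed

text \<open>The continuity equation \<open>(\<rho> u)' = \<xi> \<rho>'\<close> and the eigenvalue relation imply the momentum equation and,
since \<open>(eta, Q)\<close> is an entropy pair, the energy equation \<open>Q' = \<xi> eta'\<close>.\<close>

lemma simple_wave_derivatives:
  assumes r: "(\<rho> has_real_derivative r) (at \<xi> within S)"
    and u: "(u has_real_derivative (\<xi> - u \<xi>) * r / \<rho> \<xi>) (at \<xi> within S)"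
    and pos: "\<rho> \<xi> > 0"
    and char: "(\<xi> - u \<xi>)\<^sup>2 = \<alpha> * \<rho> \<xi> powr (- \<alpha> - 1)"
    and \<alpha>: "0 < \<alpha>"
  shows "((\<lambda>z. \<rho> z * u z) has_real_derivative \<xi> * r) (at \<xi> within S)"
    and "((\<lambda>z. \<rho> z * (u z)\<^sup>2 - \<rho> z powr (- \<alpha>)) has_real_derivative \<xi> * (\<xi> * r)) (at \<xi> within S)"
    and "\<exists>e. ((\<lambda>z. eta \<alpha> (\<rho> z, u z)) has_real_derivative e) (at \<xi> within S) \<and>
             ((\<lambda>z. Q \<alpha> (\<rho> z, u z)) has_real_derivative \<xi> * e) (at \<xi> within S)"
proof -
  define p where "p = \<rho> \<xi> powr (- \<alpha> - 1)"
  have p: "\<rho> \<xi> powr (- \<alpha>) = \<rho> \<xi> * p"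
    using pos by (simp add: p_def powr_mult_base)
  have P: "((\<lambda>z. \<rho> z powr (- \<alpha>)) has_real_derivative - \<alpha> * p * r) (at \<xi> within S)"
    using r pos by (auto intro!: derivative_eq_intros simp: p_def)
  show "((\<lambda>z. \<rho> z * u z) has_real_derivative \<xi> * r) (at \<xi> within S)"
    by (rule derivative_eq_intros r u refl)+ (use pos in \<open>simp add: field_simps\<close>)
  have [simp]: "\<rho> \<xi> \<noteq> 0" using pos by simp
  have k: "inverse (1 + \<alpha>) * (1 + \<alpha>) = 1" "inverse (\<rho> \<xi>) * \<rho> \<xi> = 1" using \<alpha> by simp_all
  have U2: "((\<lambda>z. \<rho> z * (u z)\<^sup>2) has_real_derivative r * (u \<xi>)\<^sup>2 + 2 * u \<xi> * ((\<xi> - u \<xi>) * r)) (at \<xi> within S)"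
    by (rule derivative_eq_intros r u refl)+ (simp add: field_simps)
  have U3: "((\<lambda>z. \<rho> z * u z ^ 3) has_real_derivative r * u \<xi> ^ 3 + 3 * (u \<xi>)\<^sup>2 * ((\<xi> - u \<xi>) * r)) (at \<xi> within S)"
    by (rule derivative_eq_intros r u refl)+ (simp add: field_simps)
  have char': "\<alpha> * p = (\<xi> - u \<xi>)\<^sup>2" using char by (simp add: p_def)
  show "((\<lambda>z. \<rho> z * (u z)\<^sup>2 - \<rho> z powr (- \<alpha>)) has_real_derivative \<xi> * (\<xi> * r)) (at \<xi> within S)"
    by (rule DERIV_cong [OF DERIV_diff [OF U2 P]]) (use char' in algebra)
  define e where "e = (r * (u \<xi>)\<^sup>2 + 2 * u \<xi> * ((\<xi> - u \<xi>) * r)) / 2 + (- \<alpha> * p * r) / (1 + \<alpha>)"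
  have "((\<lambda>z. eta \<alpha> (\<rho> z, u z)) has_real_derivative e) (at \<xi> within S)"
    unfolding eta.simps e_def
    by (rule DERIV_add [OF DERIV_cdivide [OF U2] DERIV_cdivide [OF P]])
  moreover have "((\<lambda>z. Q \<alpha> (\<rho> z, u z)) has_real_derivative \<xi> * e) (at \<xi> within S)"
  proof -
    have "(r * u \<xi> ^ 3 + 3 * (u \<xi>)\<^sup>2 * ((\<xi> - u \<xi>) * r)) / 2 -
        (\<alpha> / (1 + \<alpha>) * (- \<alpha> * p * r) * u \<xi> +
         (\<xi> - u \<xi>) * r / \<rho> \<xi> * (\<alpha> / (1 + \<alpha>) * \<rho> \<xi> powr (- \<alpha>))) = \<xi> * e"
      unfolding e_def p divide_inverse using k char' by algebra
    then show ?thesis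
      unfolding Q.simps
      by (intro DERIV_cong [OF DERIV_diff [OF DERIV_cdivide [OF U3] DERIV_mult [OF DERIV_cmult [OF P] u]]])
  qed
  ultimately show "\<exists>e. ((\<lambda>z. eta \<alpha> (\<rho> z, u z)) has_real_derivative e) (at \<xi> within S) \<and>
             ((\<lambda>z. Q \<alpha> (\<rho> z, u z)) has_real_derivative \<xi> * e) (at \<xi> within S)" by blast
qed

lemma eigenvalue_characteristic:
  assumes "eigenvalue \<alpha> i (\<rho>, u) = \<xi>" "0 < \<alpha>" "0 < \<rho>"
  shows "(\<xi> - u)\<^sup>2 = \<alpha> * \<rho> powr (- \<alpha> - 1)"
proof -
  have "(\<rho> powr (- (1 + \<alpha>) / 2))\<^sup>2 = \<rho> powr (- \<alpha> - 1)"
  proof -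
    have "- (1 + \<alpha>) / 2 + - (1 + \<alpha>) / 2 = - \<alpha> - 1" by (simp add: field_simps)
    then show ?thesis by (simp only: power2_eq_square powr_add [symmetric])
  qed
  moreover have "(\<xi> - u)\<^sup>2 = (sqrt \<alpha> * \<rho> powr (- (1 + \<alpha>) / 2))\<^sup>2"
    using assms(1) by (cases i) auto
  ultimately show ?thesis using assms by (simp add: power_mult_distrib)
qed

text \<open>Only the first component of the flux is needed to recover the derivative of the velocity from the
continuity equation.\<close>

lemma fan_derivatives:
  assumes V: "rarefaction_wave \<alpha> i Ul Ur V" and \<alpha>: "0 < \<alpha>"
    and \<xi>: "\<xi> \<in> {eigenvalue \<alpha> i Ul..eigenvalue \<alpha> i Ur}" (is "_ \<in> ?I")
  shows "\<exists>r. ((\<lambda>z. fst (V z)) has_real_derivative r) (at \<xi> within ?I) \<and>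
             ((\<lambda>z. snd (V z)) has_real_derivative (\<xi> - snd (V \<xi>)) * r / fst (V \<xi>)) (at \<xi> within ?I)"
proof -
  have pos: "fst (V z) > 0" if "z \<in> ?I" for z
    using V that by (auto simp: rarefaction_wave_def Let_def)
  obtain w where w: "((\<lambda>z. conserved (V z)) has_vector_derivative w) (at \<xi> within ?I)"
      "((\<lambda>z. flux \<alpha> (V z)) has_vector_derivative \<xi> *\<^sub>R w) (at \<xi> within ?I)"
    using V \<xi> unfolding rarefaction_wave_def Let_def by blast
  have cons: "conserved U = (fst U, fst U * snd U)" "fst (flux \<alpha> U) = fst U * snd U" for U
    by (cases U; simp)+
  have r: "((\<lambda>z. fst (V z)) has_real_derivative fst w) (at \<xi> within ?I)"
    using bounded_linear.has_vector_derivative [OF bounded_linear_fst w(1)]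
    by (simp add: has_real_derivative_iff_has_vector_derivative cons)
  have q: "((\<lambda>z. fst (V z) * snd (V z)) has_real_derivative \<xi> * fst w) (at \<xi> within ?I)"
    using bounded_linear.has_vector_derivative [OF bounded_linear_fst w(2)]
    by (simp add: has_real_derivative_iff_has_vector_derivative cons)
  have "((\<lambda>z. fst (V z) * snd (V z) / fst (V z)) has_real_derivative
      (\<xi> - snd (V \<xi>)) * fst w / fst (V \<xi>)) (at \<xi> within ?I)"
    by (rule derivative_eq_intros r q refl)+
      (use pos [OF \<xi>] in \<open>simp_all add: field_simps\<close>)
  then have "((\<lambda>z. snd (V z)) has_real_derivative
      (\<xi> - snd (V \<xi>)) * fst w / fst (V \<xi>)) (at \<xi> within ?I)"
    by (rule has_field_derivative_transform_within [OF _ zero_less_one \<xi>]) (use pos in force)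
  with r show ?thesis by blast
qed

text \<open>The Riemann invariant \<open>u - k * \<tau> powr ((1 + \<alpha>) / 2)\<close> is constant along the fan.  Given this, the
eigenvalue is an increasing function of the volume because \<open>\<alpha> < 1\<close>, that is, because the field is
genuinely nonlinear.\<close>

lemma first_rarefaction_states:
  assumes \<alpha>: "0 < \<alpha>" "\<alpha> < 1" and pos: "0 < \<rho>l" "0 < \<rho>r"
    and V: "rarefaction_wave \<alpha> First (\<rho>l, ul) (\<rho>r, ur) V"
  shows "1 / \<rho>l < 1 / \<rho>r \<and> ur = ul - velocity_loss \<alpha> (1 / \<rho>l) (1 / \<rho>r)"
proof -
  define \<beta> where "\<beta> = (1 + \<alpha>) / 2"
  define k where "k = 2 * sqrt \<alpha> / (1 + \<alpha>)"
  define I where "I = {eigenvalue \<alpha> First (\<rho>l, ul)..eigenvalue \<alpha> First (\<rho>r, ur)}"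
  have k\<beta>: "k * \<beta> = sqrt \<alpha>" using \<alpha> by (simp add: k_def \<beta>_def)
  have V': "eigenvalue \<alpha> First (\<rho>l, ul) < eigenvalue \<alpha> First (\<rho>r, ur)"
      "V (eigenvalue \<alpha> First (\<rho>l, ul)) = (\<rho>l, ul)" "V (eigenvalue \<alpha> First (\<rho>r, ur)) = (\<rho>r, ur)"
      "\<And>z. z \<in> I \<Longrightarrow> 0 < fst (V z) \<and> eigenvalue \<alpha> First (V z) = z"
    using V by (auto simp: rarefaction_wave_def Let_def I_def)
  have "\<exists>c. \<forall>z\<in>I. snd (V z) - k * fst (V z) powr (- \<beta>) = c"
  proof (rule has_field_derivative_zero_constant)
    show "convex I" by (simp add: I_def)
    fix z assume z: "z \<in> I"
    obtain r where r: "((\<lambda>z. fst (V z)) has_real_derivative r) (at z within I)"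
      "((\<lambda>z. snd (V z)) has_real_derivative (z - snd (V z)) * r / fst (V z)) (at z within I)"
      using fan_derivatives [OF V \<alpha>(1)] z unfolding I_def by blast
    have p: "0 < fst (V z)" using V'(4) [OF z] by simp
    have "- (1 + \<alpha>) / 2 = - \<beta>" by (simp add: \<beta>_def field_simps)
    then have c: "z - snd (V z) = - (sqrt \<alpha> * fst (V z) powr (- \<beta>))"
      using V'(4) [OF z] by (cases "V z") (auto simp del: minus_add_distrib)
    have "((\<lambda>z. fst (V z) powr (- \<beta>)) has_real_derivative - \<beta> * fst (V z) powr (- \<beta>) * r / fst (V z)) (at z within I)"
      by (rule derivative_eq_intros r p refl)+ (use p in \<open>simp add: powr_diff\<close>)
    from DERIV_diff [OF r(2) DERIV_cmult [OF this, of k]]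
    show "((\<lambda>z. snd (V z) - k * fst (V z) powr (- \<beta>)) has_real_derivative 0) (at z within I)"
      unfolding c k\<beta> [symmetric] by (simp add: algebra_simps)
  qed
  then have eq: "ul - k * \<rho>l powr (- \<beta>) = ur - k * \<rho>r powr (- \<beta>)"
    using V'(1-3) unfolding I_def by (metis atLeastAtMost_iff fst_conv less_eq_real_def snd_conv)
  define A B where "A = \<rho>l powr (- \<beta>)" and "B = \<rho>r powr (- \<beta>)"
  have AB: "A = (1 / \<rho>l) powr \<beta>" "B = (1 / \<rho>r) powr \<beta>"
    using pos by (auto simp: A_def B_def powr_neg_volume)
  have b: "- (1 + \<alpha>) / 2 = - \<beta>" by (simp add: \<beta>_def field_simps)
  have "ul - sqrt \<alpha> * A < ur - sqrt \<alpha> * B"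
    using V'(1) unfolding eigenvalue.simps b by (simp add: A_def B_def)
  with eq have "(k - sqrt \<alpha>) * A < (k - sqrt \<alpha>) * B"
    unfolding A_def [symmetric] B_def [symmetric] by (simp add: algebra_simps)
  moreover have "k - sqrt \<alpha> > 0"
    using \<alpha> by (simp add: k_def field_simps)
  ultimately have "A < B" by simp
  then have lt: "1 / \<rho>l < 1 / \<rho>r"
    unfolding AB using pos \<alpha> by (metis \<beta>_def add_pos_pos half_gt_zero less_eq_real_def not_less
        powr_mono2 zero_less_divide_1_iff zero_less_one)
  have "velocity_loss \<alpha> (1 / \<rho>l) (1 / \<rho>r) = k * (A - B)"
    using lt by (simp add: velocity_loss_def k_def \<beta>_def AB)
  then show ?thesis
    using eq lt by (simp add: A_def [symmetric] B_def [symmetric] algebra_simps)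
qed

text \<open>With the Riemann invariant fixed at \<open>w\<close>, the eigenvalue is affine in \<open>\<rho> powr (- (1 + \<alpha>) / 2)\<close>, so the
profile can be written down explicitly.\<close>

lemma ex_first_rarefaction:
  assumes \<alpha>: "0 < \<alpha>" "\<alpha> < 1" and pos: "0 < \<rho>l" "0 < \<rho>r"
    and lt: "1 / \<rho>l < 1 / \<rho>r" and ur: "ur = ul - velocity_loss \<alpha> (1 / \<rho>l) (1 / \<rho>r)"
  shows "\<exists>V. rarefaction_wave \<alpha> First (\<rho>l, ul) (\<rho>r, ur) V"
proof -
  define \<beta> where "\<beta> = (1 + \<alpha>) / 2"
  define k where "k = 2 * sqrt \<alpha> / (1 + \<alpha>)"
  define K where "K = k - sqrt \<alpha>"
  \<comment> \<open>the Riemann invariant\<close>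
  define w where "w = ul - k * \<rho>l powr (- \<beta>)"
  define \<rho> where "\<rho> \<xi> = ((\<xi> - w) / K) powr (- 1 / \<beta>)" for \<xi>
  define u where "u \<xi> = w + k * ((\<xi> - w) / K)" for \<xi>
  have k\<beta>: "k * \<beta> = sqrt \<alpha>" "\<beta> > 0" using \<alpha> by (auto simp: k_def \<beta>_def)
  have K: "K > 0" using \<alpha> by (simp add: K_def k_def field_simps)
  have b: "- (1 + \<alpha>) / 2 = - \<beta>" by (simp add: \<beta>_def field_simps)
  have AB: "\<rho>l powr (- \<beta>) = (1 / \<rho>l) powr \<beta>" "\<rho>r powr (- \<beta>) = (1 / \<rho>r) powr \<beta>"
    using pos by (auto simp: powr_neg_volume)
  have AB_less: "\<rho>l powr (- \<beta>) < \<rho>r powr (- \<beta>)"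
    unfolding AB using lt pos k\<beta> by (intro powr_less_mono2) auto
  have w: "ur = w + k * \<rho>r powr (- \<beta>)" "ul = w + k * \<rho>l powr (- \<beta>)"
  proof -
    have "velocity_loss \<alpha> (1 / \<rho>l) (1 / \<rho>r) = k * (\<rho>l powr (- \<beta>) - \<rho>r powr (- \<beta>))"
      unfolding AB using lt by (simp add: velocity_loss_def k_def \<beta>_def)
    then show "ur = w + k * \<rho>r powr (- \<beta>)" "ul = w + k * \<rho>l powr (- \<beta>)"
      unfolding w_def using ur by (simp_all add: algebra_simps)
  qed
  have ev: "eigenvalue \<alpha> First (\<rho>l, ul) = w + K * \<rho>l powr (- \<beta>)"
      "eigenvalue \<alpha> First (\<rho>r, ur) = w + K * \<rho>r powr (- \<beta>)"
    unfolding eigenvalue.simps b by (simp_all add: w K_def algebra_simps)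
  have ends: "\<rho> (w + K * x powr (- \<beta>)) = x" "u (w + K * x powr (- \<beta>)) = w + k * x powr (- \<beta>)" if "x > 0" for x
    using K k\<beta> that by (auto simp: \<rho>_def u_def powr_powr)
  have "rarefaction_wave \<alpha> First (\<rho>l, ul) (\<rho>r, ur) (\<lambda>\<xi>. (\<rho> \<xi>, u \<xi>))"
    unfolding rarefaction_wave_def Let_def ev
  proof (intro conjI ballI)
    show "w + K * \<rho>l powr (- \<beta>) < w + K * \<rho>r powr (- \<beta>)" using AB_less K by simp
    show "(\<rho> (w + K * \<rho>l powr (- \<beta>)), u (w + K * \<rho>l powr (- \<beta>))) = (\<rho>l, ul)"
      "(\<rho> (w + K * \<rho>r powr (- \<beta>)), u (w + K * \<rho>r powr (- \<beta>))) = (\<rho>r, ur)"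
      using pos by (simp_all add: ends w)
    fix \<xi> assume \<xi>: "\<xi> \<in> {w + K * \<rho>l powr (- \<beta>)..w + K * \<rho>r powr (- \<beta>)}" (is "_ \<in> ?I")
    define a where "a = (\<xi> - w) / K"
    have "\<xi> > w" using \<xi> K pos by (smt (verit) atLeastAtMost_iff powr_gt_zero mult_pos_pos)
    then have a: "a > 0" "\<xi> = w + K * a" using K by (auto simp: a_def)
    have \<rho>: "\<rho> \<xi> > 0" "\<rho> \<xi> powr (- \<beta>) = a"
      using a(1) k\<beta> by (simp_all add: \<rho>_def a_def [symmetric] powr_powr)
    show p: "fst (\<rho> \<xi>, u \<xi>) > 0" using \<rho> by simp
    show e: "eigenvalue \<alpha> First (\<rho> \<xi>, u \<xi>) = \<xi>"
    proof -
      have u: "u \<xi> = w + k * a" by (simp add: u_def a_def)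
      have "w + k * a - sqrt \<alpha> * a = \<xi>" using a(2) by (simp add: K_def algebra_simps)
      then show ?thesis unfolding eigenvalue.simps b \<rho> u .
    qed
    have c: "\<xi> - u \<xi> = - (sqrt \<alpha> * a)"
      using e unfolding eigenvalue.simps b \<rho> by simp
    define r where "r = (- 1 / \<beta>) * \<rho> \<xi> / a * (1 / K)"
    have dr: "(\<rho> has_real_derivative r) (at \<xi> within ?I)"
    proof -
      have d: "((\<lambda>z. (z - w) / K) has_real_derivative 1 / K) (at \<xi> within ?I)"
        using K by (auto intro!: derivative_eq_intros)
      have "- 1 / \<beta> * a powr (- 1 / \<beta> - 1) * (1 / K) = r"
        using a(1) by (simp add: r_def \<rho>_def a_def [symmetric] powr_diff)
      with DERIV_chain2 [OF has_real_derivative_powr [of "(\<xi> - w) / K"] d, of "- 1 / \<beta>"] a(1)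
      show ?thesis unfolding \<rho>_def a_def by simp
    qed
    have "(u has_real_derivative k * (1 / K)) (at \<xi> within ?I)"
      unfolding u_def using K by (auto intro!: derivative_eq_intros)
    also have "k * (1 / K) = (\<xi> - u \<xi>) * r / \<rho> \<xi>"
      unfolding c r_def k\<beta>(1) [symmetric] using a(1) k\<beta>(2) \<rho>(1) by simp
    finally have du: "(u has_real_derivative (\<xi> - u \<xi>) * r / \<rho> \<xi>) (at \<xi> within ?I)" .
    note D = simple_wave_derivatives [OF dr du \<rho>(1) eigenvalue_characteristic [OF e \<alpha>(1) \<rho>(1)] \<alpha>(1)]
    show "\<exists>w. ((\<lambda>z. conserved (\<rho> z, u z)) has_vector_derivative w) (at \<xi> within ?I) \<and>
         ((\<lambda>z. flux \<alpha> (\<rho> z, u z)) has_vector_derivative \<xi> *\<^sub>R w) (at \<xi> within ?I)"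
    proof (intro exI conjI)
      show "((\<lambda>z. conserved (\<rho> z, u z)) has_vector_derivative (r, \<xi> * r)) (at \<xi> within ?I)"
        using has_vector_derivative_Pair [OF dr [unfolded has_real_derivative_iff_has_vector_derivative]
            D(1) [unfolded has_real_derivative_iff_has_vector_derivative]] by simp
      show "((\<lambda>z. flux \<alpha> (\<rho> z, u z)) has_vector_derivative \<xi> *\<^sub>R (r, \<xi> * r)) (at \<xi> within ?I)"
        using has_vector_derivative_Pair [OF D(1) [unfolded has_real_derivative_iff_has_vector_derivative]
            D(2) [unfolded has_real_derivative_iff_has_vector_derivative]] by (simp add: powr_minus_divide)
    qed
  qed
  then show ?thesis by blast
qed

text \<open>The reflection \<open>x \<mapsto> - x\<close> exchanges the families and the two sides of a wave, so statements on the
second family follow from those on the first.\<close>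

definition mirror :: "state \<Rightarrow> state" where
  "mirror U = (fst U, - snd U)"

lemma mirror_simps [simp]: "mirror (\<rho>, u) = (\<rho>, - u)" "fst (mirror U) = fst U"
    "snd (mirror U) = - snd U" "mirror (mirror U) = U"
  by (simp_all add: mirror_def)

lemma second_shock_mirror:
  "shock_wave \<alpha> Second Ul Ur s \<longleftrightarrow> shock_wave \<alpha> First (mirror Ur) (mirror Ul) (- s)"
  by (cases Ul; cases Ur) (auto simp: shock_wave_def algebra_simps)

lemma second_rarefaction_mirror_imp:
  assumes "rarefaction_wave \<alpha> i Ul Ur V" "{i, j} = {First, Second}"
  shows "rarefaction_wave \<alpha> j (mirror Ur) (mirror Ul) (\<lambda>\<xi>. mirror (V (- \<xi>)))"
proof -
  have ev: "eigenvalue \<alpha> j (mirror U) = - eigenvalue \<alpha> i U" for U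
    using assms(2) by (cases U; cases i; cases j) auto
  let ?I = "{eigenvalue \<alpha> i Ul..eigenvalue \<alpha> i Ur}"
  let ?J = "{- eigenvalue \<alpha> i Ur..- eigenvalue \<alpha> i Ul}"
  have img: "uminus ` ?J = ?I" by simp
  have lin: "bounded_linear (\<lambda>x::real \<times> real. (- fst x, snd x))" "bounded_linear (\<lambda>x::real \<times> real. (fst x, - snd x))"
    by (auto intro!: bounded_linear_Pair bounded_linear_minus bounded_linear_fst bounded_linear_snd)
  have cf: "conserved (mirror U) = (fst (conserved U), - snd (conserved U))"
      "flux \<alpha> (mirror U) = (- fst (flux \<alpha> U), snd (flux \<alpha> U))" for U
    by (cases U; simp)+
  have step: "\<exists>w. ((\<lambda>z. conserved (mirror (V (- z)))) has_vector_derivative w) (at \<xi> within ?J) \<and>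
      ((\<lambda>z. flux \<alpha> (mirror (V (- z)))) has_vector_derivative \<xi> *\<^sub>R w) (at \<xi> within ?J)"
    if \<xi>: "\<xi> \<in> ?J" for \<xi>
  proof -
    have "- \<xi> \<in> ?I" using \<xi> by auto
    then obtain w where w: "((\<lambda>z. conserved (V z)) has_vector_derivative w) (at (- \<xi>) within ?I)"
        "((\<lambda>z. flux \<alpha> (V z)) has_vector_derivative (- \<xi>) *\<^sub>R w) (at (- \<xi>) within ?I)"
      using assms(1) unfolding rarefaction_wave_def Let_def by blast
    have neg: "(uminus has_vector_derivative - 1) (at \<xi> within ?J)"
      by (auto intro!: derivative_eq_intros)
    have w': "((\<lambda>z. conserved (V (- z))) has_vector_derivative - w) (at \<xi> within ?J)"
        "((\<lambda>z. flux \<alpha> (V (- z))) has_vector_derivative \<xi> *\<^sub>R w) (at \<xi> within ?J)"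
      using vector_diff_chain_within [OF neg w(1) [folded img]]
        vector_diff_chain_within [OF neg w(2) [folded img]] by (simp_all add: o_def)
    show ?thesis
      unfolding cf
      by (rule exI [of _ "(- fst w, snd w)"])
        (use bounded_linear.has_vector_derivative [OF lin(2) w'(1)]
          bounded_linear.has_vector_derivative [OF lin(1) w'(2)] in \<open>simp add: scaleR_prod_def\<close>)
  qed
  show ?thesis
    using assms(1) step unfolding rarefaction_wave_def Let_def ev by auto
qed

lemma second_rarefaction_mirror:
  "(\<exists>V. rarefaction_wave \<alpha> Second Ul Ur V) \<longleftrightarrow> (\<exists>V. rarefaction_wave \<alpha> First (mirror Ur) (mirror Ul) V)"
  using second_rarefaction_mirror_imp [of \<alpha> Second Ul Ur _ First]
    second_rarefaction_mirror_imp [of \<alpha> First "mirror Ur" "mirror Ul" _ Second] by auto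

lemma second_shock_production_mirror:
  "wave_production \<alpha> (Shock Second Ul Ur s) = wave_production \<alpha> (Shock First (mirror Ur) (mirror Ul) (- s))"
  by (cases Ul; cases Ur) (simp add: algebra_simps)

fun wave_family :: "wave \<Rightarrow> family option" where
  "wave_family (Shock i Ul Ur s) = Some i"
| "wave_family (Rarefaction i Ul Ur V) = Some i"
| "wave_family (Shadow Ul Ur c V) = None"

abbreviation volume :: "state \<Rightarrow> real" where
  "volume U \<equiv> 1 / fst U"

lemma first_wave_states:
  assumes \<alpha>: "0 < \<alpha>" "\<alpha> < 1" and w: "admissible_wave \<alpha> w" "wave_family w = Some First"
  shows "snd (right_state w) = snd (left_state w) - velocity_loss \<alpha> (volume (left_state w)) (volume (right_state w))"
    and "wave_production \<alpha> w = dissipation \<alpha> (volume (left_state w)) (volume (right_state w))"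
proof -
  note shock = first_shock_iff [OF \<alpha>] and prod = first_shock_production [OF \<alpha>] 
  note rare = first_rarefaction_states [OF \<alpha>]
  show "snd (right_state w) = snd (left_state w) - velocity_loss \<alpha> (volume (left_state w)) (volume (right_state w))"
  proof (cases w)
    case (Shock i Ul Ur s)
    with w show ?thesis by (cases Ul; cases Ur) (auto simp: shock)
  next
    case (Rarefaction i Ul Ur V)
    with w show ?thesis by (cases Ul; cases Ur) (auto dest!: rare [rotated 2])
  qed (use w in auto)
  show "wave_production \<alpha> w = dissipation \<alpha> (volume (left_state w)) (volume (right_state w))"
  proof (cases w)
    case (Shock i Ul Ur s)
    with w show ?thesis by (cases Ul; cases Ur) (use prod in auto)
  next
    case (Rarefaction i Ul Ur V)
    with w show ?thesis by (cases Ul; cases Ur) (auto dest!: rare [rotated 2] simp: dissipation_def)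
  qed (use w in auto)
qed

lemma second_wave_states:
  assumes \<alpha>: "0 < \<alpha>" "\<alpha> < 1" and w: "admissible_wave \<alpha> w" "wave_family w = Some Second"
  shows "snd (right_state w) = snd (left_state w) - velocity_loss \<alpha> (volume (right_state w)) (volume (left_state w))"
    and "wave_production \<alpha> w = dissipation \<alpha> (volume (right_state w)) (volume (left_state w))"
proof -
  have "\<exists>w'. admissible_wave \<alpha> w' \<and> wave_family w' = Some First \<and> left_state w' = mirror (right_state w) \<and>
      right_state w' = mirror (left_state w) \<and> wave_production \<alpha> w' = wave_production \<alpha> w"
  proof (cases w)
    case (Shock i Ul Ur s)
    with w second_shock_mirror [of \<alpha> Ul Ur s] second_shock_production_mirror [of \<alpha> Ul Ur s] show ?thesis
      by (intro exI [of _ "Shock First (mirror Ur) (mirror Ul) (- s)"]) simp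
  next
    case (Rarefaction i Ul Ur V)
    with w second_rarefaction_mirror_imp [of \<alpha> Second Ul Ur V First] show ?thesis
      by (intro exI [of _ "Rarefaction First (mirror Ur) (mirror Ul) (\<lambda>\<xi>. mirror (V (- \<xi>)))"]) auto
  qed (use w in auto)
  then obtain w' where "admissible_wave \<alpha> w'" "wave_family w' = Some First" "left_state w' = mirror (right_state w)"
      "right_state w' = mirror (left_state w)" "wave_production \<alpha> w' = wave_production \<alpha> w" by blast
  with first_wave_states [OF \<alpha>, of w']
  show "snd (right_state w) = snd (left_state w) - velocity_loss \<alpha> (volume (right_state w)) (volume (left_state w))"
    "wave_production \<alpha> w = dissipation \<alpha> (volume (right_state w)) (volume (left_state w))" by simp_all
qed

lemma ex_first_wave:
  assumes \<alpha>: "0 < \<alpha>" "\<alpha> < 1" and pos: "0 < fst Ul" "0 < fst Ur" and ne: "Ul \<noteq> Ur"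
    and v: "snd Ur = snd Ul - velocity_loss \<alpha> (volume Ul) (volume Ur)"
  shows "\<exists>w. admissible_wave \<alpha> w \<and> wave_family w = Some First \<and> left_state w = Ul \<and> right_state w = Ur"
proof -
  consider "volume Ur < volume Ul" | "volume Ul < volume Ur" | "volume Ul = volume Ur" by linarith
  then show ?thesis
  proof cases
    case 1
    define s where "s = snd Ul - volume Ul * mass_flux \<alpha> (volume Ul) (volume Ur)"
    have "shock_wave \<alpha> First (fst Ul, snd Ul) (fst Ur, snd Ur) s"
      unfolding first_shock_iff [OF \<alpha> pos] s_def using 1 v by blast
    then show ?thesis using pos by (intro exI [of _ "Shock First Ul Ur s"]) simp
  next
    case 2
    with ex_first_rarefaction [OF \<alpha> pos 2 v] obtain V where "rarefaction_wave \<alpha> First Ul Ur V" by auto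
    then show ?thesis using pos by (intro exI [of _ "Rarefaction First Ul Ur V"]) auto
  next
    case 3
    then have "fst Ul = fst Ur" using pos by simp
    moreover have "snd Ul = snd Ur" using v 3 by simp
    ultimately show ?thesis using ne by (simp add: prod_eq_iff)
  qed
qed

lemma ex_second_wave:
  assumes \<alpha>: "0 < \<alpha>" "\<alpha> < 1" and pos: "0 < fst Ul" "0 < fst Ur" and ne: "Ul \<noteq> Ur"
    and v: "snd Ur = snd Ul - velocity_loss \<alpha> (volume Ur) (volume Ul)"
  shows "\<exists>w. admissible_wave \<alpha> w \<and> wave_family w = Some Second \<and> left_state w = Ul \<and> right_state w = Ur"
proof -
  have "mirror Ur \<noteq> mirror Ul" using ne by (metis mirror_simps(4))
  with ex_first_wave [OF \<alpha>, of "mirror Ur" "mirror Ul"] pos v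
  obtain w where w: "admissible_wave \<alpha> w" "wave_family w = Some First" "left_state w = mirror Ur"
    "right_state w = mirror Ul" by auto
  show ?thesis
  proof (cases w)
    case (Shock i U U' s)
    with w pos second_shock_mirror [of \<alpha> Ul Ur "- s"] show ?thesis
      by (intro exI [of _ "Shock Second Ul Ur (- s)"]) auto
  next
    case (Rarefaction i U U' V)
    with w second_rarefaction_mirror [of \<alpha> Ul Ur] obtain V' where "rarefaction_wave \<alpha> Second Ul Ur V'" by auto
    with pos show ?thesis by (intro exI [of _ "Rarefaction Second Ul Ur V'"]) auto
  qed (use w in auto)
qed


section \<open>Classical solutions\<close>

lemma left_speed_le: "0 < \<epsilon> \<Longrightarrow> left_speed \<alpha> w \<epsilon> \<le> left_speed \<alpha> w 0"
  and right_speed_ge: "0 < \<epsilon> \<Longrightarrow> right_speed \<alpha> w 0 \<le> right_speed \<alpha> w \<epsilon>"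
  by (cases w; simp)+

lemma separated_Cons_Cons:
  assumes "separated \<alpha> (w # w' # ws)"
  shows "right_speed \<alpha> w 0 < left_speed \<alpha> w' 0" "separated \<alpha> (w' # ws)"
proof -
  from assms have ev: "\<forall>\<^sub>F \<epsilon> in at_right 0. right_speed \<alpha> w \<epsilon> < left_speed \<alpha> w' \<epsilon>" 
    and "separated \<alpha> (w' # ws)"
    by (simp_all add: separated_def)
  show "separated \<alpha> (w' # ws)" by fact
  have "\<forall>\<^sub>F \<epsilon> in at_right 0. (0::real) < \<epsilon>" by (simp add: eventually_at_right_less)
  with ev have "\<forall>\<^sub>F \<epsilon> in at_right (0::real). right_speed \<alpha> w 0 < left_speed \<alpha> w' 0"
    by eventually_elim (use left_speed_le right_speed_ge in \<open>meson le_less_trans less_le_trans\<close>)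
  then show "right_speed \<alpha> w 0 < left_speed \<alpha> w' 0" by simp
qed

lemma eigenvalue_less:
  "0 < \<alpha> \<Longrightarrow> 0 < fst U \<Longrightarrow> eigenvalue \<alpha> First U < snd U"
  "0 < \<alpha> \<Longrightarrow> 0 < fst U \<Longrightarrow> snd U < eigenvalue \<alpha> Second U"
  by (cases U; simp)+

lemma wave_states_pos:
  "admissible_wave \<alpha> w \<Longrightarrow> 0 < fst (left_state w)"
  "admissible_wave \<alpha> w \<Longrightarrow> 0 < fst (right_state w)"
  by (cases w; simp)+

text \<open>This and the next lemma reduce the order of waves to the eigenvalues of the state between them.\<close>

lemma left_speed_bounds:
  assumes "0 < \<alpha>" "admissible_wave \<alpha> w"
  shows "left_speed \<alpha> w 0 \<le> eigenvalue \<alpha> Second (left_state w)"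
    and "wave_family w \<noteq> Some Second \<Longrightarrow> left_speed \<alpha> w 0 \<le> eigenvalue \<alpha> First (left_state w)"
proof -
  have less: "eigenvalue \<alpha> First (left_state w) < eigenvalue \<alpha> Second (left_state w)"
    using eigenvalue_less [OF assms(1) wave_states_pos(1) [OF assms(2)]] by linarith
  show 1: "left_speed \<alpha> w 0 \<le> eigenvalue \<alpha> First (left_state w)" if "wave_family w \<noteq> Some Second"
    using that assms
  proof (cases w)
    case (Shock i Ul Ur s)
    with that assms show ?thesis by (cases i) (auto simp: shock_wave_def)
  next
    case (Rarefaction i Ul Ur V)
    with that assms show ?thesis by (cases i) auto
  qed (auto simp: overcompressive_def)
  show "left_speed \<alpha> w 0 \<le> eigenvalue \<alpha> Second (left_state w)"
  proof (cases "wave_family w = Some Second")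
    case True
    then show ?thesis using assms by (cases w) (auto simp: shock_wave_def)
  qed (use 1 less in force)
qed

lemma right_speed_bounds:
  assumes "0 < \<alpha>" "admissible_wave \<alpha> w"
  shows "eigenvalue \<alpha> First (right_state w) \<le> right_speed \<alpha> w 0"
    and "wave_family w \<noteq> Some First \<Longrightarrow> eigenvalue \<alpha> Second (right_state w) \<le> right_speed \<alpha> w 0"
proof -
  have less: "eigenvalue \<alpha> First (right_state w) < eigenvalue \<alpha> Second (right_state w)"
    using eigenvalue_less [OF assms(1) wave_states_pos(2) [OF assms(2)]] by linarith
  show 1: "eigenvalue \<alpha> Second (right_state w) \<le> right_speed \<alpha> w 0" if "wave_family w \<noteq> Some First"
    using that assms
  proof (cases w)
    case (Shock i Ul Ur s)
    with that assms show ?thesis by (cases i) (auto simp: shock_wave_def)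
  next
    case (Rarefaction i Ul Ur V)
    with that assms show ?thesis by (cases i) auto
  qed (auto simp: overcompressive_def)
  show "eigenvalue \<alpha> First (right_state w) \<le> right_speed \<alpha> w 0"
  proof (cases "wave_family w = Some First")
    case True
    then show ?thesis using assms by (cases w) (auto simp: shock_wave_def)
  qed (use 1 less in force)
qed

text \<open>If the left wave were not of the first family, the second eigenvalue of the common state would be at
most its speed and at least the speed of the right wave; similarly with the first eigenvalue if the
right wave were not of the second family.\<close>

lemma consecutive_wave_families:
  assumes "0 < \<alpha>" "admissible_wave \<alpha> w" "admissible_wave \<alpha> w'"
    and "right_state w = left_state w'" "right_speed \<alpha> w 0 < left_speed \<alpha> w' 0"
  shows "wave_family w = Some First" "wave_family w' = Some Second"
  using right_speed_bounds [OF assms(1,2)] left_speed_bounds [OF assms(1,3)] assms(4,5)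
  by force+

lemma riemann_solution_cases:
  assumes \<alpha>: "0 < \<alpha>" and sol: "riemann_solution \<alpha> U0 U1 ws"
  obtains "ws = []" "U0 = U1"
    | w where "ws = [w]" "admissible_wave \<alpha> w" "left_state w = U0" "right_state w = U1"
    | w w' where "ws = [w, w']" "admissible_wave \<alpha> w" "admissible_wave \<alpha> w'"
        "wave_family w = Some First" "wave_family w' = Some Second"
        "left_state w = U0" "right_state w = left_state w'" "right_state w' = U1"
        "right_speed \<alpha> w 0 < left_speed \<alpha> w' 0"
proof (cases ws)
  case Nil
  with sol that(1) show thesis by (simp add: riemann_solution_def)
next
  case (Cons w ws')
  show thesis
  proof (cases ws')
    case Nil
    with Cons sol that(2) show thesis by (simp add: riemann_solution_def)
  next
    case 2: (Cons w' ws'')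
    have adm: "admissible_wave \<alpha> w" "admissible_wave \<alpha> w'" and eq: "left_state w = U0" "right_state w = left_state w'"
      and sep: "separated \<alpha> (w # w' # ws'')"
      using sol Cons 2 by (auto simp: riemann_solution_def)
    note sp = separated_Cons_Cons [OF sep]
    note fam = consecutive_wave_families [OF \<alpha> adm eq(2) sp(1)]
    show thesis
    proof (cases ws'')
      case Nil
      with Cons 2 sol adm eq fam sp that(3) show thesis by (simp add: riemann_solution_def)
    next
      case 3: (Cons w'' ws3)
      have "admissible_wave \<alpha> w''" "right_state w' = left_state w''"
        using sol Cons 2 3 by (auto simp: riemann_solution_def)
      from consecutive_wave_families [OF \<alpha> adm(2) this separated_Cons_Cons(1) [OF sp(2) [unfolded 3]]]
      show thesis using fam by simp
    qed
  qed
qed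

lemma classical_wave_iff: "is_Shock w \<or> is_Rarefaction w \<longleftrightarrow> wave_family w \<noteq> None"
  by (cases w) auto

lemma riemann_solution_dichotomy:
  assumes "0 < \<alpha>" "riemann_solution \<alpha> U0 U1 ws"
  shows "classical_solution \<alpha> U0 U1 ws \<or> shadow_solution \<alpha> U0 U1 ws"
  using assms(1,2)
proof (cases rule: riemann_solution_cases)
  case (2 w)
  then show ?thesis using assms(2)
    by (cases w) (auto simp: classical_solution_def shadow_solution_def)
qed (use assms(2) in \<open>auto simp: classical_solution_def classical_wave_iff\<close>)

text \<open>A missing wave is a wave of strength \<open>0\<close>: its loss and dissipation vanish.\<close>

lemma classical_solution_middle_volume:
  assumes \<alpha>: "0 < \<alpha>" "\<alpha> < 1" and pos: "0 < fst U0" and sol: "classical_solution \<alpha> U0 U1 ws"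
  shows "\<exists>\<tau>>0. snd U0 - snd U1 = velocity_loss \<alpha> (volume U0) \<tau> + velocity_loss \<alpha> (volume U1) \<tau> \<and>
    energy_production \<alpha> ws = dissipation \<alpha> (volume U0) \<tau> + dissipation \<alpha> (volume U1) \<tau>"
proof -
  have "riemann_solution \<alpha> U0 U1 ws" and cl: "\<forall>w\<in>set ws. wave_family w \<noteq> None"
    using sol by (simp_all add: classical_solution_def classical_wave_iff)
  from \<alpha>(1) this(1) show ?thesis
  proof (cases rule: riemann_solution_cases)
    case 1
    then show ?thesis using pos by (intro exI [of _ "volume U0"]) (simp add: energy_production_def)
  next
    case (2 w)
    then consider "wave_family w = Some First" | "wave_family w = Some Second"
      using cl by (metis family.exhaust list.set_intros(1) option.exhaust)
    then show ?thesis
    proof cases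
      case 1
      with 2 first_wave_states [OF \<alpha> 2(2) 1] wave_states_pos [OF 2(2)] show ?thesis
        by (intro exI [of _ "volume U1"]) (simp add: energy_production_def)
    next
      case s: 2
      with 2 second_wave_states [OF \<alpha> 2(2) s] wave_states_pos [OF 2(2)] show ?thesis
        by (intro exI [of _ "volume U0"]) (simp add: energy_production_def)
    qed
  next
    case (3 w w')
    with first_wave_states [OF \<alpha> 3(2,4)] second_wave_states [OF \<alpha> 3(3,5)] wave_states_pos(1) [OF 3(3)]
    show ?thesis
      by (intro exI [of _ "volume (left_state w')"]) (simp add: energy_production_def)
  qed
qed

text \<open>With its mirror image below, it separates the two waves of a classical solution: they travel on
different sides of the particles in the middle state.\<close>

lemma first_wave_right_speed_less:
  assumes "0 < \<alpha>" "admissible_wave \<alpha> w" "wave_family w = Some First" "\<alpha> < 1"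
  shows "right_speed \<alpha> w 0 < snd (right_state w)"
proof (cases w)
  case (Shock i Ul Ur s)
  with assms have S: "shock_wave \<alpha> First (fst Ul, snd Ul) (fst Ur, snd Ur) s" "0 < fst Ul" "0 < fst Ur" by auto
  from S(1) have "volume Ur < volume Ul" "snd Ur = snd Ul - velocity_loss \<alpha> (volume Ul) (volume Ur)"
      "s = snd Ul - volume Ul * mass_flux \<alpha> (volume Ul) (volume Ur)"
    unfolding first_shock_iff [OF assms(1,4) S(2,3)] by auto
  moreover from this(1) S have "0 < volume Ur * mass_flux \<alpha> (volume Ul) (volume Ur)"
    using mass_flux_pos [of \<alpha> "volume Ur" "volume Ul"] assms(1) by simp
  ultimately show ?thesis
    using Shock by (simp add: velocity_loss_mass_flux algebra_simps)
next
  case (Rarefaction i Ul Ur V)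
  with assms eigenvalue_less(1) [OF assms(1), of Ur] show ?thesis by simp
qed (use assms in auto)

lemma second_wave_left_speed_greater:
  assumes "0 < \<alpha>" "admissible_wave \<alpha> w" "wave_family w = Some Second" "\<alpha> < 1"
  shows "snd (left_state w) < left_speed \<alpha> w 0"
proof (cases w)
  case (Shock i Ul Ur s)
  with assms have "admissible_wave \<alpha> (Shock First (mirror Ur) (mirror Ul) (- s))"
    by (simp add: second_shock_mirror)
  from first_wave_right_speed_less [OF assms(1) this] assms(4) Shock show ?thesis by simp
next
  case (Rarefaction i Ul Ur V)
  with assms eigenvalue_less(2) [OF assms(1), of Ul] show ?thesis by simp
qed (use assms in auto)

lemma classical_speeds: "wave_family w \<noteq> None \<Longrightarrow> left_speed \<alpha> w \<epsilon> = left_speed \<alpha> w 0"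
  "wave_family w \<noteq> None \<Longrightarrow> right_speed \<alpha> w \<epsilon> = right_speed \<alpha> w 0"
  by (cases w; simp)+

lemma ex_classical_solution:
  assumes \<alpha>: "0 < \<alpha>" "\<alpha> < 1" and pos: "0 < fst U0" "0 < fst U1" and \<tau>: "0 < \<tau>"
    and mid: "snd U0 - snd U1 = velocity_loss \<alpha> (volume U0) \<tau> + velocity_loss \<alpha> (volume U1) \<tau>"
  shows "\<exists>ws. classical_solution \<alpha> U0 U1 ws"
proof -
  define U where "U = (1 / \<tau>, snd U0 - velocity_loss \<alpha> (volume U0) \<tau>)"
  have U: "0 < fst U" "volume U = \<tau>" using \<tau> by (simp_all add: U_def)
  have v: "snd U = snd U0 - velocity_loss \<alpha> (volume U0) (volume U)"
      "snd U1 = snd U - velocity_loss \<alpha> (volume U1) (volume U)"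
    using mid unfolding U(2) by (simp_all add: U_def)
  have cl: "classical_solution \<alpha> V0 V1 ws" if "riemann_solution \<alpha> V0 V1 ws" "\<forall>w\<in>set ws. wave_family w \<noteq> None" for V0 V1 ws
    using that by (simp add: classical_solution_def classical_wave_iff)
  show ?thesis
  proof (cases "U0 = U"; cases "U = U1")
    assume "U0 = U" "U = U1"
    then have "classical_solution \<alpha> U0 U1 []"
      by (intro cl) (simp_all add: riemann_solution_def separated_def)
    then show ?thesis by blast
  next
    assume "U0 = U" "U \<noteq> U1"
    obtain w where
      "admissible_wave \<alpha> w" "wave_family w = Some Second" "left_state w = U" "right_state w = U1"
      using ex_second_wave [OF \<alpha> U(1) pos(2) \<open>U \<noteq> U1\<close> v(2)] by metis
    with \<open>U0 = U\<close> have "classical_solution \<alpha> U0 U1 [w]"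
      by (intro cl) (simp_all add: riemann_solution_def separated_def)
    then show ?thesis by blast
  next
    assume "U0 \<noteq> U" "U = U1"
    obtain w where
      "admissible_wave \<alpha> w" "wave_family w = Some First" "left_state w = U0" "right_state w = U"
      using ex_first_wave [OF \<alpha> pos(1) U(1) \<open>U0 \<noteq> U\<close> v(1)] by metis
    with \<open>U = U1\<close> have "classical_solution \<alpha> U0 U1 [w]"
      by (intro cl) (simp_all add: riemann_solution_def separated_def)
    then show ?thesis by blast
  next
    assume "U0 \<noteq> U" "U \<noteq> U1"
    obtain w where w1: "admissible_wave \<alpha> w" "wave_family w = Some First" "left_state w = U0" "right_state w = U"
      using ex_first_wave [OF \<alpha> pos(1) U(1) \<open>U0 \<noteq> U\<close> v(1)] by metis
    obtain w' where w2:
      "admissible_wave \<alpha> w'" "wave_family w' = Some Second" "left_state w' = U" "right_state w' = U1"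
      using ex_second_wave [OF \<alpha> U(1) pos(2) \<open>U \<noteq> U1\<close> v(2)] by metis
    note w = w1 w2
    have "right_speed \<alpha> w 0 < left_speed \<alpha> w' 0"
      using first_wave_right_speed_less [OF \<alpha>(1) w(1,2) \<alpha>(2)]
        second_wave_left_speed_greater [OF \<alpha>(1) w(5,6) \<alpha>(2)] w by simp
    then have "right_speed \<alpha> w \<epsilon> < left_speed \<alpha> w' \<epsilon>" for \<epsilon>
      using classical_speeds(2) [of w \<alpha> \<epsilon>] classical_speeds(1) [of w' \<alpha> \<epsilon>] w by simp
    then have "classical_solution \<alpha> U0 U1 [w, w']"
      using w by (intro cl) (simp_all add: riemann_solution_def separated_def)
    then show ?thesis by blast
  qed
qed


section \<open>Smooth test functions\<close>

primrec times_differentiable :: "nat \<Rightarrow> (real \<Rightarrow> real) \<Rightarrow> bool" where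
  "times_differentiable 0 f \<longleftrightarrow> True"
| "times_differentiable (Suc n) f \<longleftrightarrow>
     (\<exists>f'. (\<forall>x. (f has_real_derivative f' x) (at x)) \<and> times_differentiable n f')"

definition smooth :: "(real \<Rightarrow> real) \<Rightarrow> bool" where
  "smooth f \<longleftrightarrow> (\<forall>n. times_differentiable n f)"

lemma times_differentiable_Suc_imp: "times_differentiable (Suc n) f \<Longrightarrow> times_differentiable n f"
  by (induction n arbitrary: f) (simp, metis times_differentiable.simps(2))

lemma times_differentiable_const: "times_differentiable n (\<lambda>x. c)"
proof (induction n arbitrary: c)
  case (Suc n)
  have "((\<lambda>x. c) has_real_derivative 0) (at x)" for x by simp
  with Suc [of 0] show ?case by (auto intro!: exI [of _ "\<lambda>x. 0"])
qed simp

lemma times_differentiable_add: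
  "times_differentiable n f \<Longrightarrow> times_differentiable n g \<Longrightarrow> times_differentiable n (\<lambda>x. f x + g x)"
proof (induction n arbitrary: f g)
  case (Suc n)
  then obtain f' g' where "\<And>x. (f has_real_derivative f' x) (at x)" "\<And>x. (g has_real_derivative g' x) (at x)"
    "times_differentiable n f'" "times_differentiable n g'" by auto
  with Suc.IH [of f' g'] show ?case by (auto intro!: exI [of _ "\<lambda>x. f' x + g' x"] DERIV_add)
qed simp

lemma times_differentiable_mult:
  "times_differentiable n f \<Longrightarrow> times_differentiable n g \<Longrightarrow> times_differentiable n (\<lambda>x. f x * g x)"
proof (induction n arbitrary: f g)
  case (Suc n)
  then obtain f' g' where d: "\<And>x. (f has_real_derivative f' x) (at x)" "\<And>x. (g has_real_derivative g' x) (at x)"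
    and "times_differentiable n f'" "times_differentiable n g'" by auto
  then have "times_differentiable n (\<lambda>x. f' x * g x + g' x * f x)"
    using Suc times_differentiable_Suc_imp by (intro times_differentiable_add) blast+
  with d show ?case by (auto intro!: exI [of _ "\<lambda>x. f' x * g x + g' x * f x"] DERIV_mult)
qed simp

lemma times_differentiable_affine:
  "times_differentiable n f \<Longrightarrow> times_differentiable n (\<lambda>x. f (c * x + d))"
proof (induction n arbitrary: f)
  case (Suc n)
  then obtain f' where f': "\<And>x. (f has_real_derivative f' x) (at x)" "times_differentiable n f'" by auto
  then have "((\<lambda>x. f (c * x + d)) has_real_derivative f' (c * x + d) * c) (at x)" for x
    by (auto intro!: derivative_eq_intros DERIV_chain2 [OF f'(1)])
  moreover have "times_differentiable n (\<lambda>x. f' (c * x + d) * c)"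
    by (intro times_differentiable_mult times_differentiable_const Suc.IH f')
  ultimately show ?case by (auto intro!: exI [of _ "\<lambda>x. f' (c * x + d) * c"])
qed simp

lemma smooth_const: "smooth (\<lambda>x. c)"
  and smooth_mult: "smooth f \<Longrightarrow> smooth g \<Longrightarrow> smooth (\<lambda>x. f x * g x)"
  and smooth_add: "smooth f \<Longrightarrow> smooth g \<Longrightarrow> smooth (\<lambda>x. f x + g x)"
  and smooth_affine: "smooth f \<Longrightarrow> smooth (\<lambda>x. f (c * x + d))"
  by (simp_all add: smooth_def times_differentiable_const times_differentiable_mult
      times_differentiable_add times_differentiable_affine)

lemma smooth_iff: "smooth f \<longleftrightarrow> (\<exists>f'. (\<forall>x. (f has_real_derivative f' x) (at x)) \<and> smooth f')"
proof
  assume f: "smooth f"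
  have "(\<forall>x. (f has_real_derivative deriv f x) (at x)) \<and> times_differentiable n (deriv f)" for n
  proof -
    have "times_differentiable (Suc n) f" using f by (simp only: smooth_def)
    then obtain f' where f': "\<And>x. (f has_real_derivative f' x) (at x)" "times_differentiable n f'" by auto
    moreover have "f' = deriv f" by (rule ext) (metis f'(1) DERIV_imp_deriv)
    ultimately show ?thesis by simp
  qed
  then show "\<exists>f'. (\<forall>x. (f has_real_derivative f' x) (at x)) \<and> smooth f'"
    unfolding smooth_def by blast
next
  assume "\<exists>f'. (\<forall>x. (f has_real_derivative f' x) (at x)) \<and> smooth f'"
  then obtain f' where f': "\<And>x. (f has_real_derivative f' x) (at x)" "smooth f'" by blast
  have "times_differentiable n f" for n
    using f' by (cases n) (auto simp: smooth_def)
  then show "smooth f" by (simp add: smooth_def)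
qed

lemma smooth_id: "smooth (\<lambda>x. x)"
  by (subst smooth_iff) (auto intro!: exI [of _ "\<lambda>x. 1"] smooth_const)

lemma smooth_deriv:
  assumes "smooth f"
  shows "(f has_real_derivative deriv f x) (at x)" "smooth (deriv f)"
proof -
  obtain f' where f': "\<And>x. (f has_real_derivative f' x) (at x)" "smooth f'"
    using assms smooth_iff by metis
  moreover have "f' = deriv f" by (rule ext) (metis f'(1) DERIV_imp_deriv)
  ultimately show "(f has_real_derivative deriv f x) (at x)" "smooth (deriv f)" by simp_all
qed

lemma smooth_higher_deriv:
  "smooth f \<Longrightarrow> ((deriv ^^ n) f has_real_derivative (deriv ^^ Suc n) f x) (at x)"
proof (induction n arbitrary: f)
  case 0
  then show ?case by (simp add: smooth_deriv)
next
  case (Suc n)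
  from Suc.IH [OF smooth_deriv(2) [OF Suc.prems]] show ?case by (simp add: funpow_swap1)
qed

lemma continuous_on_higher_deriv: "smooth f \<Longrightarrow> continuous_on A ((deriv ^^ n) f)"
  using smooth_higher_deriv by (blast intro: DERIV_atLeastAtMost_imp_continuous_on DERIV_isCont continuous_at_imp_continuous_on)

text \<open>The mixed derivatives of a product of functions of one variable factor, and such products are
sufficient to probe a shadow wave.\<close>

lemma test_function_product:
  assumes h: "smooth h" and k: "smooth k" and "\<delta> > 0"
    and supp: "\<And>x. h x \<noteq> 0 \<Longrightarrow> \<bar>x\<bar> \<le> R" "\<And>t. k t \<noteq> 0 \<Longrightarrow> \<delta> \<le> t \<and> t \<le> R"
  shows "test_function (\<lambda>i j x t. (deriv ^^ i) h x * (deriv ^^ j) k t)"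
  unfolding test_function_def
proof (intro conjI allI)
  fix i j x t
  show "((\<lambda>y. (deriv ^^ i) h y * (deriv ^^ j) k t) has_real_derivative (deriv ^^ Suc i) h x * (deriv ^^ j) k t) (at x)"
    by (rule DERIV_cmult_right [OF smooth_higher_deriv [OF h]])
  show "((\<lambda>s. (deriv ^^ i) h x * (deriv ^^ j) k s) has_real_derivative (deriv ^^ i) h x * (deriv ^^ Suc j) k t) (at t)"
    by (rule DERIV_cmult [OF smooth_higher_deriv [OF k]])
next
  fix i j
  have "continuous_on UNIV (\<lambda>z. (deriv ^^ i) h (fst z) * (deriv ^^ j) k (snd z))"
    by (intro continuous_intros continuous_on_compose2 [OF continuous_on_higher_deriv [OF h, of UNIV]]
      continuous_on_compose2 [OF continuous_on_higher_deriv [OF k, of UNIV]]) auto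
  then show "continuous_on UNIV (\<lambda>(x, t). (deriv ^^ i) h x * (deriv ^^ j) k t)"
    by (simp add: case_prod_unfold)
next
  show "\<exists>\<delta>>0. \<exists>R. \<forall>x t. (deriv ^^ 0) h x * (deriv ^^ 0) k t \<noteq> 0 \<longrightarrow> \<bar>x\<bar> \<le> R \<and> \<delta> \<le> t \<and> t \<le> R"
    using supp \<open>\<delta> > 0\<close> by (intro exI [of _ \<delta>] exI [of _ R]) auto
qed

text \<open>The derivatives of \<open>exp (- 1 / x)\<close>, extended by \<open>0\<close>, are all of this form, which makes
smoothness an induction over the order with an arbitrary polynomial.\<close>

definition flat_at_zero :: "real poly \<Rightarrow> real \<Rightarrow> real" where
  "flat_at_zero p x = (if x > 0 then poly p (1 / x) * exp (- (1 / x)) else 0)"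

lemma poly_times_exp_neg_tendsto_0: "((\<lambda>y. poly p y * exp (- y)) \<longlongrightarrow> (0::real)) at_top"
proof -
  have "((\<lambda>y. \<Sum>i\<le>degree p. coeff p i * (y ^ i / exp y)) \<longlongrightarrow> (\<Sum>i\<le>degree p. coeff p i * 0)) at_top"
    by (intro tendsto_sum tendsto_mult tendsto_const tendsto_power_div_exp_0)
  moreover have "(\<Sum>i\<le>degree p. coeff p i * (y ^ i / exp y)) = poly p y * exp (- y)" for y
    by (simp add: poly_altdef sum_distrib_right exp_minus divide_inverse mult.assoc)
  ultimately show ?thesis by simp
qed

lemma flat_at_zero_derivative:
  "(flat_at_zero p has_real_derivative flat_at_zero ([:0, 0, 1:] * (p - pderiv p)) x) (at x)"
proof -
  consider "x < 0" | "x = 0" | "x > 0" by linarith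
  then show ?thesis
  proof cases
    case 1
    have "((\<lambda>x. 0) has_real_derivative 0) (at x)" by simp
    then have "(flat_at_zero p has_real_derivative 0) (at x)"
      by (rule has_field_derivative_transform_within_open [of _ _ _ "{..<0}"]) (use 1 in \<open>auto simp: flat_at_zero_def\<close>)
    then show ?thesis using 1 by (simp add: flat_at_zero_def)
  next
    case 2
    have "((\<lambda>y. (flat_at_zero p y - flat_at_zero p 0) / (y - 0)) \<longlongrightarrow> 0) (at_left 0)"
      by (rule tendsto_eventually) (auto simp: eventually_at_filter flat_at_zero_def)
    moreover have "((\<lambda>y. (flat_at_zero p y - flat_at_zero p 0) / (y - 0)) \<longlongrightarrow> 0) (at_right 0)"
      unfolding filterlim_at_right_to_top
    proof (rule Lim_transform_eventually [OF poly_times_exp_neg_tendsto_0 [of "[:0, 1:] * p"]])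
      show "\<forall>\<^sub>F y in at_top. poly ([:0, 1:] * p) y * exp (- y) =
          (flat_at_zero p (inverse y) - flat_at_zero p 0) / (inverse y - 0)"
        using eventually_gt_at_top [of 0] by eventually_elim (simp add: flat_at_zero_def field_simps)
    qed
    ultimately have "(flat_at_zero p has_real_derivative 0) (at 0)"
      unfolding has_field_derivative_iff by (rule filterlim_split_at)
    then show ?thesis using 2 by (simp add: flat_at_zero_def)
  next
    case 3
    have "((\<lambda>x. poly p (1 / x) * exp (- (1 / x))) has_real_derivative
        flat_at_zero ([:0, 0, 1:] * (p - pderiv p)) x) (at x)"
      by (rule derivative_eq_intros refl | use 3 in \<open>simp add: flat_at_zero_def field_simps power2_eq_square\<close>)+
    then show ?thesis
      by (rule has_field_derivative_transform_within_open [of _ _ _ "{0<..}"]) (use 3 in \<open>auto simp: flat_at_zero_def\<close>)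
  qed
qed

lemma smooth_flat_at_zero: "smooth (flat_at_zero p)"
proof -
  have "times_differentiable n (flat_at_zero p)" for n
    by (induction n arbitrary: p) (auto intro: flat_at_zero_derivative)
  then show ?thesis by (simp add: smooth_def)
qed

lemma ex_smooth_bump:
  fixes a b :: real
  obtains k where "smooth k" "\<And>t. k t \<ge> 0" "\<And>t. k t > 0 \<longleftrightarrow> a < t \<and> t < b"
proof
  \<comment> \<open>the factors live on \<open>t > a\<close> and on \<open>t < b\<close>\<close>
  define k where "k t = flat_at_zero 1 (1 * t + (- a)) * flat_at_zero 1 ((-1) * t + b)" for t
  show "smooth k" unfolding k_def by (intro smooth_mult smooth_affine smooth_flat_at_zero)
  show "k t \<ge> 0" "k t > 0 \<longleftrightarrow> a < t \<and> t < b" for t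
    by (auto simp: k_def flat_at_zero_def)
qed

lemma ex_antiderivative:
  fixes f :: "real \<Rightarrow> real"
  assumes "continuous_on UNIV f"
  obtains F where "\<And>x. (F has_real_derivative f x) (at x)"
proof -
  have "isCont f x" for x using assms by (simp add: continuous_on_eq_continuous_at [OF open_UNIV])
  then show thesis
    using einterval_antiderivative [of "-\<infinity>" "\<infinity>" f] that
    by (auto simp: has_real_derivative_iff_has_vector_derivative)
qed

text \<open>The normalised antiderivative of a bump is a smooth step; the plateau is the product of an
ascending and a descending step.\<close>

lemma ex_smooth_plateau:
  fixes M :: real
  obtains h where "smooth h" "\<And>x. \<bar>x\<bar> \<le> M \<Longrightarrow> h x = 1" "\<And>x. h x \<noteq> 0 \<Longrightarrow> \<bar>x\<bar> \<le> M + 1"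
proof -
  obtain b :: "real \<Rightarrow> real" where b: "smooth b" "\<And>t. b t \<ge> 0" "\<And>t. b t > 0 \<longleftrightarrow> 0 < t \<and> t < 1"
    using ex_smooth_bump [of 0 1] by metis
  obtain B where B: "\<And>x. (B has_real_derivative b x) (at x)"
    using ex_antiderivative continuous_on_higher_deriv [OF b(1), of UNIV 0] by auto
  have b0: "b x = 0" if "x \<le> 0 \<or> 1 \<le> x" for x
    using b(2,3) [of x] that by linarith
  have low: "B x = B 0" if "x \<le> 0" for x
  proof (cases "x < 0")
    case True
    obtain z where "z < 0" "B 0 - B x = (0 - x) * b z"
      using MVT2 [OF True, of B b] B by blast
    then show ?thesis using b0 [of z] by simp
  qed (use that in auto)
  have high: "B x = B 1" if "1 \<le> x" for x
  proof (cases "1 < x")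
    case True
    obtain z where "1 < z" "B x - B 1 = (x - 1) * b z"
      using MVT2 [OF True, of B b] B by blast
    then show ?thesis using b0 [of z] by simp
  qed (use that in auto)
  have "B 0 < B 1"
    using DERIV_pos_imp_increasing_open [of 0 1 B] B b(3) DERIV_isCont by (metis zero_less_one continuous_at_imp_continuous_on)
  define S where "S x = (B x + (- B 0)) * (1 / (B 1 - B 0))" for x
  have "smooth B" using smooth_iff B b(1) by blast
  then have S: "smooth S"
    unfolding S_def by (intro smooth_mult smooth_add smooth_const)
  have S01: "S x = 0" if "x \<le> 0" for x using low [OF that] by (simp add: S_def)
  have S1: "S x = 1" if "1 \<le> x" for x using high [OF that] \<open>B 0 < B 1\<close> by (simp add: S_def)
  define h where "h x = S (1 * x + (M + 1)) * S ((-1) * x + (M + 1))" for x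
  show thesis
  proof
    show "smooth h" unfolding h_def by (intro smooth_mult smooth_affine S)
    show "h x = 1" if "\<bar>x\<bar> \<le> M" for x using that by (simp add: h_def S1)
    show "\<bar>x\<bar> \<le> M + 1" if "h x \<noteq> 0" for x
      using that S01 [of "1 * x + (M + 1)"] S01 [of "(-1) * x + (M + 1)"] by (force simp: h_def)
  qed
qed


section \<open>Nets tested on smooth functions\<close>

text \<open>The fundamental theorem of calculus on the half-lines and on the line.\<close>

lemma compact_support_derivative_integral:
  fixes f :: "real \<Rightarrow> real"
  assumes f: "\<And>x. (f has_real_derivative f' x) (at x)" and cont: "continuous_on UNIV f'"
    and supp: "\<And>x. f x \<noteq> 0 \<Longrightarrow> \<bar>x\<bar> \<le> R" "\<And>x. f' x \<noteq> 0 \<Longrightarrow> \<bar>x\<bar> \<le> R"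
  shows "(LINT x|lborel. (if x < b then f' x else 0)) = f b"
    and "(LINT x|lborel. (if b < x then f' x else 0)) = - f b"
    and "(LINT x|lborel. f' x) = 0"
proof -
  have cont': "isCont f' x" for x using cont by (simp add: continuous_on_eq_continuous_at [OF open_UNIV])
  define K where "K = \<bar>R\<bar> + \<bar>b\<bar> + 1"
  have K: "f K = 0" "f (- K) = 0" "- K \<le> b" "b \<le> K"
  proof -
    have "\<not> \<bar>K\<bar> \<le> R" "\<not> \<bar>- K\<bar> \<le> R" by (auto simp: K_def)
    then show "f K = 0" "f (- K) = 0" using supp(1) by blast+
  qed (auto simp: K_def)
  have out: "f' x = 0" if "x < - K \<or> K < x" for x
  proof -
    have "\<not> \<bar>x\<bar> \<le> R" using that by (auto simp: K_def)
    then show ?thesis using supp(2) by blast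
  qed
  have [measurable]: "f' \<in> borel_measurable borel" using cont by (rule borel_measurable_continuous_onI)
  have ne: "AE x in lborel. x \<noteq> b" by (rule AE_lborel_singleton)
  have "(LINT x|lborel. (if x < b then f' x else 0)) = (LINT x|lborel. f' x * indicator {- K..b} x)"
    using ne by (intro integral_cong_AE) (auto simp: indicator_def out not_le elim!: eventually_mono)
  also have "\<dots> = f b - f (- K)" by (rule integral_FTC_Icc_real) (use K f cont' in auto)
  finally show "(LINT x|lborel. (if x < b then f' x else 0)) = f b" using K by simp
  have "(LINT x|lborel. (if b < x then f' x else 0)) = (LINT x|lborel. f' x * indicator {b..K} x)"
    using ne by (intro integral_cong_AE) (auto simp: indicator_def out not_le elim!: eventually_mono)
  also have "\<dots> = f K - f b" by (rule integral_FTC_Icc_real) (use K f cont' in auto)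
  finally show "(LINT x|lborel. (if b < x then f' x else 0)) = - f b" using K by simp
  have "(LINT x|lborel. f' x) = (LINT x|lborel. f' x * indicator {- K..K} x)"
  proof (intro Bochner_Integration.integral_cong refl)
    show "f' x = f' x * indicator {- K..K} x" for x
      by (cases "x < - K \<or> K < x") (use out [of x] in \<open>auto simp: indicator_def not_less\<close>)
  qed
  also have "\<dots> = f K - f (- K)" by (rule integral_FTC_Icc_real) (use K f cont' in auto)
  finally show "(LINT x|lborel. f' x) = 0" using K by simp
qed

lemma test_function_support:
  assumes "test_function D"
  obtains \<delta> R where "0 < \<delta>" "0 < R"
    and "\<And>x t. D 0 0 x t \<noteq> 0 \<or> D (Suc 0) 0 x t \<noteq> 0 \<or> D 0 (Suc 0) x t \<noteq> 0 \<Longrightarrow> \<bar>x\<bar> \<le> R \<and> \<delta> \<le> t \<and> t \<le> R"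
proof -
  obtain \<delta> R where \<delta>: "0 < \<delta>" and supp: "\<And>x t. D 0 0 x t \<noteq> 0 \<Longrightarrow> \<bar>x\<bar> \<le> R \<and> \<delta> \<le> t \<and> t \<le> R"
    using assms unfolding test_function_def by metis
  have d: "((\<lambda>y. D 0 0 y t) has_real_derivative D (Suc 0) 0 x t) (at x)"
      "((\<lambda>s. D 0 0 x s) has_real_derivative D 0 (Suc 0) x t) (at t)" for x t
    using assms unfolding test_function_def by blast+
  have z: "((\<lambda>y. 0) has_real_derivative 0) (at (x::real))" for x by simp
  have x0: "D (Suc 0) 0 x t = 0 \<and> D 0 (Suc 0) x t = 0" if out: "\<not> (\<bar>x\<bar> \<le> R \<and> \<delta> \<le> t \<and> t \<le> R)" for x t
  proof
    have "open {y. \<not> (\<bar>y\<bar> \<le> R \<and> \<delta> \<le> t \<and> t \<le> R)}"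
      unfolding not_le de_Morgan_conj
      by (intro open_Collect_disj open_Collect_less continuous_intros)
    from has_field_derivative_transform_within_open [OF z this, of x "\<lambda>y. D 0 0 y t"]
    have "((\<lambda>y. D 0 0 y t) has_real_derivative 0) (at x)" using out supp by fastforce
    with d(1) show "D (Suc 0) 0 x t = 0" using DERIV_unique by blast
    have "open {s. \<not> (\<bar>x\<bar> \<le> R \<and> \<delta> \<le> s \<and> s \<le> R)}"
      unfolding not_le de_Morgan_conj
      by (intro open_Collect_disj open_Collect_less continuous_intros)
    from has_field_derivative_transform_within_open [OF z this, of t "\<lambda>s. D 0 0 x s"]
    have "((\<lambda>s. D 0 0 x s) has_real_derivative 0) (at t)" using out supp by fastforce
    with d(2) show "D 0 (Suc 0) x t = 0" using DERIV_unique by blast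
  qed
  have "D 0 0 x t \<noteq> 0 \<or> D (Suc 0) 0 x t \<noteq> 0 \<or> D 0 (Suc 0) x t \<noteq> 0 \<Longrightarrow> \<bar>x\<bar> \<le> \<bar>R\<bar> + 1 \<and> \<delta> \<le> t \<and> t \<le> \<bar>R\<bar> + 1" for x t
    using supp [of x t] x0 [of x t] by linarith
  with \<delta> show thesis by (intro that [of \<delta> "\<bar>R\<bar> + 1"]) auto
qed

lemma integrable_half_plane:
  fixes \<psi> :: "real \<Rightarrow> real \<Rightarrow> real"
  assumes cont: "continuous_on UNIV (\<lambda>(x, t). \<psi> x t)"
    and supp: "\<And>x t. \<psi> x t \<noteq> 0 \<Longrightarrow> \<bar>x\<bar> \<le> R \<and> \<bar>t\<bar> \<le> R"
  shows "integrable (lborel \<Otimes>\<^sub>M lborel) (\<lambda>(t, x). if x < s * t then \<psi> x t else 0)"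
    and "integrable lborel (\<lambda>x. if x < s * t then \<psi> x t else 0)"
proof -
  have c2: "continuous_on UNIV (\<lambda>z. \<psi> (snd z) (fst z))"
    using continuous_on_compose2 [OF cont, of UNIV "\<lambda>z. (snd z, fst z)"] by (simp add: continuous_intros)
  have c1: "continuous_on UNIV (\<lambda>x. \<psi> x t)"
    using continuous_on_compose2 [OF cont, of UNIV "\<lambda>x. (x, t)"] by (simp add: continuous_intros)
  have "compact ({-R..R} \<times> {-R..R})" by (intro compact_Times) auto
  from borel_integrable_compact [OF this continuous_on_subset [OF c2]]
  have "integrable lborel (\<lambda>z. indicator ({-R..R} \<times> {-R..R}) z *\<^sub>R \<psi> (snd z) (fst z))" by simp
  moreover have "open {z :: real \<times> real. snd z < s * fst z}"
    by (intro open_Collect_less continuous_intros)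
  then have "{z. snd z < s * fst z} \<in> sets (lborel :: (real \<times> real) measure)" by simp
  ultimately have "integrable lborel (\<lambda>z. indicator {z. snd z < s * fst z} z *\<^sub>R
      (indicator ({-R..R} \<times> {-R..R}) z *\<^sub>R \<psi> (snd z) (fst z)))"
    by (rule integrable_mult_indicator [rotated])
  also have "(\<lambda>z. indicator {z. snd z < s * fst z} z *\<^sub>R (indicator ({-R..R} \<times> {-R..R}) z *\<^sub>R \<psi> (snd z) (fst z)))
      = (\<lambda>(t, x). if x < s * t then \<psi> x t else 0)"
    using supp by (auto simp: fun_eq_iff indicator_def abs_le_iff) (meson neg_le_iff_le minus_le_iff)+
  finally show "integrable (lborel \<Otimes>\<^sub>M lborel) (\<lambda>(t, x). if x < s * t then \<psi> x t else 0)"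
    by (simp add: lborel_prod)
  from borel_integrable_compact [OF compact_Icc continuous_on_subset [OF c1]]
  have "integrable lborel (\<lambda>x. indicator {-R..R} x *\<^sub>R \<psi> x t)" by simp
  moreover have "{..<s * t} \<in> sets lborel" by simp
  ultimately have "integrable lborel (\<lambda>x. indicator {..<s * t} x *\<^sub>R (indicator {-R..R} x *\<^sub>R \<psi> x t))"
    by (rule integrable_mult_indicator [rotated])
  also have "(\<lambda>x. indicator {..<s * t} x *\<^sub>R (indicator {-R..R} x *\<^sub>R \<psi> x t)) = (\<lambda>x. if x < s * t then \<psi> x t else 0)"
    using supp by (auto simp: fun_eq_iff indicator_def abs_le_iff) (meson neg_le_iff_le minus_le_iff)+
  finally show "integrable lborel (\<lambda>x. if x < s * t then \<psi> x t else 0)" .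
qed

text \<open>A net that is constant in sectors sees a test function only through these integrals along the
rays between the sectors.\<close>

definition ray_integral :: "(nat \<Rightarrow> nat \<Rightarrow> real \<Rightarrow> real \<Rightarrow> real) \<Rightarrow> real \<Rightarrow> real" where
  "ray_integral D s = (LINT t|lborel. D 0 0 (s * t) t)"

text \<open>For the \<open>x\<close>-derivative integrate over \<open>x\<close> first.  For the \<open>t\<close>-derivative exchange the integrals:
the inner one is a boundary value of \<open>D 0 0\<close> at \<open>t = x / s\<close>, and the substitution \<open>x = s * t\<close> gives the
factor \<open>s\<close>.  The sign of \<open>s\<close> decides which side of the boundary is met.\<close>

lemma half_plane_integrals:
  assumes D: "test_function D"
  shows "(LINT t|lborel. LINT x|lborel. (if x < s * t then D (Suc 0) 0 x t else 0)) = ray_integral D s"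
    and "(LINT t|lborel. LINT x|lborel. (if x < s * t then D 0 (Suc 0) x t else 0)) = - s * ray_integral D s"
proof -
  obtain \<delta> R where \<delta>: "0 < \<delta>" and R: "0 < R" and supp:
    "\<And>x t. D 0 0 x t \<noteq> 0 \<or> D (Suc 0) 0 x t \<noteq> 0 \<or> D 0 (Suc 0) x t \<noteq> 0 \<Longrightarrow> \<bar>x\<bar> \<le> R \<and> \<delta> \<le> t \<and> t \<le> R"
    using test_function_support [OF D] by metis
  then have supp': "\<And>x t. D 0 0 x t \<noteq> 0 \<or> D (Suc 0) 0 x t \<noteq> 0 \<or> D 0 (Suc 0) x t \<noteq> 0 \<Longrightarrow> \<bar>x\<bar> \<le> R \<and> \<bar>t\<bar> \<le> R"
    by fastforce
  have d: "((\<lambda>y. D 0 0 y t) has_real_derivative D (Suc 0) 0 x t) (at x)"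
      "((\<lambda>s. D 0 0 x s) has_real_derivative D 0 (Suc 0) x t) (at t)" for x t
    using D unfolding test_function_def by blast+
  have c: "continuous_on UNIV (\<lambda>(x, t). D i j x t)" for i j
    using D unfolding test_function_def by blast
  have c1: "continuous_on UNIV (\<lambda>x. D i j x t)" for i j t
    using continuous_on_compose2 [OF c, of UNIV "\<lambda>x. (x, t)" i j] by (simp add: continuous_intros)
  have c2: "continuous_on UNIV (\<lambda>t. D i j x t)" for i j x
    using continuous_on_compose2 [OF c, of UNIV "\<lambda>t. (x, t)" i j] by (simp add: continuous_intros)
  have "(LINT x|lborel. (if x < s * t then D (Suc 0) 0 x t else 0)) = D 0 0 (s * t) t" for t
    by (rule compact_support_derivative_integral(1) [where f = "\<lambda>x. D 0 0 x t" and R = R, OF d(1) c1])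
      (use supp' in blast)+
  then show "(LINT t|lborel. LINT x|lborel. (if x < s * t then D (Suc 0) 0 x t else 0)) = ray_integral D s"
    by (simp add: ray_integral_def)
  have "(LINT t|lborel. LINT x|lborel. (if x < s * t then D 0 (Suc 0) x t else 0))
      = (LINT x|lborel. LINT t|lborel. (if x < s * t then D 0 (Suc 0) x t else 0))"
    using supp' by (intro lborel_pair.Fubini_integral [symmetric] integrable_half_plane(1) [OF c]) blast
  also have "\<dots> = - s * ray_integral D s"
  proof -
    consider "s > 0" | "s = 0" | "s < 0" by linarith
    then show ?thesis
    proof cases
      case 1
      have "(LINT t|lborel. (if x < s * t then D 0 (Suc 0) x t else 0)) = - D 0 0 x (x / s)" for x
      proof -
        have "(LINT t|lborel. (if x / s < t then D 0 (Suc 0) x t else 0)) = - D 0 0 x (x / s)"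
          by (rule compact_support_derivative_integral(2) [where f = "\<lambda>t. D 0 0 x t" and R = R, OF d(2) c2])
            (use supp' in blast)+
        then show ?thesis using 1 by (simp add: pos_divide_less_eq mult.commute)
      qed
      then show ?thesis
        using 1 lborel_integral_real_affine [of s "\<lambda>x. D 0 0 x (x / s)" 0] by (simp add: ray_integral_def)
    next
      case 2
      have "(LINT t|lborel. (if x < 0 then D 0 (Suc 0) x t else 0)) = 0" for x
      proof -
        have "(LINT t|lborel. D 0 (Suc 0) x t) = 0"
          by (rule compact_support_derivative_integral(3) [where f = "\<lambda>t. D 0 0 x t" and R = R, OF d(2) c2])
            (use supp' in blast)+
        then show ?thesis by (cases "x < 0") simp_all
      qed
      with 2 show ?thesis by simp
    next
      case 3
      have "(LINT t|lborel. (if x < s * t then D 0 (Suc 0) x t else 0)) = D 0 0 x (x / s)" for x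
      proof -
        have "(LINT t|lborel. (if t < x / s then D 0 (Suc 0) x t else 0)) = D 0 0 x (x / s)"
          by (rule compact_support_derivative_integral(1) [where f = "\<lambda>t. D 0 0 x t" and R = R, OF d(2) c2])
            (use supp' in blast)+
        then show ?thesis using 3 by (simp add: neg_less_divide_eq mult.commute)
      qed
      then show ?thesis
        using 3 lborel_integral_real_affine [of s "\<lambda>x. D 0 0 x (x / s)" 0] by (simp add: ray_integral_def)
    qed
  qed
  finally show "(LINT t|lborel. LINT x|lborel. (if x < s * t then D 0 (Suc 0) x t else 0)) = - s * ray_integral D s" .
qed

text \<open>Each jump of the net contributes its Rankine-Hugoniot defect.  The net is written as a sum of three
indicator functions of half-planes, the last of which contains the whole support of \<open>D\<close>.\<close>

lemma weak_form_shadow_net: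
  fixes c \<epsilon> :: real
  assumes D: "test_function D" and "0 < \<epsilon>"
  defines "s \<equiv> c - \<epsilon> / 2" and "s' \<equiv> c + \<epsilon> / 2"
  shows "(LINT t|lborel. LINT x|lborel.
      D 0 1 x t *\<^sub>R conserved (wave_net \<alpha> Ul [Shadow Ul Ur c V] \<epsilon> x t) +
      D 1 0 x t *\<^sub>R flux \<alpha> (wave_net \<alpha> Ul [Shadow Ul Ur c V] \<epsilon> x t)) =
    ray_integral D s *\<^sub>R (flux \<alpha> Ul - flux \<alpha> (V \<epsilon>) - s *\<^sub>R (conserved Ul - conserved (V \<epsilon>))) +
    ray_integral D s' *\<^sub>R (flux \<alpha> (V \<epsilon>) - flux \<alpha> Ur - s' *\<^sub>R (conserved (V \<epsilon>) - conserved Ur))"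
proof -
  obtain \<delta> R where \<delta>: "0 < \<delta>" and R: "0 < R" and supp:
    "\<And>x t. D 0 0 x t \<noteq> 0 \<or> D (Suc 0) 0 x t \<noteq> 0 \<or> D 0 (Suc 0) x t \<noteq> 0 \<Longrightarrow> \<bar>x\<bar> \<le> R \<and> \<delta> \<le> t \<and> t \<le> R"
    using test_function_support [OF D] by metis
  then have supp': "\<And>x t. D 0 0 x t \<noteq> 0 \<or> D (Suc 0) 0 x t \<noteq> 0 \<or> D 0 (Suc 0) x t \<noteq> 0 \<Longrightarrow> \<bar>x\<bar> \<le> R \<and> \<bar>t\<bar> \<le> R"
    by fastforce
  have c: "continuous_on UNIV (\<lambda>(x, t). D i j x t)" for i j
    using D unfolding test_function_def by blast
  \<comment> \<open>the support lies to the left of the ray \<open>x = \<sigma> t\<close>\<close>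
  define \<sigma> where "\<sigma> = (R + 1) / \<delta>"
  have far: "x < \<sigma> * t" if "\<bar>x\<bar> \<le> R" "\<delta> \<le> t" for x t
  proof -
    have "\<sigma> * \<delta> \<le> \<sigma> * t" using that R \<delta> by (intro mult_left_mono) (auto simp: \<sigma>_def)
    then show ?thesis using that \<delta> by (simp add: \<sigma>_def)
  qed
  have "D 0 0 (\<sigma> * t) t = 0" for t
    using supp [of "\<sigma> * t" t] far [of "\<sigma> * t" t] by auto
  then have far0: "ray_integral D \<sigma> = 0" by (simp add: ray_integral_def)
  define p where "p r t x = (if x < r * t then D 0 (Suc 0) x t else 0)" for r t x
  define q where "q r t x = (if x < r * t then D (Suc 0) 0 x t else 0)" for r t x
  have int1: "integrable lborel (p r t)" "integrable lborel (q r t)" for r t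
    unfolding p_def q_def using supp' by (intro integrable_half_plane(2) [OF c, of _ _ R]; blast)+
  have "integrable (lborel \<Otimes>\<^sub>M lborel) (\<lambda>(t, x). p r t x)" "integrable (lborel \<Otimes>\<^sub>M lborel) (\<lambda>(t, x). q r t x)" for r
    unfolding p_def q_def using supp' by (intro integrable_half_plane(1) [OF c, of _ _ R]; blast)+
  from lborel_pair.integrable_fst' [OF this(1)] lborel_pair.integrable_fst' [OF this(2)]
  have int2: "integrable lborel (\<lambda>t. LINT x|lborel. p r t x)" "integrable lborel (\<lambda>t. LINT x|lborel. q r t x)" for r
    by simp_all
  have val: "(LINT t|lborel. LINT x|lborel. p r t x) = - r * ray_integral D r"
      "(LINT t|lborel. LINT x|lborel. q r t x) = ray_integral D r" for r
    unfolding p_def q_def by (rule half_plane_integrals [OF D])+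
  let ?N = "wave_net \<alpha> Ul [Shadow Ul Ur c V] \<epsilon>"
  define A B C where "A = conserved Ul - conserved (V \<epsilon>)" and "B = conserved (V \<epsilon>) - conserved Ur" and "C = conserved Ur"
  define A' B' C' where "A' = flux \<alpha> Ul - flux \<alpha> (V \<epsilon>)" and "B' = flux \<alpha> (V \<epsilon>) - flux \<alpha> Ur" and "C' = flux \<alpha> Ur"
  have split: "D 0 1 x t *\<^sub>R conserved (?N x t) + D 1 0 x t *\<^sub>R flux \<alpha> (?N x t) =
      p s t x *\<^sub>R A + p s' t x *\<^sub>R B + p \<sigma> t x *\<^sub>R C + (q s t x *\<^sub>R A' + q s' t x *\<^sub>R B' + q \<sigma> t x *\<^sub>R C')" for x t
  proof (cases "\<bar>x\<bar> \<le> R \<and> \<delta> \<le> t \<and> t \<le> R")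
    case False
    with supp [of x t] have "D 0 (Suc 0) x t = 0" "D (Suc 0) 0 x t = 0" by blast+
    then show ?thesis by (simp add: p_def q_def)
  next
    case True
    then have "s * t < s' * t" "x < \<sigma> * t"
      using \<delta> \<open>0 < \<epsilon>\<close> far by (auto simp: s_def s'_def)
    then show ?thesis
      by (auto simp: p_def q_def A_def B_def C_def A'_def B'_def C'_def s_def [symmetric] s'_def [symmetric] scaleR_diff_right)
  qed
  have inner: "(LINT x|lborel. D 0 1 x t *\<^sub>R conserved (?N x t) + D 1 0 x t *\<^sub>R flux \<alpha> (?N x t)) =
      (LINT x|lborel. p s t x) *\<^sub>R A + (LINT x|lborel. p s' t x) *\<^sub>R B + (LINT x|lborel. p \<sigma> t x) *\<^sub>R C +
      ((LINT x|lborel. q s t x) *\<^sub>R A' + (LINT x|lborel. q s' t x) *\<^sub>R B' + (LINT x|lborel. q \<sigma> t x) *\<^sub>R C')" for t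
    unfolding split using int1 by simp
  show ?thesis
    unfolding inner using int2 by (simp add: val far0 A_def [symmetric] B_def [symmetric] A'_def [symmetric] B'_def [symmetric]
      scaleR_diff_right mult.commute)
qed

text \<open>The two rays of the net differ by \<open>\<epsilon>\<close>, so continuity of this function at \<open>c\<close> is what the limit
\<open>\<epsilon> \<rightarrow> 0\<close> needs.\<close>

lemma ray_integral_Lipschitz:
  assumes D: "test_function D"
  obtains K where "\<And>s s'. \<bar>ray_integral D s - ray_integral D s'\<bar> \<le> K * \<bar>s - s'\<bar>"
proof -
  obtain \<delta> R where \<delta>: "0 < \<delta>" and R: "0 < R" and supp:
    "\<And>x t. D 0 0 x t \<noteq> 0 \<or> D (Suc 0) 0 x t \<noteq> 0 \<or> D 0 (Suc 0) x t \<noteq> 0 \<Longrightarrow> \<bar>x\<bar> \<le> R \<and> \<delta> \<le> t \<and> t \<le> R"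
    using test_function_support [OF D] by metis
  have d: "((\<lambda>y. D 0 0 y t) has_real_derivative D (Suc 0) 0 x t) (at x)" for x t
    using D unfolding test_function_def by blast
  have c: "continuous_on UNIV (\<lambda>(x, t). D i j x t)" for i j
    using D unfolding test_function_def by blast
  have "compact ({-R..R} \<times> {0..R})" by (intro compact_Times) auto
  then have "bounded ((\<lambda>(x, t). D (Suc 0) 0 x t) ` ({-R..R} \<times> {0..R}))"
    by (intro compact_imp_bounded compact_continuous_image continuous_on_subset [OF c]) auto
  then obtain M where M: "M > 0" "\<And>x t. x \<in> {-R..R} \<Longrightarrow> t \<in> {0..R} \<Longrightarrow> \<bar>D (Suc 0) 0 x t\<bar> \<le> M"
    unfolding bounded_pos by fastforce
  have bound: "\<bar>D (Suc 0) 0 x t\<bar> \<le> M" for x t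
  proof (cases "D (Suc 0) 0 x t = 0")
    case False
    with supp [of x t] \<delta> show ?thesis by (intro M) (auto simp: abs_le_iff)
  qed (use M in simp)
  have ctr: "continuous_on UNIV (\<lambda>t. D 0 0 (s * t) t)" for s
    using continuous_on_compose2 [OF c, of UNIV "\<lambda>t. (s * t, t)" 0 0] by (simp add: continuous_intros)
  have int: "integrable lborel (\<lambda>t. D 0 0 (s * t) t)" for s
  proof -
    have "integrable lborel (\<lambda>t. indicator {0..R} t *\<^sub>R D 0 0 (s * t) t)"
      by (intro borel_integrable_compact compact_Icc continuous_on_subset [OF ctr]) auto
    also have "(\<lambda>t. indicator {0..R} t *\<^sub>R D 0 0 (s * t) t) = (\<lambda>t. D 0 0 (s * t) t)"
    proof
      show "indicator {0..R} t *\<^sub>R D 0 0 (s * t) t = D 0 0 (s * t) t" for t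
        using supp [of "s * t" t] \<delta> by (auto simp: indicator_def)
    qed
    finally show ?thesis .
  qed
  have "\<bar>ray_integral D s - ray_integral D s'\<bar> \<le> (M * R * R) * \<bar>s - s'\<bar>" for s s'
  proof -
    have pt: "\<bar>D 0 0 (s * t) t - D 0 0 (s' * t) t\<bar> \<le> M * R * \<bar>s - s'\<bar> * indicator {0..R} t" for t
    proof (cases "t \<in> {0..R}")
      case True
      have "\<bar>D 0 0 (s * t) t - D 0 0 (s' * t) t\<bar> \<le> M * \<bar>s * t - s' * t\<bar>"
        using field_differentiable_bound [of UNIV "\<lambda>y. D 0 0 y t" "\<lambda>y. D (Suc 0) 0 y t" M "s * t" "s' * t"]
          d bound by (simp add: has_field_derivative_at_within)
      also have "\<bar>s * t - s' * t\<bar> = \<bar>s - s'\<bar> * t"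
        using True by (simp add: left_diff_distrib [symmetric] abs_mult)
      also have "\<dots> \<le> \<bar>s - s'\<bar> * R" using True by (intro mult_left_mono) auto
      finally show ?thesis using True M by (simp add: mult.commute mult.left_commute)
    next
      case False
      have "D 0 0 x t = 0" for x
      proof (rule ccontr)
        assume "D 0 0 x t \<noteq> 0"
        with supp have "\<delta> \<le> t \<and> t \<le> R" by blast
        with False \<delta> show False by simp
      qed
      then show ?thesis using M R by simp
    qed
    have "\<bar>ray_integral D s - ray_integral D s'\<bar> = \<bar>LINT t|lborel. D 0 0 (s * t) t - D 0 0 (s' * t) t\<bar>"
      unfolding ray_integral_def using int by simp
    also have "\<dots> \<le> (LINT t|lborel. M * R * \<bar>s - s'\<bar> * indicator {0..R} t)"
    proof (rule integral_abs_bound_integral)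
      have "integrable lborel (indicator {0..R} :: real \<Rightarrow> real)"
        using borel_integrable_compact [OF compact_Icc continuous_on_const, of 0 R "1 :: real"] by simp
      then show "integrable lborel (\<lambda>t. M * R * \<bar>s - s'\<bar> * indicator {0..R} t)" by simp
    qed (use int pt in auto)
    also have "\<dots> = (M * R * R) * \<bar>s - s'\<bar>" using R by simp
    finally show ?thesis .
  qed
  then show thesis by (rule that)
qed

lemma ray_integral_tendsto:
  assumes D: "test_function D" and s: "(s \<longlongrightarrow> c) F"
  shows "((\<lambda>\<epsilon>. ray_integral D (s \<epsilon>)) \<longlongrightarrow> ray_integral D c) F"
proof -
  obtain K where K: "\<And>s s'. \<bar>ray_integral D s - ray_integral D s'\<bar> \<le> K * \<bar>s - s'\<bar>"
    using ray_integral_Lipschitz [OF D] by metis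
  have "((\<lambda>\<epsilon>. K * \<bar>s \<epsilon> - c\<bar>) \<longlongrightarrow> K * \<bar>c - c\<bar>) F" by (intro tendsto_intros s)
  then have "((\<lambda>\<epsilon>. K * \<bar>s \<epsilon> - c\<bar>) \<longlongrightarrow> 0) F" by simp
  then have "((\<lambda>\<epsilon>. ray_integral D (s \<epsilon>) - ray_integral D c) \<longlongrightarrow> 0) F"
    by (rule Lim_null_comparison [rotated]) (use K in \<open>simp add: eventually_mono\<close>)
  then show ?thesis by (simp add: Lim_null [symmetric])
qed

lemma tendsto_half_width: "((\<lambda>\<epsilon>. c - \<epsilon> / 2) \<longlongrightarrow> (c :: real)) (at_right 0)"
    "((\<lambda>\<epsilon>. c + \<epsilon> / 2) \<longlongrightarrow> c) (at_right 0)"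
  by (auto intro!: tendsto_eq_intros)

text \<open>With \<open>u\<^sub>\<epsilon> = c\<close> exactly, the defects of the two jumps of the net stay bounded although \<open>\<rho>\<^sub>\<epsilon>\<close> does not;
they converge to opposite values, up to the pressure term \<open>(\<epsilon> / \<kappa>) powr \<alpha>\<close> that tends to \<open>0\<close>.\<close>

lemma shadow_waveI:
  fixes c \<kappa> :: real
  assumes \<alpha>: "0 < \<alpha>" and \<kappa>: "0 < \<kappa>"
    and jump: "(\<kappa>, \<kappa> * c) = c *\<^sub>R (conserved Ur - conserved Ul) - (flux \<alpha> Ur - flux \<alpha> Ul)"
  shows "shadow_wave \<alpha> Ul Ur c (\<lambda>\<epsilon>. (\<kappa> / \<epsilon>, c))"
  unfolding shadow_wave_def
proof (intro conjI)
  let ?V = "\<lambda>\<epsilon>. (\<kappa> / \<epsilon>, c)"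
  show "\<forall>\<epsilon>>0. fst (?V \<epsilon>) > 0" using \<kappa> by simp
  have pos: "\<forall>\<^sub>F \<epsilon> in at_right 0. (0::real) < \<epsilon>" by (simp add: eventually_at_right_less)
  have "((\<lambda>\<epsilon>. \<epsilon> * fst (?V \<epsilon>)) \<longlongrightarrow> \<kappa>) (at_right 0)"
    by (rule tendsto_eventually, use pos in eventually_elim) simp
  with \<kappa> show "\<exists>\<kappa>>0. ((\<lambda>\<epsilon>. \<epsilon> * fst (?V \<epsilon>)) \<longlongrightarrow> \<kappa>) (at_right 0)" by blast
  show "solves_in_limit \<alpha> (wave_net \<alpha> Ul [Shadow Ul Ur c ?V])"
    unfolding solves_in_limit_def
  proof (intro allI impI)
    fix D assume D: "test_function D"
    define A where "A = flux \<alpha> Ul - c *\<^sub>R conserved Ul - (\<kappa> / 2, \<kappa> * c / 2)"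
    define P :: "real \<Rightarrow> real \<times> real" where "P \<epsilon> = (0, (\<epsilon> / \<kappa>) powr \<alpha>)" for \<epsilon>
    have A: "flux \<alpha> Ur - c *\<^sub>R conserved Ur + (\<kappa> / 2, \<kappa> * c / 2) = A"
      using jump by (cases "flux \<alpha> Ur"; cases "flux \<alpha> Ul"; cases "conserved Ur"; cases "conserved Ul") (simp add: A_def algebra_simps)
    have P0: "(P \<longlongrightarrow> (0, 0)) (at_right 0)"
    proof -
      have "((\<lambda>\<epsilon>. (\<epsilon> / \<kappa>) powr \<alpha>) \<longlongrightarrow> (0 / \<kappa>) powr \<alpha>) (at_right 0)"
      proof (rule tendsto_powr')
        show "((\<lambda>\<epsilon>. \<epsilon> / \<kappa>) \<longlongrightarrow> 0 / \<kappa>) (at_right 0)"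
          using \<kappa> by (intro tendsto_intros) auto
        show "0 / \<kappa> \<noteq> 0 \<or> 0 < \<alpha> \<and> (\<forall>\<^sub>F \<epsilon> in at_right 0. 0 \<le> \<epsilon> / \<kappa>)"
          using \<alpha> \<kappa> pos by (auto elim: eventually_mono)
      qed (rule tendsto_const)
      then show ?thesis unfolding P_def by (intro tendsto_Pair tendsto_const) simp
    qed
    have eq: "flux \<alpha> Ul - flux \<alpha> (?V \<epsilon>) - (c - \<epsilon> / 2) *\<^sub>R (conserved Ul - conserved (?V \<epsilon>)) = A + (\<epsilon> / 2) *\<^sub>R conserved Ul + P \<epsilon>"
        "flux \<alpha> (?V \<epsilon>) - flux \<alpha> Ur - (c + \<epsilon> / 2) *\<^sub>R (conserved (?V \<epsilon>) - conserved Ur) = - A + (\<epsilon> / 2) *\<^sub>R conserved Ur - P \<epsilon>"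
      if "\<epsilon> > 0" for \<epsilon>
    proof -
      have p: "1 / (\<kappa> / \<epsilon>) powr \<alpha> = (\<epsilon> / \<kappa>) powr \<alpha>"
        using that \<kappa> by (simp add: powr_divide)
      show "flux \<alpha> Ul - flux \<alpha> (?V \<epsilon>) - (c - \<epsilon> / 2) *\<^sub>R (conserved Ul - conserved (?V \<epsilon>)) = A + (\<epsilon> / 2) *\<^sub>R conserved Ul + P \<epsilon>"
        using that by (cases "flux \<alpha> Ul"; cases "conserved Ul") (simp add: A_def P_def p field_simps power2_eq_square)
      show "flux \<alpha> (?V \<epsilon>) - flux \<alpha> Ur - (c + \<epsilon> / 2) *\<^sub>R (conserved (?V \<epsilon>) - conserved Ur) = - A + (\<epsilon> / 2) *\<^sub>R conserved Ur - P \<epsilon>"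
        unfolding A [symmetric] using that by (cases "flux \<alpha> Ur"; cases "conserved Ur") (simp add: P_def p field_simps power2_eq_square)
    qed
    let ?g = "ray_integral D"
    have "((\<lambda>\<epsilon>. ?g (c - \<epsilon> / 2) *\<^sub>R (A + (\<epsilon> / 2) *\<^sub>R conserved Ul + P \<epsilon>) +
        ?g (c + \<epsilon> / 2) *\<^sub>R (- A + (\<epsilon> / 2) *\<^sub>R conserved Ur - P \<epsilon>)) \<longlongrightarrow>
        ?g c *\<^sub>R (A + (0 / 2) *\<^sub>R conserved Ul + (0, 0)) + ?g c *\<^sub>R (- A + (0 / 2) *\<^sub>R conserved Ur - (0, 0))) (at_right 0)"
      by (intro tendsto_intros ray_integral_tendsto [OF D] tendsto_half_width P0) auto
    then have lim: "((\<lambda>\<epsilon>. ?g (c - \<epsilon> / 2) *\<^sub>R (A + (\<epsilon> / 2) *\<^sub>R conserved Ul + P \<epsilon>) +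
        ?g (c + \<epsilon> / 2) *\<^sub>R (- A + (\<epsilon> / 2) *\<^sub>R conserved Ur - P \<epsilon>)) \<longlongrightarrow> 0) (at_right 0)"
      by (simp add: zero_prod_def [symmetric])
    show "((\<lambda>\<epsilon>. LINT t|lborel. LINT x|lborel.
             D 0 1 x t *\<^sub>R conserved (wave_net \<alpha> Ul [Shadow Ul Ur c ?V] \<epsilon> x t) +
             D 1 0 x t *\<^sub>R flux \<alpha> (wave_net \<alpha> Ul [Shadow Ul Ur c ?V] \<epsilon> x t)) \<longlongrightarrow> 0) (at_right 0)"
      by (rule Lim_transform_eventually [OF lim])
        (use pos in eventually_elim, simp only: weak_form_shadow_net [OF D] eq)
  qed
qed

text \<open>Near the rays of slope at most \<open>B\<close>, the functions \<open>D1\<close> and \<open>D2\<close> are \<open>1\<close> and \<open>x\<close> times a function of \<open>t\<close>.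
Their ray integrals are exact expressions in the slope, without a remainder that would have to be
multiplied by the velocity \<open>u\<^sub>\<epsilon>\<close>, on which no bound is known in advance.\<close>

lemma ex_probing_test_functions:
  fixes B :: real
  obtains D1 D2 K1 K2 where "test_function D1" "test_function D2" "0 < K1" "0 < K2"
    "\<And>s. \<bar>s\<bar> \<le> B \<Longrightarrow> ray_integral D1 s = K1" "\<And>s. \<bar>s\<bar> \<le> B \<Longrightarrow> ray_integral D2 s = K2 * s"
proof -
  obtain k :: "real \<Rightarrow> real" where k: "smooth k" "\<And>t. k t \<ge> 0" "\<And>t. k t > 0 \<longleftrightarrow> 1 < t \<and> t < 2"
    using ex_smooth_bump [of 1 2] by metis
  have k0: "k t = 0" if "\<not> (1 < t \<and> t < 2)" for t
    using k(2,3) [of t] that by linarith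
  \<comment> \<open>on the support \<open>1 \<le> t \<le> 2\<close> of \<open>k\<close>, the rays of slope at most \<open>B\<close> stay in the plateau\<close>
  define M where "M = 2 * \<bar>B\<bar>"
  obtain h where h: "smooth h" "\<And>x. \<bar>x\<bar> \<le> M \<Longrightarrow> h x = 1" "\<And>x. h x \<noteq> 0 \<Longrightarrow> \<bar>x\<bar> \<le> M + 1"
    using ex_smooth_plateau [of M] by metis
  have int_pos: "0 < (LINT t|lborel. f t)"
    if f: "continuous_on UNIV f" "\<And>t. 1 < t \<Longrightarrow> t < 2 \<Longrightarrow> f t > 0" "\<And>t. \<not> (1 < t \<and> t < 2) \<Longrightarrow> f t = 0" for f :: "real \<Rightarrow> real"
  proof -
    obtain F where F: "\<And>x. (F has_real_derivative f x) (at x)" using ex_antiderivative [OF f(1)] by metis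
    have "(LINT t|lborel. f t) = (LINT t|lborel. f t * indicator {1..2} t)"
    proof (intro Bochner_Integration.integral_cong refl)
      show "f t = f t * indicator {1..2} t" for t
        by (cases "1 < t \<and> t < 2") (use f(3) [of t] in \<open>auto simp: indicator_def\<close>)
    qed
    also have "\<dots> = F 2 - F 1"
      by (rule integral_FTC_Icc_real) (use F f(1) in \<open>auto simp: continuous_on_eq_continuous_at [OF open_UNIV]\<close>)
    also obtain z where "1 < z" "z < 2" "F 2 - F 1 = (2 - 1) * f z"
      using MVT2 [of 1 2 F f] F by auto
    then have "F 2 - F 1 > 0" using f(2) by simp
    finally show ?thesis .
  qed
  have kc: "continuous_on UNIV k" using continuous_on_higher_deriv [OF k(1), of UNIV 0] by simp
  define D1 where "D1 = (\<lambda>i j x t. (deriv ^^ i) h x * (deriv ^^ j) k t)"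
  define D2 where "D2 = (\<lambda>i j x t. (deriv ^^ i) (\<lambda>x. x * h x) x * (deriv ^^ j) k t)"
  have R: "\<bar>x\<bar> \<le> M + 2" if "h x \<noteq> 0" for x using h(3) [OF that] by simp
  have Rt: "1 \<le> t \<and> t \<le> M + 2" if "k t \<noteq> 0" for t
  proof -
    have "1 < t \<and> t < 2" using k0 that by blast
    then have "1 \<le> t" "t \<le> 2" by auto
    with abs_ge_zero [of B] show ?thesis unfolding M_def by linarith
  qed
  show thesis
  proof
    show "test_function D1" unfolding D1_def
      by (rule test_function_product [where \<delta> = 1 and R = "M + 2"]) (use h(1) k(1) R Rt in auto)
    show "test_function D2" unfolding D2_def
      by (rule test_function_product [where \<delta> = 1 and R = "M + 2"])
        (use h(1) k(1) R Rt in \<open>auto intro!: smooth_mult smooth_id\<close>)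
    show "0 < (LINT t|lborel. k t)" using k k0 by (intro int_pos kc) auto
    show "0 < (LINT t|lborel. t * k t)" using k k0 by (intro int_pos continuous_intros kc) auto
    fix s assume s: "\<bar>s\<bar> \<le> B"
    have st: "h (s * t) = 1" if "1 < t" "t < 2" for t
    proof (rule h(2))
      have "\<bar>s\<bar> * t \<le> \<bar>B\<bar> * 2" using s that by (intro mult_mono) auto
      then show "\<bar>s * t\<bar> \<le> M" using that by (simp add: M_def abs_mult)
    qed
    have "h (s * t) * k t = k t" for t using st [of t] k0 [of t] by (cases "1 < t \<and> t < 2") auto
    then have "(\<lambda>t. h (s * t) * k t) = k" by (rule ext)
    then show "ray_integral D1 s = (LINT t|lborel. k t)" by (simp add: ray_integral_def D1_def)
    have "s * t * h (s * t) * k t = (t * k t) * s" for t using st [of t] k0 [of t] by (cases "1 < t \<and> t < 2") auto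
    then have "(\<lambda>t. s * t * h (s * t) * k t) = (\<lambda>t. (t * k t) * s)" by (rule ext)
    then show "ray_integral D2 s = (LINT t|lborel. t * k t) * s" by (simp add: ray_integral_def D2_def)
  qed
qed

text \<open>The first probe shows that the sum of the two defects tends to \<open>0\<close>, which yields the limit of
\<open>\<epsilon>\<close> times the conserved quantities.  The second one shows that \<open>\<epsilon>\<close> times their difference does so
too; its first component identifies the limit of \<open>u\<^sub>\<epsilon>\<close> as \<open>c\<close>.\<close>

lemma shadow_wave_jump:
  assumes S: "shadow_wave \<alpha> Ul Ur c V"
  obtains \<kappa> where "0 < \<kappa>" "((\<lambda>\<epsilon>. \<epsilon> * fst (V \<epsilon>)) \<longlongrightarrow> \<kappa>) (at_right 0)"
    "((\<lambda>\<epsilon>. \<epsilon> * (fst (V \<epsilon>) * snd (V \<epsilon>))) \<longlongrightarrow> \<kappa> * c) (at_right 0)"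
    "(\<kappa>, \<kappa> * c) = c *\<^sub>R (conserved Ur - conserved Ul) - (flux \<alpha> Ur - flux \<alpha> Ul)"
proof -
  obtain \<kappa> where \<kappa>: "0 < \<kappa>" "((\<lambda>\<epsilon>. \<epsilon> * fst (V \<epsilon>)) \<longlongrightarrow> \<kappa>) (at_right 0)"
    and sol: "solves_in_limit \<alpha> (wave_net \<alpha> Ul [Shadow Ul Ur c V])"
    using S unfolding shadow_wave_def by blast
  obtain D1 D2 K1 K2 where D: "test_function D1" "test_function D2" and K: "0 < K1" "0 < K2"
    and ray: "\<And>s. \<bar>s\<bar> \<le> \<bar>c\<bar> + 1 \<Longrightarrow> ray_integral D1 s = K1" "\<And>s. \<bar>s\<bar> \<le> \<bar>c\<bar> + 1 \<Longrightarrow> ray_integral D2 s = K2 * s"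
    using ex_probing_test_functions [of "\<bar>c\<bar> + 1"] by metis
  define a where "a \<epsilon> = flux \<alpha> Ul - flux \<alpha> (V \<epsilon>) - (c - \<epsilon> / 2) *\<^sub>R (conserved Ul - conserved (V \<epsilon>))" for \<epsilon>
  define b where "b \<epsilon> = flux \<alpha> (V \<epsilon>) - flux \<alpha> Ur - (c + \<epsilon> / 2) *\<^sub>R (conserved (V \<epsilon>) - conserved Ur)" for \<epsilon>
  have small: "\<forall>\<^sub>F \<epsilon> in at_right 0. 0 < \<epsilon> \<and> \<epsilon> < (1::real)"
    using eventually_at_right_less [of 0] eventually_at_right_field [of "\<lambda>x. x < 1" 0] by (auto simp: eventually_conj_iff intro: exI [of _ 1])
  have ray': "ray_integral D1 (c - \<epsilon> / 2) = K1" "ray_integral D1 (c + \<epsilon> / 2) = K1"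
      "ray_integral D2 (c - \<epsilon> / 2) = K2 * (c - \<epsilon> / 2)" "ray_integral D2 (c + \<epsilon> / 2) = K2 * (c + \<epsilon> / 2)"
    if "0 < \<epsilon> \<and> \<epsilon> < 1" for \<epsilon>
    using that by (auto intro!: ray)
  have lim1: "((\<lambda>\<epsilon>. K1 *\<^sub>R a \<epsilon> + K1 *\<^sub>R b \<epsilon>) \<longlongrightarrow> 0) (at_right 0)"
    by (rule Lim_transform_eventually [OF sol [unfolded solves_in_limit_def, rule_format, OF D(1)]])
      (use small in eventually_elim, simp add: weak_form_shadow_net [OF D(1), unfolded One_nat_def] ray' a_def b_def del: wave_net.simps)
  have lim2: "((\<lambda>\<epsilon>. (K2 * (c - \<epsilon> / 2)) *\<^sub>R a \<epsilon> + (K2 * (c + \<epsilon> / 2)) *\<^sub>R b \<epsilon>) \<longlongrightarrow> 0) (at_right 0)"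
    by (rule Lim_transform_eventually [OF sol [unfolded solves_in_limit_def, rule_format, OF D(2)]])
      (use small in eventually_elim, simp add: weak_form_shadow_net [OF D(2), unfolded One_nat_def] ray' a_def b_def del: wave_net.simps)
  have sum0: "((\<lambda>\<epsilon>. a \<epsilon> + b \<epsilon>) \<longlongrightarrow> 0) (at_right 0)"
    using tendsto_scaleR [OF tendsto_const [of "1 / K1"] lim1] K by (simp add: scaleR_add_right [symmetric])
  have dif0: "((\<lambda>\<epsilon>. \<epsilon> *\<^sub>R (b \<epsilon> - a \<epsilon>)) \<longlongrightarrow> 0) (at_right 0)"
  proof -
    have "((\<lambda>\<epsilon>. (2 / K2) *\<^sub>R ((K2 * (c - \<epsilon> / 2)) *\<^sub>R a \<epsilon> + (K2 * (c + \<epsilon> / 2)) *\<^sub>R b \<epsilon>) - (2 * c) *\<^sub>R (a \<epsilon> + b \<epsilon>)) \<longlongrightarrow>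
        (2 / K2) *\<^sub>R 0 - (2 * c) *\<^sub>R 0) (at_right 0)"
      by (intro tendsto_intros lim2 sum0)
    moreover have "(2 / K2) *\<^sub>R ((K2 * (c - \<epsilon> / 2)) *\<^sub>R a \<epsilon> + (K2 * (c + \<epsilon> / 2)) *\<^sub>R b \<epsilon>) - (2 * c) *\<^sub>R (a \<epsilon> + b \<epsilon>) = \<epsilon> *\<^sub>R (b \<epsilon> - a \<epsilon>)" for \<epsilon>
      using K by (simp add: prod_eq_iff field_simps)
    ultimately show ?thesis by simp
  qed
  define L where "L = c *\<^sub>R (conserved Ur - conserved Ul) - (flux \<alpha> Ur - flux \<alpha> Ul)"
  have mass: "((\<lambda>\<epsilon>. \<epsilon> *\<^sub>R conserved (V \<epsilon>)) \<longlongrightarrow> L) (at_right 0)"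
  proof -
    have "((\<lambda>\<epsilon>. L + (\<epsilon> / 2) *\<^sub>R (conserved Ul + conserved Ur) - (a \<epsilon> + b \<epsilon>)) \<longlongrightarrow>
        L + (0 / 2) *\<^sub>R (conserved Ul + conserved Ur) - 0) (at_right 0)"
      by (intro tendsto_intros sum0) auto
    moreover have "L + (\<epsilon> / 2) *\<^sub>R (conserved Ul + conserved Ur) - (a \<epsilon> + b \<epsilon>) = \<epsilon> *\<^sub>R conserved (V \<epsilon>)" for \<epsilon>
      by (simp add: prod_eq_iff L_def a_def b_def field_simps)
    ultimately show ?thesis by simp
  qed
  have cf: "conserved U = (fst U, fst U * snd U)" "fst (flux \<alpha> U) = fst U * snd U" for U
    by (cases U; simp)+
  have L1: "fst L = \<kappa>"
    using tendsto_fst [OF mass] \<kappa>(2) by (intro tendsto_unique [of "at_right (0::real)"]) (simp_all add: cf)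
  have mom: "((\<lambda>\<epsilon>. \<epsilon> * (fst (V \<epsilon>) * snd (V \<epsilon>))) \<longlongrightarrow> snd L) (at_right 0)"
    using tendsto_snd [OF mass] by (simp add: cf)
  have "((\<lambda>\<epsilon>. fst (\<epsilon> *\<^sub>R (b \<epsilon> - a \<epsilon>))) \<longlongrightarrow> 2 * snd L - 2 * c * \<kappa>) (at_right 0)"
  proof -
    let ?k1 = "c * (fst Ul + fst Ur) - fst (flux \<alpha> Ul) - fst (flux \<alpha> Ur)" and ?k2 = "(fst Ur - fst Ul) / 2"
    have "((\<lambda>\<epsilon>. 2 * (\<epsilon> * (fst (V \<epsilon>) * snd (V \<epsilon>))) - 2 * c * (\<epsilon> * fst (V \<epsilon>)) + \<epsilon> * ?k1 + \<epsilon> * (\<epsilon> * ?k2)) \<longlongrightarrow>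
        2 * snd L - 2 * c * \<kappa> + 0 * ?k1 + 0 * (0 * ?k2)) (at_right 0)"
      by (intro tendsto_intros mom \<kappa>(2))
    moreover have "fst (\<epsilon> *\<^sub>R (b \<epsilon> - a \<epsilon>)) =
        2 * (\<epsilon> * (fst (V \<epsilon>) * snd (V \<epsilon>))) - 2 * c * (\<epsilon> * fst (V \<epsilon>)) + \<epsilon> * ?k1 + \<epsilon> * (\<epsilon> * ?k2)" for \<epsilon>
      by (simp add: a_def b_def cf field_simps)
    ultimately show ?thesis by simp
  qed
  moreover have "((\<lambda>\<epsilon>. fst (\<epsilon> *\<^sub>R (b \<epsilon> - a \<epsilon>))) \<longlongrightarrow> 0) (at_right 0)"
    using tendsto_fst [OF dif0] by simp
  ultimately have "2 * snd L - 2 * c * \<kappa> = 0"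
    by (intro tendsto_unique [of "at_right (0::real)"]) auto
  then have L2: "snd L = \<kappa> * c" by simp
  have "(\<kappa>, \<kappa> * c) = L" using L1 L2 by (simp add: prod_eq_iff)
  then show thesis
    using \<kappa> mom [unfolded L2] by (intro that [of \<kappa>]) (simp_all only: L_def)
qed


section \<open>Shadow waves\<close>

text \<open>The jump relations in the frame that moves with the wave.\<close>

lemma shadow_jump_iff:
  fixes c :: real
  assumes pos: "0 < \<rho>0" "0 < \<rho>1"
  shows "(\<kappa>, \<kappa> * c) = c *\<^sub>R (conserved (\<rho>1, u1) - conserved (\<rho>0, u0)) - (flux \<alpha> (\<rho>1, u1) - flux \<alpha> (\<rho>0, u0)) \<longleftrightarrow>
    \<kappa> = \<rho>0 * (u0 - c) + \<rho>1 * (c - u1) \<and>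
    \<rho>0 * (u0 - c)\<^sup>2 - (1 / \<rho>0) powr \<alpha> = \<rho>1 * (c - u1)\<^sup>2 - (1 / \<rho>1) powr \<alpha>"
proof -
  define x y where "x = (1 / \<rho>0) powr \<alpha>" and "y = (1 / \<rho>1) powr \<alpha>"
  have xy: "1 / \<rho>0 powr \<alpha> = x" "1 / \<rho>1 powr \<alpha> = y" using pos by (simp_all add: x_def y_def powr_divide)
  have "(\<kappa> = c * (\<rho>1 - \<rho>0) - (\<rho>1 * u1 - \<rho>0 * u0) \<and>
      \<kappa> * c = c * (\<rho>1 * u1 - \<rho>0 * u0) - (\<rho>1 * u1\<^sup>2 - y - (\<rho>0 * u0\<^sup>2 - x))) \<longleftrightarrow>
    (\<kappa> = \<rho>0 * (u0 - c) + \<rho>1 * (c - u1) \<and> \<rho>0 * (u0 - c)\<^sup>2 - x = \<rho>1 * (c - u1)\<^sup>2 - y)"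
    by (intro iffI conjI; elim conjE; algebra)
  then show ?thesis by (simp only: conserved.simps flux.simps xy x_def [symmetric] y_def [symmetric]
    diff_Pair scaleR_Pair prod.inject real_scaleR_def)
qed

text \<open>The kinetic energy is momentum squared over twice the mass, both of which converge after
multiplication by \<open>\<epsilon>\<close>; the internal energy of the dense state is negligible.\<close>

lemma shadow_energy_limit:
  assumes \<alpha>: "0 < \<alpha>" and S: "shadow_wave \<alpha> Ul Ur c V"
    and \<kappa>: "0 < \<kappa>" "((\<lambda>\<epsilon>. \<epsilon> * fst (V \<epsilon>)) \<longlongrightarrow> \<kappa>) (at_right 0)"
    and mom: "((\<lambda>\<epsilon>. \<epsilon> * (fst (V \<epsilon>) * snd (V \<epsilon>))) \<longlongrightarrow> \<kappa> * c) (at_right 0)"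
  shows "((\<lambda>\<epsilon>. \<epsilon> * eta \<alpha> (V \<epsilon>)) \<longlongrightarrow> \<kappa> * c\<^sup>2 / 2) (at_right 0)"
proof -
  have pos: "\<forall>\<^sub>F \<epsilon> in at_right 0. (0::real) < \<epsilon>" by (simp add: eventually_at_right_less)
  have Vpos: "0 < fst (V \<epsilon>)" if "0 < \<epsilon>" for \<epsilon> using S that by (simp add: shadow_wave_def)
  have "((\<lambda>\<epsilon>. \<epsilon> powr (1 + \<alpha>)) \<longlongrightarrow> 0 powr (1 + \<alpha>)) (at_right 0)"
    by (rule tendsto_powr') (use \<alpha> pos in \<open>auto elim: eventually_mono\<close>)
  then have p0: "((\<lambda>\<epsilon>. \<epsilon> powr (1 + \<alpha>)) \<longlongrightarrow> 0) (at_right 0)" by simp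
  have "((\<lambda>\<epsilon>. (\<epsilon> * (fst (V \<epsilon>) * snd (V \<epsilon>)))\<^sup>2 / (\<epsilon> * fst (V \<epsilon>)) / 2 +
      \<epsilon> powr (1 + \<alpha>) * (\<epsilon> * fst (V \<epsilon>)) powr (- \<alpha>) / (1 + \<alpha>)) \<longlongrightarrow>
      (\<kappa> * c)\<^sup>2 / \<kappa> / 2 + 0 * \<kappa> powr (- \<alpha>) / (1 + \<alpha>)) (at_right 0)"
    using \<kappa>(1) \<alpha> by (intro tendsto_intros mom \<kappa>(2) p0) auto
  also have "(\<kappa> * c)\<^sup>2 / \<kappa> / 2 + 0 * \<kappa> powr (- \<alpha>) / (1 + \<alpha>) = \<kappa> * c\<^sup>2 / 2"
    using \<kappa>(1) by (simp add: power2_eq_square)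
  finally show ?thesis
  proof (rule Lim_transform_eventually)
    show "\<forall>\<^sub>F \<epsilon> in at_right 0. (\<epsilon> * (fst (V \<epsilon>) * snd (V \<epsilon>)))\<^sup>2 / (\<epsilon> * fst (V \<epsilon>)) / 2 +
      \<epsilon> powr (1 + \<alpha>) * (\<epsilon> * fst (V \<epsilon>)) powr (- \<alpha>) / (1 + \<alpha>) = \<epsilon> * eta \<alpha> (V \<epsilon>)"
      using pos
    proof eventually_elim
      case (elim \<epsilon>)
      have V: "0 < fst (V \<epsilon>)" using Vpos elim .
      have "\<epsilon> powr (1 + \<alpha>) * (\<epsilon> * fst (V \<epsilon>)) powr (- \<alpha>) = \<epsilon> * fst (V \<epsilon>) powr (- \<alpha>)"
        using elim V by (simp add: powr_mult powr_add [symmetric] mult.assoc [symmetric])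
      moreover have "(\<epsilon> * (fst (V \<epsilon>) * snd (V \<epsilon>)))\<^sup>2 / (\<epsilon> * fst (V \<epsilon>)) = \<epsilon> * (fst (V \<epsilon>) * (snd (V \<epsilon>))\<^sup>2)"
        using elim V by (simp add: power2_eq_square)
      ultimately show ?case by (cases "V \<epsilon>") (simp add: algebra_simps)
    qed
  qed
qed

text \<open>The right-hand side is the production of two shocks into a state of volume \<open>0\<close>, pressure \<open>- P\<close> and
internal energy \<open>0\<close>: compare \<open>dissipation\<close> at \<open>\<tau> = 0\<close>.\<close>

lemma shadow_production:
  assumes \<alpha>: "0 < \<alpha>" and pos: "0 < \<rho>0" "0 < \<rho>1"
    and S: "shadow_wave \<alpha> (\<rho>0, u0) (\<rho>1, u1) c V"
  defines "a \<equiv> 1 / \<rho>0" and "b \<equiv> 1 / \<rho>1" and "v0 \<equiv> u0 - c" and "v1 \<equiv> c - u1"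
  defines "P \<equiv> a powr \<alpha> - \<rho>0 * v0\<^sup>2"
  shows "P = b powr \<alpha> - \<rho>1 * v1\<^sup>2" "0 < \<rho>0 * v0 + \<rho>1 * v1"
    and "wave_production \<alpha> (Shadow (\<rho>0, u0) (\<rho>1, u1) c V) =
      \<rho>0 * v0 * (a * (a powr \<alpha> + P) / 2 - a powr (1 + \<alpha>) / (1 + \<alpha>)) +
      \<rho>1 * v1 * (b * (b powr \<alpha> + P) / 2 - b powr (1 + \<alpha>) / (1 + \<alpha>))"
proof -
  obtain \<kappa> where \<kappa>: "0 < \<kappa>" "((\<lambda>\<epsilon>. \<epsilon> * fst (V \<epsilon>)) \<longlongrightarrow> \<kappa>) (at_right 0)"
    "((\<lambda>\<epsilon>. \<epsilon> * (fst (V \<epsilon>) * snd (V \<epsilon>))) \<longlongrightarrow> \<kappa> * c) (at_right 0)"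
    and jump: "(\<kappa>, \<kappa> * c) = c *\<^sub>R (conserved (\<rho>1, u1) - conserved (\<rho>0, u0)) - (flux \<alpha> (\<rho>1, u1) - flux \<alpha> (\<rho>0, u0))"
    by (rule shadow_wave_jump [OF S])
  have k: "\<kappa> = \<rho>0 * v0 + \<rho>1 * v1" and P: "P = b powr \<alpha> - \<rho>1 * v1\<^sup>2"
    using jump unfolding shadow_jump_iff [OF pos] by (auto simp: P_def a_def b_def v0_def v1_def)
  show "P = b powr \<alpha> - \<rho>1 * v1\<^sup>2" "0 < \<rho>0 * v0 + \<rho>1 * v1" using P \<kappa>(1) k by auto
  have lim: "Lim (at_right 0) (\<lambda>\<epsilon>. \<epsilon> * eta \<alpha> (V \<epsilon>)) = \<kappa> * c\<^sup>2 / 2"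
    by (rule tendsto_Lim [OF _ shadow_energy_limit [OF \<alpha> S \<kappa>]]) simp
  define x y w where "x = a powr \<alpha>" and "y = b powr \<alpha>" and "w = inverse (1 + \<alpha>)"
  have \<pi>: "\<rho>0 powr (- \<alpha>) = x" "\<rho>1 powr (- \<alpha>) = y"
    using pos by (auto simp: a_def b_def x_def y_def powr_divide powr_minus_divide)
  have e: "a powr (1 + \<alpha>) = a * x" "b powr (1 + \<alpha>) = b * y"
    using pos by (simp_all add: x_def y_def a_def b_def powr_add)
  have ab: "\<rho>0 * a = 1" "\<rho>1 * b = 1" using pos by (simp_all add: a_def b_def)
  have P': "P = x - \<rho>0 * v0\<^sup>2" "P = y - \<rho>1 * v1\<^sup>2" using P by (simp_all add: P_def x_def y_def)
  have u: "u0 = c + v0" "u1 = c - v1" by (simp_all add: v0_def v1_def)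
  have xy: "x = P + \<rho>0 * v0\<^sup>2" "y = P + \<rho>1 * v1\<^sup>2" using P' by simp_all
  have k': "\<alpha> * w = 1 - w" using \<alpha> by (simp add: w_def field_simps)
  have lhs: "- c * (\<rho>1 * u1\<^sup>2 / 2 + y * w - (\<rho>0 * u0\<^sup>2 / 2 + x * w)) +
      (\<rho>1 * u1 ^ 3 / 2 - (1 - w) * y * u1 - (\<rho>0 * u0 ^ 3 / 2 - (1 - w) * x * u0)) +
      (\<rho>0 * v0 + \<rho>1 * v1) * c\<^sup>2 / 2 = v0 * ((x + P) / 2 - x * w) + v1 * ((y + P) / 2 - y * w)"
    unfolding u xy by (simp add: field_simps power2_eq_square power3_eq_cube)
  have rhs: "\<rho>0 * v0 * (a * (x + P) / 2 - a * x * w) + \<rho>1 * v1 * (b * (y + P) / 2 - b * y * w) =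
      \<rho>0 * a * (v0 * ((x + P) / 2 - x * w)) + \<rho>1 * b * (v1 * ((y + P) / 2 - y * w))"
    by (simp add: algebra_simps)
  have dw: "z / (1 + \<alpha>) = z * w" for z by (simp add: w_def divide_inverse)
  show "wave_production \<alpha> (Shadow (\<rho>0, u0) (\<rho>1, u1) c V) =
      \<rho>0 * v0 * (a * (a powr \<alpha> + P) / 2 - a powr (1 + \<alpha>) / (1 + \<alpha>)) +
      \<rho>1 * v1 * (b * (b powr \<alpha> + P) / 2 - b powr (1 + \<alpha>) / (1 + \<alpha>))"
    unfolding wave_production.simps lim eta.simps Q.simps \<pi> e x_def [symmetric] y_def [symmetric] k dw
    unfolding k' lhs rhs ab by (simp only: mult_1_left)
qed

text \<open>The comparison of one shock of the classical solution, of mass flux \<open>M\<close>, with its counterpart of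
mass flux \<open>m\<close> in the shadow wave.  The total velocity loss is the same for both solutions, so any multiple
of the difference of the losses may be subtracted; the mean \<open>(\<tau> powr \<alpha> + P) / 2\<close> of the two pressures is the
multiple for which the remainder has the factor \<open>M - m\<close>.\<close>

lemma mass_flux_comparison:
  assumes \<alpha>: "0 < \<alpha>" and "0 < \<tau>" "\<tau> < a" and m: "0 < m" "P = a powr \<alpha> - m\<^sup>2 * a" and \<tau>P: "\<tau> powr \<alpha> < P"
  defines "M \<equiv> mass_flux \<alpha> a \<tau>"
  shows "m < M" "0 < a * (a powr \<alpha> - \<tau> powr \<alpha>) / (1 + \<alpha>) + m * a * (M * (a - \<tau>)) / 2"
    and "dissipation \<alpha> a \<tau> - m * (a * (a powr \<alpha> + P) / 2 - a powr (1 + \<alpha>) / (1 + \<alpha>))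
      - (\<tau> powr \<alpha> + P) / 2 * (velocity_loss \<alpha> a \<tau> - m * a) =
      M * (\<tau> * \<tau> powr \<alpha> / (1 + \<alpha>)) - (M - m) * (a * a powr \<alpha> / (1 + \<alpha>) + m * a * (M * (a - \<tau>)) / 2)"
proof -
  define x z w where "x = a powr \<alpha>" and "z = \<tau> powr \<alpha>" and "w = inverse (1 + \<alpha>)"
  have M2: "M\<^sup>2 * (a - \<tau>) = x - z"
    unfolding M_def x_def z_def using assms by (intro mass_flux_square) auto
  have M: "0 < M" unfolding M_def using assms by (intro mass_flux_pos) auto
  have "m\<^sup>2 * (a - \<tau>) \<le> m\<^sup>2 * a" using assms by (intro mult_left_mono) auto
  also have "\<dots> < M\<^sup>2 * (a - \<tau>)" unfolding M2 using m(2) \<tau>P by (simp add: x_def z_def)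
  finally have "m\<^sup>2 < M\<^sup>2" using \<open>\<tau> < a\<close> by simp
  then show mM: "m < M" using M by (simp add: power2_less_imp_less)
  have "z < x" unfolding x_def z_def using assms by (intro powr_less_mono2) auto
  then show "0 < a * (a powr \<alpha> - \<tau> powr \<alpha>) / (1 + \<alpha>) + m * a * (M * (a - \<tau>)) / 2"
    unfolding x_def [symmetric] z_def [symmetric] using assms M
    by (intro add_pos_pos divide_pos_pos mult_pos_pos) auto
  have e: "a powr (1 + \<alpha>) = a * x" "\<tau> powr (1 + \<alpha>) = \<tau> * z"
    using assms by (simp_all add: x_def z_def powr_add)
  have P: "P = x - m\<^sup>2 * a" using m(2) by (simp add: x_def)
  have z: "z = x - M\<^sup>2 * (a - \<tau>)" using M2 by simp
  define h :: real where "h = inverse 2"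
  have dis: "dissipation \<alpha> a \<tau> = M * ((\<tau> * z - a * x) / (1 + \<alpha>) + (x + z) / 2 * (a - \<tau>))"
    using \<open>\<tau> < a\<close> unfolding dissipation_def e by (simp add: M_def x_def z_def)
  have loss: "velocity_loss \<alpha> a \<tau> = M * (a - \<tau>)"
    using \<open>\<tau> < a\<close> by (simp add: M_def velocity_loss_mass_flux)
  show "dissipation \<alpha> a \<tau> - m * (a * (a powr \<alpha> + P) / 2 - a powr (1 + \<alpha>) / (1 + \<alpha>))
      - (\<tau> powr \<alpha> + P) / 2 * (velocity_loss \<alpha> a \<tau> - m * a) =
      M * (\<tau> * \<tau> powr \<alpha> / (1 + \<alpha>)) - (M - m) * (a * a powr \<alpha> / (1 + \<alpha>) + m * a * (M * (a - \<tau>)) / 2)"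
    unfolding dis loss e x_def [symmetric] z_def [symmetric] divide_inverse w_def [symmetric] h_def [symmetric] P
    unfolding z by algebra
qed

text \<open>The loss is the square root of pressure difference times volume difference, and at a pressure of at
most \<open>- P\<close> and a positive volume both factors are smaller than for the shadow wave.\<close>

lemma velocity_loss_less:
  assumes \<alpha>: "0 < \<alpha>" and "0 < \<tau>" "0 < a" and v: "0 < v" "P = a powr \<alpha> - v\<^sup>2 / a" and \<tau>P: "P \<le> \<tau> powr \<alpha>"
  shows "velocity_loss \<alpha> a \<tau> < v"
proof (cases "\<tau> < a")
  case True
  have va: "v\<^sup>2 / a = a powr \<alpha> - P" using v(2) by simp
  have "(a powr \<alpha> - \<tau> powr \<alpha>) * (a - \<tau>) \<le> v\<^sup>2 / a * (a - \<tau>)"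
    unfolding va using True \<tau>P by (intro mult_right_mono) auto
  also have "\<dots> < v\<^sup>2 / a * a" using assms by (intro mult_strict_left_mono) auto
  also have "\<dots> = v\<^sup>2" using assms by simp
  finally show ?thesis using True v(1) by (simp add: velocity_loss_def real_less_lsqrt)
next
  case False
  then have "velocity_loss \<alpha> a \<tau> \<le> velocity_loss \<alpha> a a"
    using velocity_loss_strict_antimono [of \<alpha> a a \<tau>] assms by (cases "a = \<tau>") auto
  then show ?thesis using v(1) by simp
qed

text \<open>By \<open>velocity_loss_less\<close> the middle pressure exceeds \<open>- P\<close>, so both waves are shocks.  Summing
\<open>mass_flux_comparison\<close> over them leaves a term \<open>(M + M') * \<tau>\<close>, and equality of the total losses
expresses it through \<open>M - m\<close> and \<open>M' - m'\<close>.\<close>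

lemma classical_dissipation_less:
  assumes \<alpha>: "0 < \<alpha>" and \<tau>: "0 < \<tau>" and pos: "0 < a" "0 < b" and v: "0 < v" "0 < v'"
    and P: "P = a powr \<alpha> - v\<^sup>2 / a" "P = b powr \<alpha> - v'\<^sup>2 / b"
    and loss: "velocity_loss \<alpha> a \<tau> + velocity_loss \<alpha> b \<tau> = v + v'"
  shows "dissipation \<alpha> a \<tau> + dissipation \<alpha> b \<tau> <
    v / a * (a * (a powr \<alpha> + P) / 2 - a powr (1 + \<alpha>) / (1 + \<alpha>)) +
    v' / b * (b * (b powr \<alpha> + P) / 2 - b powr (1 + \<alpha>) / (1 + \<alpha>))" (is "_ < ?S + ?S'")
proof -
  \<comment> \<open>the middle pressure exceeds that of the shadow wave, or both losses would be too small\<close>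
  have \<tau>P: "\<tau> powr \<alpha> < P"
  proof (rule ccontr)
    assume "\<not> \<tau> powr \<alpha> < P"
    then have "velocity_loss \<alpha> a \<tau> < v" "velocity_loss \<alpha> b \<tau> < v'"
      using assms by (auto intro!: velocity_loss_less)
    with loss show False by simp
  qed
  have "0 < v\<^sup>2 / a" "0 < v'\<^sup>2 / b" using pos v by simp_all
  then have "P < a powr \<alpha>" "P < b powr \<alpha>" using P by linarith+
  then have "\<tau> powr \<alpha> < a powr \<alpha>" "\<tau> powr \<alpha> < b powr \<alpha>" using \<tau>P by linarith+
  then have lt: "\<tau> < a" "\<tau> < b"
    using powr_mono2 [of \<alpha> a \<tau>] powr_mono2 [of \<alpha> b \<tau>] \<alpha> pos by (force simp: not_le [symmetric])+
  define m m' where "m = v / a" and "m' = v' / b"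
  define M M' where "M = mass_flux \<alpha> a \<tau>" and "M' = mass_flux \<alpha> b \<tau>"
  have m: "0 < m" "0 < m'" "P = a powr \<alpha> - m\<^sup>2 * a" "P = b powr \<alpha> - m'\<^sup>2 * b" "v = m * a" "v' = m' * b"
    using v pos P by (simp_all add: m_def m'_def power2_eq_square)
  note A = mass_flux_comparison [OF \<alpha> \<tau> lt(1) m(1,3) \<tau>P, folded M_def]
  note B = mass_flux_comparison [OF \<alpha> \<tau> lt(2) m(2,4) \<tau>P, folded M'_def]
  define x y z w where "x = a powr \<alpha>" and "y = b powr \<alpha>" and "z = \<tau> powr \<alpha>" and "w = inverse (1 + \<alpha>)"
  have sum: "M * (a - \<tau>) + M' * (b - \<tau>) = m * a + m' * b"
    using loss lt by (simp add: velocity_loss_mass_flux M_def M'_def m)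
  have "(dissipation \<alpha> a \<tau> - ?S - (z + P) / 2 * (velocity_loss \<alpha> a \<tau> - m * a)) +
      (dissipation \<alpha> b \<tau> - ?S' - (z + P) / 2 * (velocity_loss \<alpha> b \<tau> - m' * b)) =
      (M * (\<tau> * z / (1 + \<alpha>)) - (M - m) * (a * x / (1 + \<alpha>) + m * a * (M * (a - \<tau>)) / 2)) +
      (M' * (\<tau> * z / (1 + \<alpha>)) - (M' - m') * (b * y / (1 + \<alpha>) + m' * b * (M' * (b - \<tau>)) / 2))"
    using A(3) B(3) unfolding x_def y_def z_def m_def [symmetric] m'_def [symmetric] by linarith
  also have "\<dots> = - ((M - m) * (a * (x - z) / (1 + \<alpha>) + m * a * (M * (a - \<tau>)) / 2)
      + (M' - m') * (b * (y - z) / (1 + \<alpha>) + m' * b * (M' * (b - \<tau>)) / 2))"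
  proof -
    have \<tau>M: "\<tau> * (M + M') = (M - m) * a + (M' - m') * b" using sum by (simp add: algebra_simps)
    have "M * (\<tau> * z / (1 + \<alpha>)) + M' * (\<tau> * z / (1 + \<alpha>)) = \<tau> * (M + M') * z / (1 + \<alpha>)"
      unfolding divide_inverse by algebra
    also have "\<dots> = (M - m) * (a * z / (1 + \<alpha>)) + (M' - m') * (b * z / (1 + \<alpha>))"
      unfolding \<tau>M divide_inverse by algebra
    finally show ?thesis unfolding divide_inverse by algebra
  qed
  also have "\<dots> < 0"
    using add_pos_pos [OF mult_pos_pos [OF _ A(2), of "M - m"] mult_pos_pos [OF _ B(2), of "M' - m'"]]
      A(1) B(1)
    unfolding x_def y_def z_def neg_less_0_iff_less by simp
  finally have less: "(dissipation \<alpha> a \<tau> - ?S - (z + P) / 2 * (velocity_loss \<alpha> a \<tau> - m * a)) +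
      (dissipation \<alpha> b \<tau> - ?S' - (z + P) / 2 * (velocity_loss \<alpha> b \<tau> - m' * b)) < 0" .
  have "d + d' < s + s'" if "(d - s - k * (l - p)) + (d' - s' - k * (l' - p')) < 0" "l + l' = p + p'"
    for d d' s s' k l l' p p' :: real
  proof -
    have "k * (l - p) + k * (l' - p') = 0" using that(2) by algebra
    then show ?thesis using that(1) by linarith
  qed
  from this [OF less] show ?thesis using loss m(5,6) by simp
qed

lemma overcompressive_iff:
  assumes "0 < \<alpha>" "0 < \<rho>0" "0 < \<rho>1"
  shows "overcompressive \<alpha> (\<rho>0, u0) (\<rho>1, u1) c \<longleftrightarrow>
    sqrt \<alpha> * (1 / \<rho>0) powr ((1 + \<alpha>) / 2) \<le> u0 - c \<and> sqrt \<alpha> * (1 / \<rho>1) powr ((1 + \<alpha>) / 2) \<le> c - u1"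
proof -
  have p: "0 < sqrt \<alpha> * (1 / \<rho>0) powr ((1 + \<alpha>) / 2)" "0 < sqrt \<alpha> * (1 / \<rho>1) powr ((1 + \<alpha>) / 2)"
    using assms by simp_all
  have all: "(\<forall>i. R i) \<longleftrightarrow> R First \<and> R Second" for R by (metis family.exhaust)
  have ev: "eigenvalue \<alpha> First (\<rho>, u) = u - sqrt \<alpha> * (1 / \<rho>) powr ((1 + \<alpha>) / 2)"
    "eigenvalue \<alpha> Second (\<rho>, u) = u + sqrt \<alpha> * (1 / \<rho>) powr ((1 + \<alpha>) / 2)" if "0 < \<rho>" for \<rho> u
    by (simp_all only: eigenvalue.simps minus_divide_left [symmetric] powr_neg_volume [OF that])
  show ?thesis
    unfolding overcompressive_def all ev [OF assms(2)] ev [OF assms(3)] using p by auto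
qed

text \<open>For \<open>v0 = (1 / \<rho>0) powr ((1 + \<alpha>) / 2)\<close> the left side of the jump relation vanishes and the right one is
nonnegative; at the other end the roles are exchanged.  In between lies a solution, and on the whole interval
the wave is overcompressive because \<open>sqrt \<alpha> \<le> 1\<close>.\<close>

lemma ex_overcompressive_shadow_wave:
  assumes \<alpha>: "0 < \<alpha>" "\<alpha> < 1" and pos: "0 < \<rho>0" "0 < \<rho>1"
    and gap: "(1 / \<rho>0) powr ((1 + \<alpha>) / 2) + (1 / \<rho>1) powr ((1 + \<alpha>) / 2) \<le> u0 - u1"
  shows "\<exists>c V. admissible_wave \<alpha> (Shadow (\<rho>0, u0) (\<rho>1, u1) c V)"
proof -
  define a b where "a = (1 / \<rho>0) powr ((1 + \<alpha>) / 2)" and "b = (1 / \<rho>1) powr ((1 + \<alpha>) / 2)"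
  have ab: "0 < a" "0 < b" using pos by (simp_all add: a_def b_def)
  have sq: "\<rho> * ((1 / \<rho>) powr ((1 + \<alpha>) / 2))\<^sup>2 = (1 / \<rho>) powr \<alpha>" if "0 < \<rho>" for \<rho> :: real
  proof -
    have "((1 / \<rho>) powr ((1 + \<alpha>) / 2))\<^sup>2 = (1 / \<rho>) powr (1 + \<alpha>)"
      by (simp add: power2_eq_square powr_add [symmetric])
    then show ?thesis using that by (simp add: powr_add)
  qed
  \<comment> \<open>\<open>\<rho>0 * a\<^sup>2\<close> and \<open>\<rho>1 * b\<^sup>2\<close> are the powers \<open>(1 / \<rho>i) powr \<alpha>\<close> in the jump relation, by \<open>sq\<close>\<close>
  define h where "h v = (\<rho>0 * v\<^sup>2 - \<rho>0 * a\<^sup>2) - (\<rho>1 * (u0 - u1 - v)\<^sup>2 - \<rho>1 * b\<^sup>2)" for v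
  have gap': "a \<le> u0 - u1 - b" "b \<le> u0 - u1 - a" using gap by (simp_all add: a_def b_def)
  have "b\<^sup>2 \<le> (u0 - u1 - a)\<^sup>2" using gap' ab by (intro power_mono) auto
  then have lo: "h a \<le> 0" using pos by (simp add: h_def)
  have "a\<^sup>2 \<le> (u0 - u1 - b)\<^sup>2" using gap' ab by (intro power_mono) auto
  then have hi: "0 \<le> h (u0 - u1 - b)" using pos by (simp add: h_def)
  have "continuous_on {a..u0 - u1 - b} h" unfolding h_def by (intro continuous_intros)
  from IVT' [OF lo hi gap'(1) this] obtain v where v: "a \<le> v" "v \<le> u0 - u1 - b" "h v = 0" by blast
  define c where "c = u0 - v"
  define \<kappa> where "\<kappa> = \<rho>0 * (u0 - c) + \<rho>1 * (c - u1)"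
  have vc: "u0 - c = v" "c - u1 = u0 - u1 - v" "b \<le> c - u1" using v by (simp_all add: c_def)
  have \<kappa>: "0 < \<kappa>" unfolding \<kappa>_def vc(1) using vc(3) v(1) ab pos by (intro add_pos_pos mult_pos_pos) auto
  have "\<rho>0 * (u0 - c)\<^sup>2 - (1 / \<rho>0) powr \<alpha> = \<rho>1 * (c - u1)\<^sup>2 - (1 / \<rho>1) powr \<alpha>"
    using v(3) unfolding vc(1,2) h_def a_def b_def sq [OF pos(1)] sq [OF pos(2)] by simp
  then have "shadow_wave \<alpha> (\<rho>0, u0) (\<rho>1, u1) c (\<lambda>\<epsilon>. (\<kappa> / \<epsilon>, c))"
    by (intro shadow_waveI \<alpha> \<kappa>) (simp only: shadow_jump_iff [OF pos] \<kappa>_def simp_thms)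
  moreover have "overcompressive \<alpha> (\<rho>0, u0) (\<rho>1, u1) c"
  proof -
    have "sqrt \<alpha> * a \<le> 1 * a" "sqrt \<alpha> * b \<le> 1 * b" using \<alpha> ab by (intro mult_right_mono; simp)+
    then show ?thesis
      unfolding overcompressive_iff [OF \<alpha>(1) pos] a_def [symmetric] b_def [symmetric] using v(1) vc by simp
  qed
  ultimately show ?thesis using pos by auto
qed

text \<open>The speed is a root of a polynomial of degree at most two whose derivative there is \<open>2 * \<kappa> > 0\<close>, so
no second root can have this property.\<close>

lemma shadow_production_unique:
  assumes \<alpha>: "0 < \<alpha>" and pos: "0 < \<rho>0" "0 < \<rho>1"
    and S: "shadow_wave \<alpha> (\<rho>0, u0) (\<rho>1, u1) c V" "shadow_wave \<alpha> (\<rho>0, u0) (\<rho>1, u1) c' V'"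
  shows "wave_production \<alpha> (Shadow (\<rho>0, u0) (\<rho>1, u1) c V) = wave_production \<alpha> (Shadow (\<rho>0, u0) (\<rho>1, u1) c' V')"
proof -
  note A = shadow_production [OF \<alpha> pos S(1)] and B = shadow_production [OF \<alpha> pos S(2)]
  define \<kappa> \<kappa>' where "\<kappa> = \<rho>0 * (u0 - c) + \<rho>1 * (c - u1)" and "\<kappa>' = \<rho>0 * (u0 - c') + \<rho>1 * (c' - u1)"
  have "0 < \<kappa> + \<kappa>'" using A(2) B(2) by (simp add: \<kappa>_def \<kappa>'_def)
  moreover have "(c - c') * (\<kappa> + \<kappa>') = 0"
  proof -
    have "(c - c') * (\<kappa> + \<kappa>') = (\<rho>0 * (u0 - c')\<^sup>2 - \<rho>1 * (c' - u1)\<^sup>2) - (\<rho>0 * (u0 - c)\<^sup>2 - \<rho>1 * (c - u1)\<^sup>2)"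
      by (simp add: \<kappa>_def \<kappa>'_def algebra_simps power2_eq_square)
    then show ?thesis using A(1) B(1) by linarith
  qed
  ultimately have "c = c'"
    by (metis less_irrefl mult_eq_0_iff eq_iff_diff_eq_0)
  note A(3) also note B(3) [symmetric, folded \<open>c = c'\<close>]
  finally show ?thesis unfolding \<open>c = c'\<close> .
qed

lemma classical_production_less_shadow:
  assumes \<alpha>: "0 < \<alpha>" "\<alpha> < 1" and pos: "0 < \<rho>0" "0 < \<rho>1"
    and cl: "classical_solution \<alpha> (\<rho>0, u0) (\<rho>1, u1) ws"
    and sh: "admissible_wave \<alpha> (Shadow (\<rho>0, u0) (\<rho>1, u1) c V)"
  shows "energy_production \<alpha> ws < wave_production \<alpha> (Shadow (\<rho>0, u0) (\<rho>1, u1) c V)"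
proof -
  have S: "shadow_wave \<alpha> (\<rho>0, u0) (\<rho>1, u1) c V" and over: "overcompressive \<alpha> (\<rho>0, u0) (\<rho>1, u1) c"
    using sh by simp_all
  have v: "0 < u0 - c" "0 < c - u1"
  proof -
    have "0 < sqrt \<alpha> * (1 / \<rho>0) powr ((1 + \<alpha>) / 2)" "0 < sqrt \<alpha> * (1 / \<rho>1) powr ((1 + \<alpha>) / 2)"
      using \<alpha> pos by simp_all
    then show "0 < u0 - c" "0 < c - u1" using over unfolding overcompressive_iff [OF \<alpha>(1) pos] by linarith+
  qed
  obtain \<tau> where \<tau>: "0 < \<tau>" "u0 - u1 = velocity_loss \<alpha> (1 / \<rho>0) \<tau> + velocity_loss \<alpha> (1 / \<rho>1) \<tau>"
      "energy_production \<alpha> ws = dissipation \<alpha> (1 / \<rho>0) \<tau> + dissipation \<alpha> (1 / \<rho>1) \<tau>"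
    using classical_solution_middle_volume [OF \<alpha> _ cl] pos unfolding fst_conv snd_conv by metis
  note A = shadow_production [OF \<alpha>(1) pos S]
  define P where "P = (1 / \<rho>0) powr \<alpha> - \<rho>0 * (u0 - c)\<^sup>2"
  have P: "P = (1 / \<rho>0) powr \<alpha> - (u0 - c)\<^sup>2 / (1 / \<rho>0)" "P = (1 / \<rho>1) powr \<alpha> - (c - u1)\<^sup>2 / (1 / \<rho>1)"
    using A(1) by (simp_all add: P_def mult.commute)
  have inv: "0 < 1 / \<rho>0" "0 < 1 / \<rho>1" using pos by simp_all
  have loss: "velocity_loss \<alpha> (1 / \<rho>0) \<tau> + velocity_loss \<alpha> (1 / \<rho>1) \<tau> = (u0 - c) + (c - u1)"
    using \<tau>(2) by linarith
  have conv: "(u0 - c) / (1 / \<rho>0) = \<rho>0 * (u0 - c)" "(c - u1) / (1 / \<rho>1) = \<rho>1 * (c - u1)"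
    by (simp_all only: divide_divide_eq_right div_by_1 mult.commute)
  show ?thesis
    unfolding \<tau>(3) A(3) P_def [symmetric]
    by (rule classical_dissipation_less [OF \<alpha>(1) \<tau>(1) inv v P loss, unfolded conv])
qed


section \<open>The rate of the energy\<close>

lemma has_integral_three_pieces:
  fixes f g :: "real \<Rightarrow> real"
  assumes "y \<le> p" "p \<le> q" "q \<le> L" "(f has_integral I) {p..q}" "(g has_integral J) {q..L}"
  shows "((\<lambda>x. if x < p then A else if x < q then f x else g x) has_integral (A * (p - y) + I + J)) {y..L}"
proof -
  let ?h = "\<lambda>x. if x < p then A else if x < q then f x else g x"
  have "((\<lambda>x. A) has_integral A * (p - y)) {y..p}"
    using has_integral_const_real [of A y p] assms(1) by (simp add: mult.commute)
  then have 1: "(?h has_integral A * (p - y)) {y..p}"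
    by (rule has_integral_spike_finite [of "{p}", rotated 2]) auto
  have 2: "(?h has_integral I) {p..q}"
    by (rule has_integral_spike_finite [OF _ _ assms(4), of "{q}"]) auto
  have 3: "(?h has_integral J) {q..L}"
    by (rule has_integral_spike_finite [OF _ _ assms(5), of "{}"]) (use assms(2) in auto)
  show ?thesis
    using has_integral_combine [OF _ _ has_integral_combine [OF assms(1,2) 1 2] 3] assms by simp
qed

lemma shock_production_normalised:
  assumes "shock_wave \<alpha> i Ul Ur s"
  shows "s * eta_bar \<alpha> a1 a2 Ul - s * eta_bar \<alpha> a1 a2 Ur =
    wave_production \<alpha> (Shock i Ul Ur s) - (Q_bar \<alpha> a1 a2 c Ur - Q_bar \<alpha> a1 a2 c Ul)"
proof -
  obtain \<rho>l ul \<rho>r ur where U: "Ul = (\<rho>l, ul)" "Ur = (\<rho>r, ur)" by (cases Ul; cases Ur)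
  have rh: "s * (\<rho>r - \<rho>l) = \<rho>r * ur - \<rho>l * ul"
      "s * (\<rho>r * ur - \<rho>l * ul) = (\<rho>r * ur\<^sup>2 - \<rho>r powr (- \<alpha>)) - (\<rho>l * ul\<^sup>2 - \<rho>l powr (- \<alpha>))"
    using assms(1) by (simp_all add: shock_wave_def U powr_minus_divide)
  have "s * (a1 * \<rho>l + a2 * (\<rho>l * ul)) - s * (a1 * \<rho>r + a2 * (\<rho>r * ur)) =
      - (a1 * (s * (\<rho>r - \<rho>l)) + a2 * (s * (\<rho>r * ur - \<rho>l * ul)))"
    by (simp add: algebra_simps)
  then show ?thesis
    unfolding rh by (simp add: U algebra_simps del: eta.simps Q.simps)
qed

text \<open>Along a fan \<open>Q_bar' = \<xi> * eta_bar'\<close>, so \<open>\<xi> * eta_bar - Q_bar\<close> is an antiderivative of \<open>eta_bar\<close>.\<close>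

lemma fan_integral:
  assumes V: "rarefaction_wave \<alpha> i Ul Ur V" and \<alpha>: "0 < \<alpha>"
  defines "a \<equiv> eigenvalue \<alpha> i Ul" and "b \<equiv> eigenvalue \<alpha> i Ur"
  shows "((\<lambda>\<xi>. eta_bar \<alpha> a1 a2 (V \<xi>)) has_integral
    (b * eta_bar \<alpha> a1 a2 Ur - Q_bar \<alpha> a1 a2 c Ur - (a * eta_bar \<alpha> a1 a2 Ul - Q_bar \<alpha> a1 a2 c Ul))) {a..b}"
proof -
  have V': "a < b" "V a = Ul" "V b = Ur" "\<And>\<xi>. \<xi> \<in> {a..b} \<Longrightarrow> 0 < fst (V \<xi>) \<and> eigenvalue \<alpha> i (V \<xi>) = \<xi>"
    using V unfolding rarefaction_wave_def Let_def a_def b_def by blast+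
  have "((\<lambda>z. z * eta_bar \<alpha> a1 a2 (V z) - Q_bar \<alpha> a1 a2 c (V z)) has_vector_derivative eta_bar \<alpha> a1 a2 (V \<xi>))
      (at \<xi> within {a..b})" if \<xi>: "\<xi> \<in> {a..b}" for \<xi>
  proof -
    obtain r where r: "((\<lambda>z. fst (V z)) has_real_derivative r) (at \<xi> within {a..b})"
      "((\<lambda>z. snd (V z)) has_real_derivative (\<xi> - snd (V \<xi>)) * r / fst (V \<xi>)) (at \<xi> within {a..b})"
      using fan_derivatives [OF V \<alpha>, of \<xi>] \<xi> unfolding a_def b_def by blast
    have p: "0 < fst (V \<xi>)" "(\<xi> - snd (V \<xi>))\<^sup>2 = \<alpha> * fst (V \<xi>) powr (- \<alpha> - 1)"
      using V'(4) [OF \<xi>] eigenvalue_characteristic [of \<alpha> i "fst (V \<xi>)" "snd (V \<xi>)" \<xi>] \<alpha> by simp_all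
    note D = simple_wave_derivatives [OF r p \<alpha>]
    obtain e where e: "((\<lambda>z. eta \<alpha> (V z)) has_real_derivative e) (at \<xi> within {a..b})"
        "((\<lambda>z. Q \<alpha> (V z)) has_real_derivative \<xi> * e) (at \<xi> within {a..b})"
      using D(3) by auto
    have bar: "eta_bar \<alpha> a1 a2 U = eta \<alpha> U + a1 * fst U + a2 * (fst U * snd U)"
        "Q_bar \<alpha> a1 a2 c U = Q \<alpha> U + a1 * (fst U * snd U) + a2 * (fst U * (snd U)\<^sup>2 - fst U powr (- \<alpha>)) + c" for U
      by (cases U; simp)+
    have E: "((\<lambda>z. eta_bar \<alpha> a1 a2 (V z)) has_real_derivative e + a1 * r + a2 * (\<xi> * r)) (at \<xi> within {a..b})"
      unfolding bar by (intro DERIV_add DERIV_cmult e r D)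
    have F: "((\<lambda>z. Q_bar \<alpha> a1 a2 c (V z)) has_real_derivative
        \<xi> * e + a1 * (\<xi> * r) + a2 * (\<xi> * (\<xi> * r)) + 0) (at \<xi> within {a..b})"
      unfolding bar by (intro DERIV_add DERIV_cmult DERIV_const e D)
    have "((\<lambda>z. z * eta_bar \<alpha> a1 a2 (V z) - Q_bar \<alpha> a1 a2 c (V z)) has_real_derivative
        (1 * eta_bar \<alpha> a1 a2 (V \<xi>) + (e + a1 * r + a2 * (\<xi> * r)) * \<xi>) - (\<xi> * e + a1 * (\<xi> * r) + a2 * (\<xi> * (\<xi> * r)) + 0)) (at \<xi> within {a..b})"
      by (intro DERIV_diff DERIV_mult E F DERIV_ident)
    then show ?thesis
      by (simp add: has_real_derivative_iff_has_vector_derivative algebra_simps)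
  qed
  from fundamental_theorem_of_calculus [OF _ this] V'(1-3) show ?thesis by simp
qed

lemma classical_wave_integral:
  assumes w: "admissible_wave \<alpha> w" "wave_family w \<noteq> None" and \<alpha>: "0 < \<alpha>" and t: "0 \<le> t"
  shows "\<exists>J. ((\<lambda>x. eta_bar \<alpha> a1 a2 (interior_value w \<epsilon> (x / t))) has_integral t * J)
        {left_speed \<alpha> w 0 * t..right_speed \<alpha> w 0 * t} \<and>
      left_speed \<alpha> w 0 * eta_bar \<alpha> a1 a2 (left_state w) - right_speed \<alpha> w 0 * eta_bar \<alpha> a1 a2 (right_state w) + J =
      wave_production \<alpha> w - (Q_bar \<alpha> a1 a2 c (right_state w) - Q_bar \<alpha> a1 a2 c (left_state w))"
proof (cases w)
  case (Shock i Ul Ur s)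
  with w shock_production_normalised [of \<alpha> i Ul Ur s a1 a2 c] show ?thesis
    by (intro exI [of _ 0]) (simp add: has_integral_refl del: wave_production.simps)
next
  case (Rarefaction i Ul Ur V)
  with w have V: "rarefaction_wave \<alpha> i Ul Ur V" by simp
  define a b J where "a = eigenvalue \<alpha> i Ul" and "b = eigenvalue \<alpha> i Ur" and
    "J = b * eta_bar \<alpha> a1 a2 Ur - Q_bar \<alpha> a1 a2 c Ur - (a * eta_bar \<alpha> a1 a2 Ul - Q_bar \<alpha> a1 a2 c Ul)"
  have I: "((\<lambda>\<xi>. eta_bar \<alpha> a1 a2 (V \<xi>)) has_integral J) {a..b}"
    unfolding a_def b_def J_def by (rule fan_integral [OF V \<alpha>])
  have "((\<lambda>x. eta_bar \<alpha> a1 a2 (V (x / t))) has_integral t * J) {a * t..b * t}"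
  proof (cases "t = 0")
    case True
    then show ?thesis by (simp add: has_integral_refl)
  next
    case False
    with t have t: "0 < t" by simp
    from has_integral_affinity' [OF I [folded box_real(2)], of "1 / t" 0] t show ?thesis
      by (simp add: box_real field_simps)
  qed
  then show ?thesis
    using Rarefaction by (intro exI [of _ J]) (simp add: a_def [symmetric] b_def [symmetric] J_def)
qed (use w in simp)

text \<open>Induction over the waves from the left, with the left end \<open>y\<close> of the interval moving to the right
edge of the wave that is removed.\<close>

lemma classical_energy_integral:
  assumes \<alpha>: "0 < \<alpha>" and t: "0 \<le> t"
  shows "connects Ul ws Ur \<Longrightarrow> separated \<alpha> ws \<Longrightarrow>
    (\<forall>w\<in>set ws. admissible_wave \<alpha> w \<and> wave_family w \<noteq> None) \<Longrightarrow>
    y \<le> L \<Longrightarrow> (\<forall>w\<in>set ws. y \<le> left_speed \<alpha> w 0 * t \<and> right_speed \<alpha> w 0 * t \<le> L) \<Longrightarrow>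
    ((\<lambda>x. eta_bar \<alpha> a1 a2 (wave_net \<alpha> Ul ws \<epsilon> x t)) has_integral
      eta_bar \<alpha> a1 a2 Ur * L - eta_bar \<alpha> a1 a2 Ul * y +
      t * (energy_production \<alpha> ws - (Q_bar \<alpha> a1 a2 c Ur - Q_bar \<alpha> a1 a2 c Ul))) {y..L}"
proof (induction ws arbitrary: Ul y)
  case Nil
  then show ?case
    using has_integral_const_real [of "eta_bar \<alpha> a1 a2 Ur" y L] by (simp add: energy_production_def algebra_simps)
next
  case (Cons w ws)
  define p q where "p = left_speed \<alpha> w 0 * t" and "q = right_speed \<alpha> w 0 * t"
  have w: "admissible_wave \<alpha> w" "wave_family w \<noteq> None" "left_state w = Ul" "connects (right_state w) ws Ur"
    using Cons.prems by simp_all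
  have "left_speed \<alpha> w 0 \<le> right_speed \<alpha> w 0"
    using w(1,2) by (cases w) (auto simp: rarefaction_wave_def Let_def)
  then have pq: "y \<le> p" "p \<le> q" "q \<le> L"
    using Cons.prems(5) t by (auto simp: p_def q_def intro: mult_right_mono)
  have sep: "separated \<alpha> ws"
    using Cons.prems(2) by (cases ws) (auto simp: separated_def)
  have order: "\<forall>w'\<in>set ws. q \<le> left_speed \<alpha> w' 0 * t"
  proof -
    have "right_speed \<alpha> v 0 < left_speed \<alpha> w' 0"
      if "separated \<alpha> (v # vs)" "\<forall>w\<in>set (v # vs). admissible_wave \<alpha> w \<and> wave_family w \<noteq> None" "w' \<in> set vs" for v vs w'
      using that
    proof (induction vs arbitrary: v)
      case (Cons v' vs)
      have less: "right_speed \<alpha> v 0 < left_speed \<alpha> v' 0" "separated \<alpha> (v' # vs)"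
        using separated_Cons_Cons [OF Cons.prems(1)] by auto
      have "left_speed \<alpha> v' 0 \<le> right_speed \<alpha> v' 0"
        using Cons.prems(2) by (cases v') (auto simp: rarefaction_wave_def Let_def)
      with less Cons.IH [OF less(2)] Cons.prems show ?case by fastforce
    qed simp
    from this [OF Cons.prems(2,3)] show ?thesis
      unfolding q_def using t by (intro ballI mult_right_mono [OF less_imp_le]) auto
  qed
  obtain J where J: "((\<lambda>x. eta_bar \<alpha> a1 a2 (interior_value w \<epsilon> (x / t))) has_integral t * J) {p..q}"
    "left_speed \<alpha> w 0 * eta_bar \<alpha> a1 a2 Ul - right_speed \<alpha> w 0 * eta_bar \<alpha> a1 a2 (right_state w) + J =
      wave_production \<alpha> w - (Q_bar \<alpha> a1 a2 c (right_state w) - Q_bar \<alpha> a1 a2 c Ul)"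
    using classical_wave_integral [OF w(1,2) \<alpha> t, of a1 a2 \<epsilon> c] unfolding p_def q_def w(3) by blast
  have IH: "((\<lambda>x. eta_bar \<alpha> a1 a2 (wave_net \<alpha> (right_state w) ws \<epsilon> x t)) has_integral
      eta_bar \<alpha> a1 a2 Ur * L - eta_bar \<alpha> a1 a2 (right_state w) * q +
      t * (energy_production \<alpha> ws - (Q_bar \<alpha> a1 a2 c Ur - Q_bar \<alpha> a1 a2 c (right_state w)))) {q..L}"
    using Cons.prems w sep order pq by (intro Cons.IH) auto
  have eq: "eta_bar \<alpha> a1 a2 (wave_net \<alpha> Ul (w # ws) \<epsilon> x t) =
      (if x < p then eta_bar \<alpha> a1 a2 Ul else if x < q then eta_bar \<alpha> a1 a2 (interior_value w \<epsilon> (x / t))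
       else eta_bar \<alpha> a1 a2 (wave_net \<alpha> (right_state w) ws \<epsilon> x t))" for x
    using classical_speeds(1) [OF w(2), of \<alpha> \<epsilon>] classical_speeds(2) [OF w(2), of \<alpha> \<epsilon>] by (simp add: p_def q_def)
  have val: "eta_bar \<alpha> a1 a2 Ul * (p - y) + t * J + (eta_bar \<alpha> a1 a2 Ur * L - eta_bar \<alpha> a1 a2 (right_state w) * q +
      t * (energy_production \<alpha> ws - (Q_bar \<alpha> a1 a2 c Ur - Q_bar \<alpha> a1 a2 c (right_state w)))) =
    eta_bar \<alpha> a1 a2 Ur * L - eta_bar \<alpha> a1 a2 Ul * y +
      t * (energy_production \<alpha> (w # ws) - (Q_bar \<alpha> a1 a2 c Ur - Q_bar \<alpha> a1 a2 c Ul))"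
  proof -
    have prod: "energy_production \<alpha> (w # ws) = wave_production \<alpha> w + energy_production \<alpha> ws"
      by (simp add: energy_production_def)
    have J_eq: "J = wave_production \<alpha> w - (Q_bar \<alpha> a1 a2 c (right_state w) - Q_bar \<alpha> a1 a2 c Ul)
        - left_speed \<alpha> w 0 * eta_bar \<alpha> a1 a2 Ul + right_speed \<alpha> w 0 * eta_bar \<alpha> a1 a2 (right_state w)"
      using J(2) by linarith
    show ?thesis unfolding prod p_def q_def J_eq by (simp add: algebra_simps)
  qed
  show ?case
    unfolding eq val [symmetric] by (rule has_integral_three_pieces [OF pq J(1) IH])
qed

lemma has_energy_rate_affine:
  assumes "0 < T" and "\<And>t. t \<in> {0..T} \<Longrightarrow>
    ((\<lambda>\<epsilon>. integral {-L..L} (\<lambda>x. eta_bar \<alpha> a1 a2 (wave_net \<alpha> U0 ws \<epsilon> x t))) \<longlongrightarrow> C + t * d) (at_right 0)"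
  shows "has_energy_rate \<alpha> a1 a2 L U0 ws d"
  unfolding has_energy_rate_def
proof (intro exI conjI ballI)
  show "((\<lambda>t. C + t * d) has_real_derivative d) (at 0 within {0..T})"
    by (auto intro!: derivative_eq_intros)
qed (use assms in auto)

lemma classical_energy_rate:
  assumes \<alpha>: "0 < \<alpha>" and sol: "classical_solution \<alpha> U0 U1 ws" and L: "0 < L"
    and norm: "Q_bar \<alpha> a1 a2 c U0 = 0" "Q_bar \<alpha> a1 a2 c U1 = 0"
  shows "has_energy_rate \<alpha> a1 a2 L U0 ws (energy_production \<alpha> ws)"
proof -
  define speed where "speed w = \<bar>left_speed \<alpha> w 0\<bar> + \<bar>right_speed \<alpha> w 0\<bar>" for w
  \<comment> \<open>a bound of all speeds: the waves stay in \<open>[-L, L]\<close> up to the time \<open>L / B\<close>\<close>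
  define B where "B = (\<Sum>w\<in>set ws. speed w) + 1"
  have speed: "0 \<le> speed w" for w by (simp add: speed_def)
  have B: "speed w < B" if "w \<in> set ws" for w
    using member_le_sum [of w "set ws" speed] that speed by (simp add: B_def)
  have "0 \<le> (\<Sum>w\<in>set ws. speed w)" by (intro sum_nonneg speed)
  then have B0: "0 < B" by (simp add: B_def)
  show ?thesis
  proof (rule has_energy_rate_affine)
    show "0 < L / B" using L B0 by simp
    fix t assume t: "t \<in> {0..L / B}"
    have "- L \<le> left_speed \<alpha> w 0 * t \<and> right_speed \<alpha> w 0 * t \<le> L" if "w \<in> set ws" for w
    proof -
      have bound: "\<bar>s * t\<bar> \<le> L" if "\<bar>s\<bar> \<le> B" for s
      proof -
        have "\<bar>s\<bar> * t \<le> B * (L / B)" using that t B0 by (intro mult_mono) auto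
        then show ?thesis using t B0 by (simp add: abs_mult)
      qed
      have "\<bar>left_speed \<alpha> w 0\<bar> \<le> B" "\<bar>right_speed \<alpha> w 0\<bar> \<le> B"
        using B [OF that] unfolding speed_def by linarith+
      from this [THEN bound] show ?thesis by linarith
    qed
    then have "((\<lambda>x. eta_bar \<alpha> a1 a2 (wave_net \<alpha> U0 ws \<epsilon> x t)) has_integral
      eta_bar \<alpha> a1 a2 U1 * L - eta_bar \<alpha> a1 a2 U0 * (- L) +
      t * (energy_production \<alpha> ws - (Q_bar \<alpha> a1 a2 c U1 - Q_bar \<alpha> a1 a2 c U0))) {-L..L}" for \<epsilon>
      using sol t L by (intro classical_energy_integral \<alpha>)
        (auto simp: classical_solution_def riemann_solution_def classical_wave_iff)
    then have "integral {-L..L} (\<lambda>x. eta_bar \<alpha> a1 a2 (wave_net \<alpha> U0 ws \<epsilon> x t)) =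
      (eta_bar \<alpha> a1 a2 U1 * L - eta_bar \<alpha> a1 a2 U0 * (- L)) + t * energy_production \<alpha> ws" for \<epsilon>
      using norm by (simp add: integral_unique)
    then show "((\<lambda>\<epsilon>. integral {-L..L} (\<lambda>x. eta_bar \<alpha> a1 a2 (wave_net \<alpha> U0 ws \<epsilon> x t))) \<longlongrightarrow>
      (eta_bar \<alpha> a1 a2 U1 * L - eta_bar \<alpha> a1 a2 U0 * (- L)) + t * energy_production \<alpha> ws) (at_right 0)"
      by simp
  qed
qed

lemma shadow_energy_rate:
  assumes \<alpha>: "0 < \<alpha>" and S: "shadow_wave \<alpha> U0 U1 c V" and L: "0 < L"
    and norm: "Q_bar \<alpha> a1 a2 c' U0 = 0" "Q_bar \<alpha> a1 a2 c' U1 = 0"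
  shows "has_energy_rate \<alpha> a1 a2 L U0 [Shadow U0 U1 c V] (energy_production \<alpha> [Shadow U0 U1 c V])"
proof -
  obtain \<kappa> where \<kappa>: "0 < \<kappa>" "((\<lambda>\<epsilon>. \<epsilon> * fst (V \<epsilon>)) \<longlongrightarrow> \<kappa>) (at_right 0)"
    "((\<lambda>\<epsilon>. \<epsilon> * (fst (V \<epsilon>) * snd (V \<epsilon>))) \<longlongrightarrow> \<kappa> * c) (at_right 0)"
    and jump: "(\<kappa>, \<kappa> * c) = c *\<^sub>R (conserved U1 - conserved U0) - (flux \<alpha> U1 - flux \<alpha> U0)"
    by (rule shadow_wave_jump [OF S])
  note lim = shadow_energy_limit [OF \<alpha> S \<kappa>]
  have Lim: "Lim (at_right 0) (\<lambda>\<epsilon>. \<epsilon> * eta \<alpha> (V \<epsilon>)) = \<kappa> * c\<^sup>2 / 2"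
    by (rule tendsto_Lim [OF _ lim]) simp
  have bar: "eta_bar \<alpha> a1 a2 U = eta \<alpha> U + a1 * fst U + a2 * (fst U * snd U)"
      "Q_bar \<alpha> a1 a2 c' U = Q \<alpha> U + a1 * (fst U * snd U) + a2 * snd (flux \<alpha> U) + c'" for U
    by (cases U; simp add: powr_minus_divide)+
  define h where "h = eta_bar \<alpha> a1 a2"
  define E where "E = \<kappa> * c\<^sup>2 / 2 + a1 * \<kappa> + a2 * (\<kappa> * c)"
  have "((\<lambda>\<epsilon>. \<epsilon> * eta \<alpha> (V \<epsilon>) + a1 * (\<epsilon> * fst (V \<epsilon>)) + a2 * (\<epsilon> * (fst (V \<epsilon>) * snd (V \<epsilon>)))) \<longlongrightarrow> E) (at_right 0)"
    unfolding E_def by (intro tendsto_intros lim \<kappa>)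
  then have E: "((\<lambda>\<epsilon>. \<epsilon> * h (V \<epsilon>)) \<longlongrightarrow> E) (at_right 0)"
    by (simp add: h_def bar algebra_simps)
  have rate: "c * (h U0 - h U1) + E = energy_production \<alpha> [Shadow U0 U1 c V]"
  proof -
    have j: "\<kappa> = c * (fst U1 - fst U0) - (fst U1 * snd U1 - fst U0 * snd U0)"
        "\<kappa> * c = c * (fst U1 * snd U1 - fst U0 * snd U0) - (snd (flux \<alpha> U1) - snd (flux \<alpha> U0))"
      using jump by (cases U0; cases U1; simp)+
    have "c * (a1 * fst U0 + a2 * (fst U0 * snd U0) - (a1 * fst U1 + a2 * (fst U1 * snd U1))) + a1 * \<kappa> + a2 * (\<kappa> * c) =
        - (a1 * (fst U1 * snd U1) + a2 * snd (flux \<alpha> U1)) + (a1 * (fst U0 * snd U0) + a2 * snd (flux \<alpha> U0))"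
      unfolding j(2) unfolding j(1) by (simp add: algebra_simps)
    then show ?thesis
      using norm unfolding bar by (simp add: energy_production_def Lim h_def bar E_def algebra_simps)
  qed
  \<comment> \<open>for \<open>\<epsilon> < 1\<close> both rays of the net stay in \<open>[-L, L]\<close> up to the time \<open>T\<close>\<close>
  define T where "T = L / (\<bar>c\<bar> + 1)"
  show ?thesis
  proof (rule has_energy_rate_affine)
    show "0 < T" using L by (simp add: T_def)
    fix t assume t: "t \<in> {0..T}"
    have bound: "\<bar>s * t\<bar> \<le> L" if "\<bar>s\<bar> \<le> \<bar>c\<bar> + 1" for s
    proof -
      have "\<bar>s\<bar> * t \<le> (\<bar>c\<bar> + 1) * T" using that t by (intro mult_mono) auto
      then show ?thesis using t by (simp add: abs_mult T_def)
    qed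
    have int: "integral {-L..L} (\<lambda>x. h (wave_net \<alpha> U0 [Shadow U0 U1 c V] \<epsilon> x t)) =
      h U0 * ((c - \<epsilon> / 2) * t + L) + t * (\<epsilon> * h (V \<epsilon>)) + h U1 * (L - (c + \<epsilon> / 2) * t)"
      if \<epsilon>: "0 < \<epsilon> \<and> \<epsilon> < 1" for \<epsilon>
    proof -
      define p q where "p = (c - \<epsilon> / 2) * t" and "q = (c + \<epsilon> / 2) * t"
      have pq: "- L \<le> p" "p \<le> q" "q \<le> L"
      proof -
        have "\<bar>c - \<epsilon> / 2\<bar> \<le> \<bar>c\<bar> + 1" "\<bar>c + \<epsilon> / 2\<bar> \<le> \<bar>c\<bar> + 1" using \<epsilon> by linarith+
        from this [THEN bound] show "- L \<le> p" "q \<le> L" by (simp_all add: p_def q_def abs_le_iff)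
        show "p \<le> q" unfolding p_def q_def using \<epsilon> t by (intro mult_right_mono) auto
      qed
      have eq: "h (wave_net \<alpha> U0 [Shadow U0 U1 c V] \<epsilon> x t) = (if x < p then h U0 else if x < q then h (V \<epsilon>) else h U1)" for x
        by (simp add: p_def q_def)
      have "(q - p) * h (V \<epsilon>) = t * (\<epsilon> * h (V \<epsilon>))" by (simp add: p_def q_def algebra_simps)
      moreover have "((\<lambda>x. h (V \<epsilon>)) has_integral (q - p) * h (V \<epsilon>)) {p..q}" "((\<lambda>x. h U1) has_integral (L - q) * h U1) {q..L}"
        using has_integral_const_real [of "h (V \<epsilon>)" p q] has_integral_const_real [of "h U1" q L] pq by simp_all
      from has_integral_three_pieces [OF pq this]
      have "integral {-L..L} (\<lambda>x. h (wave_net \<alpha> U0 [Shadow U0 U1 c V] \<epsilon> x t)) =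
          h U0 * (p - - L) + (q - p) * h (V \<epsilon>) + (L - q) * h U1"
        unfolding eq by (rule integral_unique)
      ultimately show ?thesis by (simp add: p_def q_def mult.commute)
    qed
    have "((\<lambda>\<epsilon>. h U0 * ((c - \<epsilon> / 2) * t + L) + t * (\<epsilon> * h (V \<epsilon>)) + h U1 * (L - (c + \<epsilon> / 2) * t)) \<longlongrightarrow>
        h U0 * (c * t + L) + t * E + h U1 * (L - c * t)) (at_right 0)"
      by (intro tendsto_intros tendsto_half_width E)
    also have "h U0 * (c * t + L) + t * E + h U1 * (L - c * t) = (h U0 + h U1) * L + t * energy_production \<alpha> [Shadow U0 U1 c V]"
      unfolding rate [symmetric] by (simp add: algebra_simps)
    finally show "((\<lambda>\<epsilon>. integral {-L..L} (\<lambda>x. eta_bar \<alpha> a1 a2 (wave_net \<alpha> U0 [Shadow U0 U1 c V] \<epsilon> x t))) \<longlongrightarrow>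
        (h U0 + h U1) * L + t * energy_production \<alpha> [Shadow U0 U1 c V]) (at_right 0)"
    proof (rule Lim_transform_eventually)
      have "\<forall>\<^sub>F \<epsilon> in at_right 0. 0 < \<epsilon> \<and> \<epsilon> < (1::real)"
        using eventually_at_right_less [of 0] eventually_at_right_field [of "\<lambda>x. x < 1" 0] by (auto simp: eventually_conj_iff intro: exI [of _ 1])
      then show "\<forall>\<^sub>F \<epsilon> in at_right 0. h U0 * ((c - \<epsilon> / 2) * t + L) + t * (\<epsilon> * h (V \<epsilon>)) + h U1 * (L - (c + \<epsilon> / 2) * t) =
          integral {-L..L} (\<lambda>x. eta_bar \<alpha> a1 a2 (wave_net \<alpha> U0 [Shadow U0 U1 c V] \<epsilon> x t))"
        by eventually_elim (use int in \<open>simp only: h_def\<close>)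
    qed
  qed
qed

lemma riemann_energy_rate:
  assumes \<alpha>: "0 < \<alpha>" and sol: "riemann_solution \<alpha> U0 U1 ws" and L: "0 < L"
    and norm: "Q_bar \<alpha> a1 a2 c U0 = 0" "Q_bar \<alpha> a1 a2 c U1 = 0"
  shows "has_energy_rate \<alpha> a1 a2 L U0 ws (energy_production \<alpha> ws)"
  using riemann_solution_dichotomy [OF \<alpha> sol]
proof
  assume "classical_solution \<alpha> U0 U1 ws"
  from classical_energy_rate [OF \<alpha> this L norm] show ?thesis .
next
  assume "shadow_solution \<alpha> U0 U1 ws"
  then obtain c' V where ws: "ws = [Shadow U0 U1 c' V]" by (auto simp: shadow_solution_def)
  with sol have "shadow_wave \<alpha> U0 U1 c' V" by (auto simp: riemann_solution_def)
  from shadow_energy_rate [OF \<alpha> this L norm] show ?thesis unfolding ws .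
qed

text \<open>The rate is the production whenever normalising constants exist, so the condition on the rates
follows from the one on the productions.\<close>

lemma energy_admissible_iff:
  assumes \<alpha>: "0 < \<alpha>"
  shows "energy_admissible \<alpha> U0 U1 ws \<longleftrightarrow> riemann_solution \<alpha> U0 U1 ws \<and>
    (\<forall>ws'. riemann_solution \<alpha> U0 U1 ws' \<longrightarrow> energy_production \<alpha> ws \<le> energy_production \<alpha> ws')"
  unfolding energy_admissible_def using riemann_energy_rate [OF \<alpha>] by meson

section \<open>The solution of the Riemann problem\<close>

theorem theorem2p1:
  fixes \<alpha> \<rho>0 \<rho>1 u0 u1 :: real
  assumes "0 < \<alpha>" and "\<alpha> < 1" and "\<rho>0 > 0" and "\<rho>1 > 0"
  shows "if u1 > u0 - \<rho>0 powr (- (1 + \<alpha>) / 2) - \<rho>1 powr (- (1 + \<alpha>) / 2)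
         then (\<exists>ws. classical_solution \<alpha> (\<rho>0, u0) (\<rho>1, u1) ws) \<and>
              (\<forall>ws. energy_admissible \<alpha> (\<rho>0, u0) (\<rho>1, u1) ws \<longleftrightarrow>
                    classical_solution \<alpha> (\<rho>0, u0) (\<rho>1, u1) ws)
         else (\<exists>ws. shadow_solution \<alpha> (\<rho>0, u0) (\<rho>1, u1) ws) \<and>
              (\<forall>ws. energy_admissible \<alpha> (\<rho>0, u0) (\<rho>1, u1) ws \<longleftrightarrow>
                    shadow_solution \<alpha> (\<rho>0, u0) (\<rho>1, u1) ws)"
proof -
  note \<alpha> = assms(1,2) and pos = assms(3,4)
  define U0 U1 where "U0 = (\<rho>0, u0)" and "U1 = (\<rho>1, u1)"
  have U: "0 < fst U0" "0 < fst U1" "0 < volume U0" "0 < volume U1"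
    using pos by (simp_all add: U0_def U1_def)
  \<comment> \<open>in terms of volumes, the hypothesis is the criterion of \<open>ex_middle_volume\<close>\<close>
  have threshold: "u1 > u0 - \<rho>0 powr (- (1 + \<alpha>) / 2) - \<rho>1 powr (- (1 + \<alpha>) / 2) \<longleftrightarrow>
      snd U0 - snd U1 < volume U0 powr ((1 + \<alpha>) / 2) + volume U1 powr ((1 + \<alpha>) / 2)"
    unfolding minus_divide_left [symmetric] powr_neg_volume [OF pos(1)] powr_neg_volume [OF pos(2)]
    by (auto simp: U0_def U1_def)
  note mid = ex_middle_volume [OF \<alpha>(1) U(3,4), of "snd U0 - snd U1"]
  have classical_iff: "(\<exists>ws. classical_solution \<alpha> U0 U1 ws) \<longleftrightarrow>
      snd U0 - snd U1 < volume U0 powr ((1 + \<alpha>) / 2) + volume U1 powr ((1 + \<alpha>) / 2)"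
    unfolding mid [symmetric]
    using classical_solution_middle_volume [OF \<alpha> U(1)] ex_classical_solution [OF \<alpha> U(1,2)] by metis
  have classical_eq: "energy_production \<alpha> ws = energy_production \<alpha> ws'"
    if "classical_solution \<alpha> U0 U1 ws" "classical_solution \<alpha> U0 U1 ws'" for ws ws'
    using classical_solution_middle_volume [OF \<alpha> U(1) that(1)]
      classical_solution_middle_volume [OF \<alpha> U(1) that(2)] middle_volume_unique [OF \<alpha>(1) U(3,4)] by metis
  have sh: "\<exists>c V. ws = [Shadow U0 U1 c V] \<and> admissible_wave \<alpha> (Shadow U0 U1 c V) \<and>
      energy_production \<alpha> ws = wave_production \<alpha> (Shadow U0 U1 c V)" if "shadow_solution \<alpha> U0 U1 ws" for ws
    using that by (auto simp: shadow_solution_def riemann_solution_def energy_production_def)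
  have shadow_eq: "energy_production \<alpha> ws = energy_production \<alpha> ws'"
    if "shadow_solution \<alpha> U0 U1 ws" "shadow_solution \<alpha> U0 U1 ws'" for ws ws'
    using sh [OF that(1)] sh [OF that(2)] shadow_production_unique [OF \<alpha>(1) pos]
    unfolding U0_def U1_def by (metis admissible_wave.simps(3))
  have less: "energy_production \<alpha> ws < energy_production \<alpha> ws'"
    if "classical_solution \<alpha> U0 U1 ws" "shadow_solution \<alpha> U0 U1 ws'" for ws ws'
    using sh [OF that(2)] classical_production_less_shadow [OF \<alpha> pos that(1) [unfolded U0_def U1_def]]
    unfolding U0_def U1_def by metis
  note adm = energy_admissible_iff [OF \<alpha>(1), of U0 U1]
  note dich = riemann_solution_dichotomy [OF \<alpha>(1), of U0 U1]
  have sol: "classical_solution \<alpha> U0 U1 ws \<Longrightarrow> riemann_solution \<alpha> U0 U1 ws"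
    "shadow_solution \<alpha> U0 U1 ws \<Longrightarrow> riemann_solution \<alpha> U0 U1 ws" for ws
    by (simp_all add: classical_solution_def shadow_solution_def)
  show ?thesis
    unfolding threshold U0_def [symmetric] U1_def [symmetric] classical_iff [symmetric]
  proof (split if_split, intro conjI impI)
    assume "\<exists>ws. classical_solution \<alpha> U0 U1 ws"
    then obtain ws0 where ws0: "classical_solution \<alpha> U0 U1 ws0" by blast
    then show "\<exists>ws. classical_solution \<alpha> U0 U1 ws" by blast
    show "\<forall>ws. energy_admissible \<alpha> U0 U1 ws \<longleftrightarrow> classical_solution \<alpha> U0 U1 ws"
      unfolding adm using dich sol less [OF ws0] less classical_eq sol(1) [OF ws0]
      by (metis less_imp_le not_le order_refl)
  next
    assume none: "\<not> (\<exists>ws. classical_solution \<alpha> U0 U1 ws)"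
    then have "(1 / \<rho>0) powr ((1 + \<alpha>) / 2) + (1 / \<rho>1) powr ((1 + \<alpha>) / 2) \<le> u0 - u1"
      unfolding classical_iff by (simp add: U0_def U1_def)
    from ex_overcompressive_shadow_wave [OF \<alpha> pos this] obtain c V where
      "admissible_wave \<alpha> (Shadow U0 U1 c V)" unfolding U0_def U1_def by blast
    then have "shadow_solution \<alpha> U0 U1 [Shadow U0 U1 c V]"
      by (simp add: shadow_solution_def riemann_solution_def separated_def)
    then show "\<exists>ws. shadow_solution \<alpha> U0 U1 ws" by blast
    show "\<forall>ws. energy_admissible \<alpha> U0 U1 ws \<longleftrightarrow> shadow_solution \<alpha> U0 U1 ws"
      unfolding adm using dich sol none shadow_eq by (metis order_refl)
  qed
qed

end
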